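(* Let $K$ be a field and let $\mathbb G$ be a functor of monoids such that $\mathbb A_{\mathbb G}$ is reflexive. (i) Let $\mathbb M,\mathbb M'$ be reflexive functors of $\mathbb G$-modules. Then a morphism of $\mathcal K$-modules $\mathbb M\to\mathbb M'$ is a morphism of $\mathbb G$-modules if and only if $\mathbb M(K)\to\mathbb M'(K)$ is a morphism of $\mathbb A_{\mathbb G}^*(K)$-modules. (ii) Let $\mathcal M$ be a $\mathbb G$-module, where $\mathcal M$ is the quasi-coherent module associated with a $K$-module $M$. Then the set of quasi-coherent $\mathbb G$-submodules of $\mathcal M$ is equal to the set of $\mathbb A_{\mathbb G}^*(K)$-submodules of $M$.
   Context: All functors are covariant functors on the category of commutative (associative, unital) $K$-algebras. $\mathcal K(S)=S$. A functor of $\mathcal K$-modules is a functor $\mathbb M$ with functorial $S$-module structures on $\mathbb M(S)$; functors of $\mathcal K$-algebras analogously. For a $K$-module $M$, $\mathcal M(S):=M\otimes_KS$ is the quasi-coherent module associated with $M$. $\mathbb{H}om_{\mathcal K}(\mathbb M,\mathbb M')(S):=\operatorname{Hom}_{\mathcal S}(\mathbb M_{|S},\mathbb M'_{|S})$ where $|S$ denotes restriction to commutative $S$-algebras, and $\mathbb M^*:=\mathbb{H}om_{\mathcal K}(\mathbb M,\mathcal K)$. $\mathbb M$ is reflexive if the canonical morphism $\mathbb M\to\mathbb M^{**}$ is an isomorphism. For a functor of sets $\mathbb X$, $\mathbb A_{\mathbb X}(S):=\operatorname{Hom}(\mathbb X_{|S},\mathcal K_{|S})$. There is a natural morphism $\mathbb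 G\to\mathbb A_{\mathbb G}^*$, $g\mapsto(f\mapsto f(g))$, and $\mathbb A_{\mathbb G}^*$ is endowed with the unique structure of functor of $\mathcal K$-algebras for which this is a morphism of functors of monoids (explicitly $(w\cdot w')(f)=w\big(g\mapsto w'(h\mapsto f(gh))\big)$). A functor of $\mathbb G$-modules is a functor of $\mathcal K$-modules $\mathbb M$ with a morphism of functors of monoids $\mathbb G\to\mathbb{E}nd_{\mathcal K}(\mathbb M)$. When $\mathbb M$ is reflexive (for instance quasi-coherent), the $\mathbb G$-action extends uniquely along $\mathbb G\to\mathbb A_{\mathbb G}^*$ to a structure of $\mathbb A_{\mathbb G}^*$-module on $\mathbb M$; this makes $\mathbb M(K)$ an $\mathbb A_{\mathbb G}^*(K)$-module. *)

theory Defs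
  imports "HOL-Algebra.Module" "HOL-Algebra.Free_Abelian_Groups"
begin

section \<open>Commutative algebras and scalar restriction\<close>

text \<open>
  A commutative \<open>B\<close>-algebra is a commutative ring \<open>S\<close> with a ring homomorphism \<open>smap S\<close> from
  \<open>B\<close> to \<open>S\<close>. All rings have their elements in one type \<open>'u\<close>, which plays the role of the
  universe; values of functors may lie in other types. Structure maps and homomorphisms are kept extensional throughout, so that they can be compared as HOL
  functions and scalar restriction is strictly associative and unital.
\<close>

record 'u calg = "'u ring" +
  smap :: "'u \<Rightarrow> 'u"

definition CAlg :: "('u, 'b) ring_scheme \<Rightarrow> 'u calg set" where
  "CAlg B = {S. cring S \<and> smap S \<in> ring_hom B S \<and> smap S \<in> extensional (carrier B)}"

definition alg_hom :: "('u, 'b) ring_scheme \<Rightarrow> 'u calg \<Rightarrow> 'u calg \<Rightarrow> ('u \<Rightarrow> 'u) set" where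
  "alg_hom B S T = {f. f \<in> ring_hom S T \<and> f \<in> extensional (carrier S)
                       \<and> compose (carrier B) f (smap S) = smap T}"

text \<open>\<open>self B\<close> is \<open>B\<close> as an algebra over itself; \<open>via B h T\<close> is \<open>T\<close> with scalars restricted along
  \<open>h\<close>; \<open>res K S T\<close> is the \<open>S\<close>-algebra \<open>T\<close> regarded as a \<open>K\<close>-algebra.\<close>

definition self :: "('u, 'b) ring_scheme \<Rightarrow> 'u calg" where
  "self B = \<lparr>carrier = carrier B, monoid.mult = monoid.mult B, monoid.one = monoid.one B,
             ring.zero = ring.zero B, ring.add = ring.add B, smap = (\<lambda>x\<in>carrier B. x)\<rparr>"

definition via :: "('u, 'b) ring_scheme \<Rightarrow> ('u \<Rightarrow> 'u) \<Rightarrow> 'u calg \<Rightarrow> 'u calg" where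
  "via B h T = T\<lparr>smap := compose (carrier B) (smap T) h\<rparr>"

definition res :: "('u, 'b) ring_scheme \<Rightarrow> 'u calg \<Rightarrow> 'u calg \<Rightarrow> 'u calg" where
  "res K S T = via K (smap S) T"


section \<open>Functors on commutative algebras\<close>

text \<open>\<open>'s\<close> is the type of the values (records with a carrier in \<open>'e\<close>); \<open>Mor F S T f\<close> is the map
  induced by \<open>f : S \<rightarrow> T\<close>, relevant only on the carrier of \<open>Obj F S\<close>.\<close>

record ('u, 's, 'e) alg_functor =
  Obj :: "'u calg \<Rightarrow> 's"
  Mor :: "'u calg \<Rightarrow> 'u calg \<Rightarrow> ('u \<Rightarrow> 'u) \<Rightarrow> 'e \<Rightarrow> 'e"

type_synonym ('u, 'g) mon_functor = "('u, 'g monoid, 'g) alg_functor"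
type_synonym ('u, 'm) mod_functor = "('u, ('u, 'm) module, 'm) alg_functor"

definition set_functor ::
  "('u, 'b) ring_scheme \<Rightarrow> ('u, ('e, 'x) partial_object_scheme, 'e) alg_functor \<Rightarrow> bool" where
  "set_functor B F \<longleftrightarrow>
     (\<forall>S\<in>CAlg B. \<forall>T\<in>CAlg B. \<forall>f\<in>alg_hom B S T.
        Mor F S T f \<in> carrier (Obj F S) \<rightarrow> carrier (Obj F T)) \<and>
     (\<forall>S\<in>CAlg B. \<forall>x\<in>carrier (Obj F S). Mor F S S (\<lambda>a\<in>carrier S. a) x = x) \<and>
     (\<forall>S\<in>CAlg B. \<forall>T\<in>CAlg B. \<forall>U\<in>CAlg B. \<forall>f\<in>alg_hom B S T. \<forall>g\<in>alg_hom B T U.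
        \<forall>x\<in>carrier (Obj F S). Mor F S U (compose (carrier S) g f) x = Mor F T U g (Mor F S T f x))"

definition monoid_functor :: "('u, 'b) ring_scheme \<Rightarrow> ('u, 'g) mon_functor \<Rightarrow> bool" where
  "monoid_functor B G \<longleftrightarrow> set_functor B G \<and>
     (\<forall>S\<in>CAlg B. monoid (Obj G S)) \<and>
     (\<forall>S\<in>CAlg B. \<forall>T\<in>CAlg B. \<forall>f\<in>alg_hom B S T.
        Mor G S T f \<in> hom (Obj G S) (Obj G T) \<and>
        Mor G S T f \<one>\<^bsub>Obj G S\<^esub> = \<one>\<^bsub>Obj G T\<^esub>)"

definition module_functor :: "('u, 'b) ring_scheme \<Rightarrow> ('u, 'm) mod_functor \<Rightarrow> bool" where
  "module_functor B M \<longleftrightarrow> set_functor B M \<and>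
     (\<forall>S\<in>CAlg B. module S (Obj M S)) \<and>
     (\<forall>S\<in>CAlg B. \<forall>T\<in>CAlg B. \<forall>f\<in>alg_hom B S T. \<forall>x\<in>carrier (Obj M S).
        (\<forall>y\<in>carrier (Obj M S).
           Mor M S T f (x \<oplus>\<^bsub>Obj M S\<^esub> y) = Mor M S T f x \<oplus>\<^bsub>Obj M T\<^esub> Mor M S T f y) \<and>
        (\<forall>s\<in>carrier S. Mor M S T f (s \<odot>\<^bsub>Obj M S\<^esub> x) = f s \<odot>\<^bsub>Obj M T\<^esub> Mor M S T f x))"

definition scal :: "('u, 'u) mod_functor" where
  "scal = \<lparr>Obj = (\<lambda>S. \<lparr>carrier = carrier S, monoid.mult = monoid.mult S, monoid.one = monoid.one S,
                        ring.zero = ring.zero S, ring.add = ring.add S, smult = monoid.mult S\<rparr>),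
           Mor = (\<lambda>S T f. f)\<rparr>"

definition restr ::
  "('u, 'b) ring_scheme \<Rightarrow> 'u calg \<Rightarrow> ('u, 's, 'e) alg_functor \<Rightarrow> ('u, 's, 'e) alg_functor" where
  "restr K S F = \<lparr>Obj = (\<lambda>T. Obj F (res K S T)), Mor = (\<lambda>T T'. Mor F (res K S T) (res K S T'))\<rparr>"


section \<open>Morphisms of functors\<close>

definition nat_trans ::
  "('u, 'b) ring_scheme \<Rightarrow> ('u, ('e, 'x) partial_object_scheme, 'e) alg_functor \<Rightarrow>
   ('u, ('d, 'y) partial_object_scheme, 'd) alg_functor \<Rightarrow> ('u calg \<Rightarrow> 'e \<Rightarrow> 'd) set" where
  "nat_trans B F F' =
     {\<eta> \<in> (\<Pi>\<^sub>E S\<in>CAlg B. carrier (Obj F S) \<rightarrow>\<^sub>E carrier (Obj F' S)).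
        \<forall>S\<in>CAlg B. \<forall>T\<in>CAlg B. \<forall>f\<in>alg_hom B S T. \<forall>x\<in>carrier (Obj F S).
          \<eta> T (Mor F S T f x) = Mor F' S T f (\<eta> S x)}"

definition lin_trans ::
  "('u, 'b) ring_scheme \<Rightarrow> ('u, 'm) mod_functor \<Rightarrow> ('u, 'n) mod_functor \<Rightarrow>
   ('u calg \<Rightarrow> 'm \<Rightarrow> 'n) set" where
  "lin_trans B M N =
     {\<eta> \<in> nat_trans B M N. \<forall>S\<in>CAlg B. \<forall>x\<in>carrier (Obj M S).
        (\<forall>y\<in>carrier (Obj M S). \<eta> S (x \<oplus>\<^bsub>Obj M S\<^esub> y) = \<eta> S x \<oplus>\<^bsub>Obj N S\<^esub> \<eta> S y) \<and>
        (\<forall>s\<in>carrier S. \<eta> S (s \<odot>\<^bsub>Obj M S\<^esub> x) = s \<odot>\<^bsub>Obj N S\<^esub> \<eta> S x)}"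

definition is_iso ::
  "('u, 'b) ring_scheme \<Rightarrow> ('u, 'm) mod_functor \<Rightarrow> ('u, 'n) mod_functor \<Rightarrow>
   ('u calg \<Rightarrow> 'm \<Rightarrow> 'n) \<Rightarrow> bool" where
  "is_iso B M N \<eta> \<longleftrightarrow> \<eta> \<in> lin_trans B M N \<and>
     (\<exists>\<theta>\<in>lin_trans B N M. \<forall>S\<in>CAlg B.
        (\<forall>x\<in>carrier (Obj M S). \<theta> S (\<eta> S x) = x) \<and> (\<forall>y\<in>carrier (Obj N S). \<eta> S (\<theta> S y) = y))"

definition monoid_trans ::
  "('u, 'b) ring_scheme \<Rightarrow> ('u, ('e, 'x) monoid_scheme, 'e) alg_functor \<Rightarrow>
   ('u, ('d, 'y) monoid_scheme, 'd) alg_functor \<Rightarrow> ('u calg \<Rightarrow> 'e \<Rightarrow> 'd) set" where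
  "monoid_trans B G H =
     {\<eta> \<in> nat_trans B G H. \<forall>S\<in>CAlg B.
        \<eta> S \<in> hom (Obj G S) (Obj H S) \<and> \<eta> S \<one>\<^bsub>Obj G S\<^esub> = \<one>\<^bsub>Obj H S\<^esub>}"

text \<open>For functors of (possibly noncommutative) algebras, the product is the field \<open>mult\<close> of the
  module record.\<close>

definition alg_trans ::
  "('u, 'b) ring_scheme \<Rightarrow> ('u, 'm) mod_functor \<Rightarrow> ('u, 'n) mod_functor \<Rightarrow>
   ('u calg \<Rightarrow> 'm \<Rightarrow> 'n) set" where
  "alg_trans B A A' = lin_trans B A A' \<inter> monoid_trans B A A'"


section \<open>Internal Hom, duals and reflexivity\<close>

text \<open>The ring fields \<open>mult\<close> and \<open>one\<close> of a mere module carry no meaning.\<close>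

definition HOM ::
  "('u, 'b) ring_scheme \<Rightarrow> ('u, 'm) mod_functor \<Rightarrow> ('u, 'n) mod_functor \<Rightarrow>
   ('u, 'u calg \<Rightarrow> 'm \<Rightarrow> 'n) mod_functor" where
  "HOM K M N =
    \<lparr>Obj = (\<lambda>S. \<lparr>carrier = lin_trans S (restr K S M) (restr K S N),
       monoid.mult = undefined, monoid.one = undefined,
       ring.zero = (\<lambda>T\<in>CAlg S. \<lambda>x\<in>carrier (Obj (restr K S M) T). \<zero>\<^bsub>Obj (restr K S N) T\<^esub>),
       ring.add = (\<lambda>\<eta> \<theta>. \<lambda>T\<in>CAlg S. \<lambda>x\<in>carrier (Obj (restr K S M) T).
                \<eta> T x \<oplus>\<^bsub>Obj (restr K S N) T\<^esub> \<theta> T x),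
       smult = (\<lambda>s \<eta>. \<lambda>T\<in>CAlg S. \<lambda>x\<in>carrier (Obj (restr K S M) T).
                  smap T s \<odot>\<^bsub>Obj (restr K S N) T\<^esub> \<eta> T x)\<rparr>),
     Mor = (\<lambda>S S' f \<eta>. \<lambda>T\<in>CAlg S'. \<eta> (via S f T))\<rparr>"

definition END ::
  "('u, 'b) ring_scheme \<Rightarrow> ('u, 'm) mod_functor \<Rightarrow> ('u, 'u calg \<Rightarrow> 'm \<Rightarrow> 'm) mod_functor" where
  "END K M =
    \<lparr>Obj = (\<lambda>S. (Obj (HOM K M M) S)
       \<lparr>monoid.mult := (\<lambda>\<eta> \<theta>. \<lambda>T\<in>CAlg S. compose (carrier (Obj (restr K S M) T)) (\<eta> T) (\<theta> T)),
        monoid.one := (\<lambda>T\<in>CAlg S. \<lambda>x\<in>carrier (Obj (restr K S M) T). x)\<rparr>),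
     Mor = Mor (HOM K M M)\<rparr>"

definition dual ::
  "('u, 'b) ring_scheme \<Rightarrow> ('u, 'm) mod_functor \<Rightarrow> ('u, 'u calg \<Rightarrow> 'm \<Rightarrow> 'u) mod_functor" where
  "dual K M = HOM K M scal"

text \<open>For \<open>m \<in> M(S)\<close>, an \<open>S\<close>-algebra \<open>T\<close> and \<open>\<phi> \<in> M\<^sup>*(T)\<close>: evaluate \<open>\<phi>\<close>, at the \<open>T\<close>-algebra \<open>T\<close>,
  on the image of \<open>m\<close> in \<open>M(T)\<close>.\<close>

definition bidual_map ::
  "('u, 'b) ring_scheme \<Rightarrow> ('u, 'm) mod_functor \<Rightarrow>
   'u calg \<Rightarrow> 'm \<Rightarrow> 'u calg \<Rightarrow> ('u calg \<Rightarrow> 'm \<Rightarrow> 'u) \<Rightarrow> 'u" where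
  "bidual_map K M = (\<lambda>S\<in>CAlg K. \<lambda>m\<in>carrier (Obj M S).
     \<lambda>T\<in>CAlg S. \<lambda>\<phi>\<in>carrier (Obj (restr K S (dual K M)) T).
       \<phi> (self T) (Mor M S (res K S T) (smap T) m))"

definition reflexive :: "('u, 'b) ring_scheme \<Rightarrow> ('u, 'm) mod_functor \<Rightarrow> bool" where
  "reflexive K M \<longleftrightarrow> is_iso K M (dual K (dual K M)) (bidual_map K M)"


section \<open>Functions on a functor and distributions\<close>

definition fun_functor ::
  "('u, 'b) ring_scheme \<Rightarrow> ('u, ('e, 'x) partial_object_scheme, 'e) alg_functor \<Rightarrow>
   ('u, 'u calg \<Rightarrow> 'e \<Rightarrow> 'u) mod_functor" where
  "fun_functor K X =
    \<lparr>Obj = (\<lambda>S. \<lparr>carrier = nat_trans S (restr K S X) (restr K S scal),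
       monoid.mult = (\<lambda>f h. \<lambda>T\<in>CAlg S. \<lambda>x\<in>carrier (Obj (restr K S X) T). f T x \<otimes>\<^bsub>T\<^esub> h T x),
       monoid.one = (\<lambda>T\<in>CAlg S. \<lambda>x\<in>carrier (Obj (restr K S X) T). \<one>\<^bsub>T\<^esub>),
       ring.zero = (\<lambda>T\<in>CAlg S. \<lambda>x\<in>carrier (Obj (restr K S X) T). \<zero>\<^bsub>T\<^esub>),
       ring.add = (\<lambda>f h. \<lambda>T\<in>CAlg S. \<lambda>x\<in>carrier (Obj (restr K S X) T). f T x \<oplus>\<^bsub>T\<^esub> h T x),
       smult = (\<lambda>s f. \<lambda>T\<in>CAlg S. \<lambda>x\<in>carrier (Obj (restr K S X) T). smap T s \<otimes>\<^bsub>T\<^esub> f T x)\<rparr>),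
     Mor = (\<lambda>S S' f \<eta>. \<lambda>T\<in>CAlg S'. \<eta> (via S f T))\<rparr>"

definition dirac ::
  "('u, 'b) ring_scheme \<Rightarrow> ('u, 'g) mon_functor \<Rightarrow>
   'u calg \<Rightarrow> 'g \<Rightarrow> 'u calg \<Rightarrow> ('u calg \<Rightarrow> 'g \<Rightarrow> 'u) \<Rightarrow> 'u" where
  "dirac K G = (\<lambda>S\<in>CAlg K. \<lambda>g\<in>carrier (Obj G S).
     \<lambda>T\<in>CAlg S. \<lambda>f\<in>carrier (Obj (restr K S (fun_functor K G)) T).
       f (self T) (Mor G S (res K S T) (smap T) g))"

text \<open>The product \<open>(w \<cdot> w')(f) = w (g \<mapsto> w' (h \<mapsto> f (g h)))\<close> of \<open>w, w' \<in> A\<^sub>G\<^sup>*(S)\<close>. Here \<open>T\<close> is an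
  \<open>S\<close>-algebra and \<open>f \<in> A\<^sub>G(T)\<close>; \<open>g \<in> G(U)\<close> for a \<open>T\<close>-algebra \<open>U\<close>; \<open>h \<in> G(V)\<close> for a \<open>U\<close>-algebra \<open>V\<close>.\<close>

definition convolution ::
  "('u, 'b) ring_scheme \<Rightarrow> ('u, 'g) mon_functor \<Rightarrow> 'u calg \<Rightarrow>
   ('u calg \<Rightarrow> ('u calg \<Rightarrow> 'g \<Rightarrow> 'u) \<Rightarrow> 'u) \<Rightarrow> ('u calg \<Rightarrow> ('u calg \<Rightarrow> 'g \<Rightarrow> 'u) \<Rightarrow> 'u) \<Rightarrow>
   'u calg \<Rightarrow> ('u calg \<Rightarrow> 'g \<Rightarrow> 'u) \<Rightarrow> 'u" where
  "convolution K G S w w' =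
     (\<lambda>T\<in>CAlg S. \<lambda>f\<in>carrier (Obj (restr K S (fun_functor K G)) T).
        w T (\<lambda>U\<in>CAlg T. \<lambda>g\<in>carrier (Obj G (res K (res K S T) U)).
          let U\<^sub>K = res K (res K S T) U in
          w' (res S T U) (\<lambda>V\<in>CAlg U. \<lambda>h\<in>carrier (Obj G (res K U\<^sub>K V)).
            f (res T U V) (Mor G U\<^sub>K (res K U\<^sub>K V) (smap V) g \<otimes>\<^bsub>Obj G (res K U\<^sub>K V)\<^esub> h))))"

definition dist_algebra ::
  "('u, 'b) ring_scheme \<Rightarrow> ('u, 'g) mon_functor \<Rightarrow>
   ('u, 'u calg \<Rightarrow> ('u calg \<Rightarrow> 'g \<Rightarrow> 'u) \<Rightarrow> 'u) mod_functor" where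
  "dist_algebra K G =
    \<lparr>Obj = (\<lambda>S. (Obj (dual K (fun_functor K G)) S)
       \<lparr>monoid.mult := convolution K G S, monoid.one := dirac K G S \<one>\<^bsub>Obj G S\<^esub>\<rparr>),
     Mor = Mor (dual K (fun_functor K G))\<rparr>"


section \<open>Functors of \<open>G\<close>-modules\<close>

text \<open>A functor of \<open>G\<close>-modules is a module functor \<open>M\<close> with some \<open>\<rho> \<in> monoid_trans K G (END K M)\<close>.
  The operator \<open>\<rho> S g\<close> is an endomorphism of the restriction of \<open>M\<close> to \<open>S\<close>-algebras; its action on
  \<open>M(S)\<close> itself is its component at the \<open>S\<close>-algebra \<open>S\<close>.\<close>

definition act :: "('u calg \<Rightarrow> 'a \<Rightarrow> 'u calg \<Rightarrow> 'm \<Rightarrow> 'm) \<Rightarrow> 'u calg \<Rightarrow> 'a \<Rightarrow> 'm \<Rightarrow> 'm" where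
  "act \<rho> S a m = \<rho> S a (self S) m"

definition G_morphism ::
  "('u, 'b) ring_scheme \<Rightarrow> ('u, 'g) mon_functor \<Rightarrow>
   ('u, 'm) mod_functor \<Rightarrow> ('u calg \<Rightarrow> 'g \<Rightarrow> 'u calg \<Rightarrow> 'm \<Rightarrow> 'm) \<Rightarrow>
   ('u, 'n) mod_functor \<Rightarrow> ('u calg \<Rightarrow> 'g \<Rightarrow> 'u calg \<Rightarrow> 'n \<Rightarrow> 'n) \<Rightarrow>
   ('u calg \<Rightarrow> 'm \<Rightarrow> 'n) \<Rightarrow> bool" where
  "G_morphism K G M \<rho> M' \<rho>' \<phi> \<longleftrightarrow> \<phi> \<in> lin_trans K M M' \<and>
     (\<forall>S\<in>CAlg K. \<forall>g\<in>carrier (Obj G S). \<forall>m\<in>carrier (Obj M S).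
        \<phi> S (act \<rho> S g m) = act \<rho>' S g (\<phi> S m))"

text \<open>The extension of \<open>\<rho>\<close> along \<open>dirac K G\<close> to a morphism of functors of algebras from \<open>A\<^sub>G\<^sup>*\<close> to
  the endomorphisms of \<open>M\<close>; it exists and is unique when \<open>A\<^sub>G\<close> and \<open>M\<close> are reflexive.\<close>

definition extension ::
  "('u, 'b) ring_scheme \<Rightarrow> ('u, 'g) mon_functor \<Rightarrow>
   ('u, 'm) mod_functor \<Rightarrow> ('u calg \<Rightarrow> 'g \<Rightarrow> 'u calg \<Rightarrow> 'm \<Rightarrow> 'm) \<Rightarrow>
   'u calg \<Rightarrow> ('u calg \<Rightarrow> ('u calg \<Rightarrow> 'g \<Rightarrow> 'u) \<Rightarrow> 'u) \<Rightarrow> 'u calg \<Rightarrow> 'm \<Rightarrow> 'm" where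
  "extension K G M \<rho> =
     (THE \<sigma>. \<sigma> \<in> alg_trans K (dist_algebra K G) (END K M) \<and>
        (\<forall>S\<in>CAlg K. \<forall>g\<in>carrier (Obj G S). \<sigma> S (dirac K G S g) = \<rho> S g))"

text \<open>Homomorphisms and submodules for an action \<open>a\<close> of a possibly noncommutative ring \<open>R\<close>.\<close>

definition act_hom ::
  "('r, 'x) ring_scheme \<Rightarrow> ('m, 'y) ring_scheme \<Rightarrow> ('r \<Rightarrow> 'm \<Rightarrow> 'm) \<Rightarrow>
   ('n, 'z) ring_scheme \<Rightarrow> ('r \<Rightarrow> 'n \<Rightarrow> 'n) \<Rightarrow> ('m \<Rightarrow> 'n) set" where
  "act_hom R M a N b = {h \<in> hom (add_monoid M) (add_monoid N).
     \<forall>r\<in>carrier R. \<forall>m\<in>carrier M. h (a r m) = b r (h m)}"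

definition act_submodules ::
  "('r, 'x) ring_scheme \<Rightarrow> ('m, 'y) ring_scheme \<Rightarrow> ('r \<Rightarrow> 'm \<Rightarrow> 'm) \<Rightarrow> 'm set set" where
  "act_submodules R M a =
     {N. subgroup N (add_monoid M) \<and> (\<forall>r\<in>carrier R. \<forall>n\<in>N. a r n \<in> N)}"


section \<open>Quasi-coherent modules\<close>

text \<open>\<open>M \<otimes>\<^sub>K S\<close> is the free abelian group on \<open>M \<times> S\<close> modulo the subgroup generated by the
  bilinearity relations.\<close>

type_synonym ('m, 'u) tensor_elt = "('m \<times> 'u \<Rightarrow>\<^sub>0 int) set"

definition pair_group :: "('u, 'm) module \<Rightarrow> 'u calg \<Rightarrow> ('m \<times> 'u \<Rightarrow>\<^sub>0 int) monoid" where
  "pair_group M S = free_Abelian_group (carrier M \<times> carrier S)"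

definition tensor_rels ::
  "('u, 'b) ring_scheme \<Rightarrow> ('u, 'm) module \<Rightarrow> 'u calg \<Rightarrow> ('m \<times> 'u \<Rightarrow>\<^sub>0 int) set" where
  "tensor_rels K M S = generate (pair_group M S)
     ({frag_of (m \<oplus>\<^bsub>M\<^esub> m', s) - frag_of (m, s) - frag_of (m', s) | m m' s.
         m \<in> carrier M \<and> m' \<in> carrier M \<and> s \<in> carrier S} \<union>
      {frag_of (m, s \<oplus>\<^bsub>S\<^esub> s') - frag_of (m, s) - frag_of (m, s') | m s s'.
         m \<in> carrier M \<and> s \<in> carrier S \<and> s' \<in> carrier S} \<union>
      {frag_of (k \<odot>\<^bsub>M\<^esub> m, s) - frag_of (m, smap S k \<otimes>\<^bsub>S\<^esub> s) | k m s.
         k \<in> carrier K \<and> m \<in> carrier M \<and> s \<in> carrier S})"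

definition tens ::
  "('u, 'b) ring_scheme \<Rightarrow> ('u, 'm) module \<Rightarrow> 'u calg \<Rightarrow> 'm \<Rightarrow> 'u \<Rightarrow> ('m, 'u) tensor_elt" where
  "tens K M S m s = tensor_rels K M S #>\<^bsub>pair_group M S\<^esub> frag_of (m, s)"

text \<open>The map on tensor products with \<open>m \<otimes> s \<mapsto> m \<otimes> h s\<close>. All of \<open>X\<close> is mapped into one coset,
  which is written as a union of cosets to avoid choosing a representative.\<close>

definition tensor_map ::
  "('u, 'b) ring_scheme \<Rightarrow> ('u, 'm) module \<Rightarrow> 'u calg \<Rightarrow> ('u \<Rightarrow> 'u) \<Rightarrow>
   ('m, 'u) tensor_elt \<Rightarrow> ('m, 'u) tensor_elt" where
  "tensor_map K M S h X =
     (\<Union>x\<in>X. tensor_rels K M S #>\<^bsub>pair_group M S\<^esub> frag_extend (\<lambda>(m, s). frag_of (m, h s)) x)"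

definition tensor ::
  "('u, 'b) ring_scheme \<Rightarrow> ('u, 'm) module \<Rightarrow> 'u calg \<Rightarrow> ('u, ('m, 'u) tensor_elt) module" where
  "tensor K M S = (let Q = pair_group M S Mod tensor_rels K M S in
     \<lparr>carrier = carrier Q, monoid.mult = undefined, monoid.one = undefined,
      ring.zero = monoid.one Q, ring.add = monoid.mult Q,
      smult = (\<lambda>s. tensor_map K M S (\<lambda>t. s \<otimes>\<^bsub>S\<^esub> t))\<rparr>)"

definition qcoh ::
  "('u, 'b) ring_scheme \<Rightarrow> ('u, 'm) module \<Rightarrow> ('u, ('m, 'u) tensor_elt) mod_functor" where
  "qcoh K M = \<lparr>Obj = tensor K M, Mor = (\<lambda>S T f. tensor_map K M T f)\<rparr>"

definition subfunctor ::
  "('u, 'm) mod_functor \<Rightarrow> ('u calg \<Rightarrow> 'm set) \<Rightarrow> ('u, 'm) mod_functor" where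
  "subfunctor M N = M\<lparr>Obj := (\<lambda>S. (Obj M S)\<lparr>carrier := N S\<rparr>)\<rparr>"

text \<open>The set of \<open>G\<close>-submodules of \<open>(M, \<rho>)\<close> that are quasi-coherent, that is, isomorphic to
  \<open>qcoh K P\<close> for some \<open>K\<close>-module \<open>P\<close>.\<close>

definition submodule_functors ::
  "('u, 'b) ring_scheme \<Rightarrow> ('u, 'm) mod_functor \<Rightarrow> ('u calg \<Rightarrow> 'm set) set" where
  "submodule_functors K M = {N \<in> extensional (CAlg K).
     (\<forall>S\<in>CAlg K. submodule (N S) S (Obj M S)) \<and>
     (\<forall>S\<in>CAlg K. \<forall>T\<in>CAlg K. \<forall>f\<in>alg_hom K S T. Mor M S T f ` N S \<subseteq> N T)}"

definition qcoh_G_submodules ::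
  "('u, 'b) ring_scheme \<Rightarrow> ('u, 'g) mon_functor \<Rightarrow> ('u, 'm) mod_functor \<Rightarrow>
   ('u calg \<Rightarrow> 'g \<Rightarrow> 'u calg \<Rightarrow> 'm \<Rightarrow> 'm) \<Rightarrow> ('u calg \<Rightarrow> 'm set) set" where
  "qcoh_G_submodules K G M \<rho> = {N \<in> submodule_functors K M.
     (\<forall>S\<in>CAlg K. \<forall>g\<in>carrier (Obj G S). \<forall>n\<in>N S. act \<rho> S g n \<in> N S) \<and>
     (\<exists>(P :: ('u, 'u) module) \<eta>. module K P \<and> is_iso K (qcoh K P) (subfunctor M N) \<eta>)}"

text \<open>\<open>M\<close> is identified with \<open>M \<otimes>\<^sub>K K\<close> by \<open>m \<mapsto> m \<otimes> 1\<close>. Accordingly, \<open>base_act\<close> transports an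
  action on \<open>M \<otimes>\<^sub>K K\<close> to \<open>M\<close>, and \<open>base_points\<close> turns a subfunctor \<open>N\<close> of the quasi-coherent module
  into the subset \<open>N(K)\<close> of \<open>M\<close>.\<close>

definition base_incl ::
  "('u, 'b) ring_scheme \<Rightarrow> ('u, 'm) module \<Rightarrow> 'm \<Rightarrow> ('m, 'u) tensor_elt" where
  "base_incl K M m = tens K M (self K) m \<one>\<^bsub>K\<^esub>"

definition base_act ::
  "('u, 'b) ring_scheme \<Rightarrow> ('u, 'm) module \<Rightarrow>
   ('a \<Rightarrow> ('m, 'u) tensor_elt \<Rightarrow> ('m, 'u) tensor_elt) \<Rightarrow> 'a \<Rightarrow> 'm \<Rightarrow> 'm" where
  "base_act K M a r m = inv_into (carrier M) (base_incl K M) (a r (base_incl K M m))"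

definition base_points ::
  "('u, 'b) ring_scheme \<Rightarrow> ('u, 'm) module \<Rightarrow> ('u calg \<Rightarrow> ('m, 'u) tensor_elt set) \<Rightarrow> 'm set" where
  "base_points K M N = {m \<in> carrier M. base_incl K M m \<in> N (self K)}"

text \<open>For a \<open>K\<close>-submodule \<open>N\<close> of \<open>M\<close>: the image of \<open>N \<otimes>\<^sub>K S\<close> in \<open>M \<otimes>\<^sub>K S\<close>, for every \<open>S\<close>.\<close>

definition qcoh_sub ::
  "('u, 'b) ring_scheme \<Rightarrow> ('u, 'm) module \<Rightarrow> 'm set \<Rightarrow> 'u calg \<Rightarrow> ('m, 'u) tensor_elt set" where
  "qcoh_sub K M N = (\<lambda>S\<in>CAlg K. (\<lambda>X. \<Union>x\<in>X. tensor_rels K M S #>\<^bsub>pair_group M S\<^esub> x)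
      ` carrier (tensor K (M\<lparr>carrier := N\<rparr>) S))"

end

theory Submission
  imports Defs
begin

text \<open>
  Since \<open>A\<^sub>G\<^sup>*\<^sup>* = A\<^sub>G\<close>, an element of \<open>A\<^sub>G\<^sup>*\<^sup>*(S)\<close> is determined by its values on Dirac distributions. For
  reflexive \<open>M\<close> the action of a distribution \<open>w\<close> is therefore characterised by
  \<open>\<mu> (w m) = w (g \<mapsto> \<mu> (g m))\<close> for all functionals \<open>\<mu>\<close>, and \<open>G\<close>-morphisms commute with it.

  For the converse, let \<open>K\<close> be a field. If \<open>n, n' \<in> N(S)\<close> have equal values under all of \<open>N\<^sup>*(K)\<close>, then
  their images have equal values under \<open>N\<^sup>*(V)\<close> for every \<open>S\<close>-algebra \<open>V\<close>: evaluate \<open>\<mu> \<in> N\<^sup>*(V)\<close> over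
  \<open>V \<otimes>\<^sub>K U\<close> and contract \<open>V\<close> with linear forms to obtain enough elements of \<open>N\<^sup>*(K)\<close>. Applied first to
  \<open>N = A\<^sub>G\<close> and then to \<open>N = M\<^sup>*\<close>, this turns linearity over \<open>A\<^sub>G\<^sup>*(K)\<close> on \<open>M(K)\<close> into equivariance.

  The image of \<open>N \<otimes> S\<close> in \<open>M \<otimes> S\<close> is cut out by the linear forms \<open>\<omega>\<close> on \<open>M\<close> that vanish on \<open>N\<close>. Hence
  stability of \<open>N\<close> under \<open>G\<close> and under \<open>A\<^sub>G\<^sup>*(K)\<close> both mean that the functions \<open>g \<mapsto> \<omega> (g n)\<close> vanish.

  The universe has to be infinite to contain the algebras \<open>V \<otimes>\<^sub>K U\<close> and the square-zero extensions that
  show quasi-coherent modules to be reflexive.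
\<close>

section \<open>Algebras over an algebra as arrows\<close>

text \<open>A Dirac distribution at \<open>g \<in> G(S)\<close> need not come from \<open>K\<close>,
  so linearity over distributions on \<open>K\<close> says nothing directly about \<open>g\<close>.
  Vectors show the same gap: the hypothesis in (i) concerns \<open>M(K)\<close> only, and a
  reflexive \<open>M\<close> need not be generated by its \<open>K\<close>-points. One lemma closes
  both gaps, because both concern points of a dual: distributions are the dual of
  \<open>A_G\<close>, and \<open>M\<close> is the dual of \<open>M*\<close>.

  The action of distributions is introduced by a description operator, so existence and uniqueness
  of the extension must both be settled before (i) becomes a statement about matrix coefficients
  \<open>g \<mapsto> \<mu> (g m)\<close>.

  In (ii), quasi-coherence makes a submodule recoverable from its \<open>K\<close>-points, while
  conversely flatness over a field makes the image of \<open>N \<otimes> S\<close> quasi-coherent.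
  No finiteness is available for \<open>M\<close>; bases are replaced by finite chains of
  one-generator enlargements.

  A functional on a quasi-coherent module over \<open>S\<close> is a linear map from
  \<open>M\<close> into the algebra \<open>S\<close>. A universal one therefore needs an algebra
  that contains \<open>M \<otimes> S\<close>, which is where square-zero extensions come
  from.\<close>

text \<open>An \<open>S\<close>-algebra is a \<open>K\<close>-algebra \<open>R\<close> with a morphism \<open>f : S \<rightarrow> R\<close>; as an \<open>S\<close>-algebra it is
  written \<open>along R f\<close>. Indexing the components of elements of \<open>Hom(X|S, Y|S)\<close> by such arrows
  collapses all nested restrictions of scalars.\<close>

definition along :: "'u calg \<Rightarrow> ('u \<Rightarrow> 'u) \<Rightarrow> 'u calg" where
  "along R f = R\<lparr>smap := f\<rparr>"

lemma along_sel [simp]: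
  "carrier (along R f) = carrier R" "monoid.mult (along R f) = monoid.mult R"
  "monoid.one (along R f) = monoid.one R" "ring.zero (along R f) = ring.zero R"
  "ring.add (along R f) = ring.add R" "smap (along R f) = f"
  by (simp_all add: along_def)

lemma along_smap [simp]: "along R (smap R) = R"
  by (simp add: along_def)

text \<open>Changing only the structure map produces a different record, so ring properties are
  transported field by field.\<close>

lemma cring_cong:
  assumes "cring S" "carrier S = carrier T" "monoid.mult S = monoid.mult T"
    "monoid.one S = monoid.one T" "ring.zero S = ring.zero T" "ring.add S = ring.add T"
  shows "cring T"
proof -
  interpret S: cring S by fact
  note eq = assms(2-6)[symmetric]
  show ?thesis
  proof (intro cringI abelian_groupI comm_monoidI)
    show "\<exists>y\<in>carrier T. y \<oplus>\<^bsub>T\<^esub> x = \<zero>\<^bsub>T\<^esub>" if "x \<in> carrier T" for x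
      using that S.l_neg S.a_inv_closed unfolding eq by blast
  qed (unfold eq, auto simp: S.a_ac S.m_ac S.l_distr S.r_distr)
qed

lemma cring_along [simp]: "cring (along R f) = cring R"
  by (metis cring_cong along_sel(1-5))

lemma ring_hom_along [simp]:
  "ring_hom B (along R f) = ring_hom B R" "ring_hom (along R f) B = ring_hom R B"
  by (simp_all add: ring_hom_def)

lemma self_sel [simp]:
  "carrier (self B) = carrier B" "monoid.mult (self B) = monoid.mult B"
  "monoid.one (self B) = monoid.one B" "ring.zero (self B) = ring.zero B"
  "ring.add (self B) = ring.add B" "smap (self B) = (\<lambda>x\<in>carrier B. x)"
  by (simp_all add: self_def)

lemma ring_hom_self [simp]:
  "ring_hom (self B) R = ring_hom B R" "ring_hom R (self B) = ring_hom R B"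
  by (simp_all add: ring_hom_def)

lemma self_eq_along: "self (S :: 'u calg) = along S (\<lambda>a\<in>carrier S. a)"
  by (simp add: self_def along_def)

lemma ring_hom_compose:
  assumes "f \<in> ring_hom R S" "g \<in> ring_hom S T" "cring R"
  shows "compose (carrier R) g f \<in> ring_hom R T"
proof -
  interpret cring R by fact
  show ?thesis
    using assms by (auto simp: ring_hom_def compose_def Pi_iff)
qed

lemma ring_hom_restrict_id: "cring R \<Longrightarrow> (\<lambda>a\<in>carrier R. a) \<in> ring_hom R R"
proof -
  assume "cring R"
  then interpret cring R .
  show ?thesis by (auto simp: ring_hom_def)
qed

lemma CAlgD:
  assumes "S \<in> CAlg B"
  shows "cring S" "smap S \<in> ring_hom B S" "smap S \<in> extensional (carrier B)"
    "\<And>x. x \<in> carrier B \<Longrightarrow> smap S x \<in> carrier S"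
  using assms by (auto simp: CAlg_def ring_hom_closed)

lemma alg_homD:
  assumes "f \<in> alg_hom B S T"
  shows "f \<in> ring_hom S T" "f \<in> extensional (carrier S)"
    "compose (carrier B) f (smap S) = smap T"
    "\<And>x. x \<in> carrier S \<Longrightarrow> f x \<in> carrier T" "f \<in> carrier S \<rightarrow> carrier T"
    "\<And>x y. x \<in> carrier S \<Longrightarrow> y \<in> carrier S \<Longrightarrow> f (x \<otimes>\<^bsub>S\<^esub> y) = f x \<otimes>\<^bsub>T\<^esub> f y"
    "\<And>x y. x \<in> carrier S \<Longrightarrow> y \<in> carrier S \<Longrightarrow> f (x \<oplus>\<^bsub>S\<^esub> y) = f x \<oplus>\<^bsub>T\<^esub> f y"
    "f \<one>\<^bsub>S\<^esub> = \<one>\<^bsub>T\<^esub>"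
    "\<And>k. k \<in> carrier B \<Longrightarrow> f (smap S k) = smap T k"
  using assms by (auto simp: alg_hom_def ring_hom_def compose_def fun_eq_iff split: if_splits)

locale base_ring =
  fixes K :: "'u ring"
  assumes cring_K: "cring K"
begin

abbreviation "A \<equiv> CAlg K"
abbreviation "hm \<equiv> alg_hom K"
abbreviation "ids \<equiv> (\<lambda>S. \<lambda>a\<in>carrier (S :: 'u calg). a)"
abbreviation "cmp \<equiv> (\<lambda>S :: 'u calg. compose (carrier S) :: ('u \<Rightarrow> 'u) \<Rightarrow> _)"

lemma self_A [simp]: "self K \<in> A"
  using cring_K ring_hom_restrict_id[OF cring_K]
  by (auto simp: CAlg_def intro: cring_cong)

lemma ids_hm [simp]: "S \<in> A \<Longrightarrow> ids S \<in> hm S S"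
  using ring_hom_restrict_id[of S] CAlgD[of S K]
  by (auto simp: alg_hom_def compose_def fun_eq_iff extensional_def)

lemma cmp_hm [simp]:
  assumes "f \<in> hm S T" "g \<in> hm T U" "S \<in> A"
  shows "cmp S g f \<in> hm S U"
proof -
  have "compose (carrier K) (cmp S g f) (smap S) = compose (carrier K) g (compose (carrier K) f (smap S))"
    using CAlgD[OF assms(3)] by (auto simp: compose_def)
  then show ?thesis
    using ring_hom_compose[of f S T g U] CAlgD(1)[OF assms(3)] alg_homD(1,3)[OF assms(1)]
      alg_homD(1,3)[OF assms(2)] by (simp add: alg_hom_def)
qed

lemma cmp_app [simp]: "x \<in> carrier S \<Longrightarrow> cmp S g f x = g (f x)"
  by (simp add: compose_def)

lemma cmp_assoc: "f \<in> hm S T \<Longrightarrow> cmp S h (cmp S g f) = cmp S (cmp T h g) f"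
  by (rule compose_assoc) (rule alg_homD)

lemma cmp_ids [simp]:
  assumes "f \<in> hm S T"
  shows "cmp S (ids T) f = f" "cmp S f (ids S) = f"
  using alg_homD(2,5)[OF assms] by (blast intro: Id_compose compose_Id)+

lemma smap_hm [simp]: "S \<in> A \<Longrightarrow> smap S \<in> hm (self K) S"
  using CAlgD[of S K] by (auto simp: alg_hom_def compose_def fun_eq_iff extensional_def)

text \<open>\<open>self K\<close> is initial: compatibility with the structure maps leaves no
  choice.\<close>

lemma hm_self: "f \<in> hm (self K) S \<Longrightarrow> f = smap S"
  using compose_Id[of f "carrier K"] alg_homD(2,3,5)[of f K "self K" S] by simp

lemma res_sel [simp]:
  "carrier (res K S T) = carrier T" "monoid.mult (res K S T) = monoid.mult T"
  "monoid.one (res K S T) = monoid.one T" "ring.zero (res K S T) = ring.zero T"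
  "ring.add (res K S T) = ring.add T"
  by (simp_all add: res_def via_def)

lemma along_res [simp]: "along (res K S T) (smap T) = T"
  by (simp add: res_def via_def along_def)

lemma along_CAlg [simp]: "R \<in> A \<Longrightarrow> f \<in> hm S R \<Longrightarrow> along R f \<in> CAlg S"
  using alg_homD[of f K S R] by (auto simp: CAlg_def)

lemma res_along [simp]: "R \<in> A \<Longrightarrow> f \<in> hm S R \<Longrightarrow> res K S (along R f) = R"
  using alg_homD[of f K S R] by (simp add: res_def via_def along_def)

text \<open>With \<open>along_CAlg\<close> and \<open>res_along\<close> this makes
  \<open>S\<close>-algebras and arrows out of \<open>S\<close> correspond strictly, not just up to
  isomorphism.\<close>

lemma res_A:
  assumes "S \<in> A" "T \<in> CAlg S"
  shows "res K S T \<in> A" "smap T \<in> hm S (res K S T)" "along (res K S T) (smap T) = T"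
proof -
  have 1: "res K S T = along T (compose (carrier K) (smap T) (smap S))"
    by (simp add: res_def via_def along_def)
  show "along (res K S T) (smap T) = T"
    using 1 by simp
  show "res K S T \<in> A"
    unfolding 1 using ring_hom_compose[of "smap S" K S "smap T" T] CAlgD[OF assms(1)] CAlgD[OF assms(2)]
      cring_K by (simp add: CAlg_def)
  show "smap T \<in> hm S (res K S T)"
    unfolding 1 using CAlgD[OF assms(2)] by (simp add: alg_hom_def)
qed

lemma ball_CAlg: "S \<in> A \<Longrightarrow> (\<forall>T\<in>CAlg S. P T) \<longleftrightarrow> (\<forall>R\<in>A. \<forall>f\<in>hm S R. P (along R f))"
  using res_A[of S] along_CAlg by metis

text \<open>Morphisms of \<open>S\<close>-algebras are commuting triangles under \<open>S\<close>;
  compatibility with \<open>K\<close> follows by composing the triangle with the structure map of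
  \<open>S\<close>.\<close>

lemma alg_hom_along:
  assumes "R \<in> A" "Q \<in> A" "f \<in> hm S R" "g \<in> hm S Q" "S \<in> A"
  shows "h \<in> alg_hom S (along R f) (along Q g) \<longleftrightarrow> h \<in> hm R Q \<and> cmp S h f = g"
proof -
  have "compose (carrier K) h (smap R) = smap Q" if "cmp S h f = g"
  proof -
    have "compose (carrier K) h (smap R) = compose (carrier K) h (compose (carrier K) f (smap S))"
      by (simp add: alg_homD(3)[OF assms(3)])
    also have "\<dots> = compose (carrier K) (cmp S h f) (smap S)"
      using CAlgD(4)[OF assms(5)] by (auto simp: compose_def)
    finally show ?thesis
      using that alg_homD(3)[OF assms(4)] by simp
  qed
  then show ?thesis
    by (auto simp: alg_hom_def)
qed

lemma via_along [simp]: "via S f (along R g) = along R (cmp S g f)"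
  by (simp add: via_def along_def)

end

section \<open>Functors and their morphisms\<close>

lemma restr_sel [simp]:
  "Obj (restr K S F) T = Obj F (res K S T)"
  "Mor (restr K S F) T T' = Mor F (res K S T) (res K S T')"
  by (simp_all add: restr_def)

lemma scal_sel [simp]:
  "carrier (Obj scal S) = carrier S" "ring.add (Obj scal S) = ring.add S"
  "ring.zero (Obj scal S) = ring.zero S"
  "smult (Obj scal S) = monoid.mult S" "Mor scal S T f = f"
  by (simp_all add: scal_def)

lemma set_functorD:
  assumes "set_functor B F" "S \<in> CAlg B"
  shows "\<And>T f x. T \<in> CAlg B \<Longrightarrow> f \<in> alg_hom B S T \<Longrightarrow> x \<in> carrier (Obj F S) \<Longrightarrow>
      Mor F S T f x \<in> carrier (Obj F T)"
    "\<And>x. x \<in> carrier (Obj F S) \<Longrightarrow> Mor F S S (\<lambda>a\<in>carrier S. a) x = x"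
    "\<And>T U f g x. T \<in> CAlg B \<Longrightarrow> U \<in> CAlg B \<Longrightarrow> f \<in> alg_hom B S T \<Longrightarrow> g \<in> alg_hom B T U \<Longrightarrow>
      x \<in> carrier (Obj F S) \<Longrightarrow> Mor F S U (compose (carrier S) g f) x = Mor F T U g (Mor F S T f x)"
  using assms unfolding set_functor_def by blast+

text \<open>The part of \<open>module_functor\<close> that is used for arguments of internal Homs; unlike the module
  axioms it is immediate for duals and for \<open>fun_functor\<close>.\<close>

definition linear_functor :: "('u, 'b) ring_scheme \<Rightarrow> ('u, 'm) mod_functor \<Rightarrow> bool" where
  "linear_functor B M \<longleftrightarrow> set_functor B M \<and>
     (\<forall>S\<in>CAlg B. \<forall>x\<in>carrier (Obj M S).
        (\<forall>y\<in>carrier (Obj M S). x \<oplus>\<^bsub>Obj M S\<^esub> y \<in> carrier (Obj M S)) \<and>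
        (\<forall>s\<in>carrier S. s \<odot>\<^bsub>Obj M S\<^esub> x \<in> carrier (Obj M S))) \<and>
     (\<forall>S\<in>CAlg B. \<forall>T\<in>CAlg B. \<forall>f\<in>alg_hom B S T. \<forall>x\<in>carrier (Obj M S).
        (\<forall>y\<in>carrier (Obj M S).
           Mor M S T f (x \<oplus>\<^bsub>Obj M S\<^esub> y) = Mor M S T f x \<oplus>\<^bsub>Obj M T\<^esub> Mor M S T f y) \<and>
        (\<forall>s\<in>carrier S. Mor M S T f (s \<odot>\<^bsub>Obj M S\<^esub> x) = f s \<odot>\<^bsub>Obj M T\<^esub> Mor M S T f x))"

lemma module_functor_imp_linear: "module_functor B M \<Longrightarrow> linear_functor B M"
  unfolding module_functor_def linear_functor_def
  by (auto simp: module_def abelian_group_def abelian_monoid.a_closed module_axioms_def)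

lemma linear_functorD:
  assumes "linear_functor B M" "S \<in> CAlg B"
  shows "\<And>x y. x \<in> carrier (Obj M S) \<Longrightarrow> y \<in> carrier (Obj M S) \<Longrightarrow> x \<oplus>\<^bsub>Obj M S\<^esub> y \<in> carrier (Obj M S)"
    "\<And>s x. s \<in> carrier S \<Longrightarrow> x \<in> carrier (Obj M S) \<Longrightarrow> s \<odot>\<^bsub>Obj M S\<^esub> x \<in> carrier (Obj M S)"
    "\<And>T f x y. T \<in> CAlg B \<Longrightarrow> f \<in> alg_hom B S T \<Longrightarrow> x \<in> carrier (Obj M S) \<Longrightarrow> y \<in> carrier (Obj M S) \<Longrightarrow>
      Mor M S T f (x \<oplus>\<^bsub>Obj M S\<^esub> y) = Mor M S T f x \<oplus>\<^bsub>Obj M T\<^esub> Mor M S T f y"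
    "\<And>T f s x. T \<in> CAlg B \<Longrightarrow> f \<in> alg_hom B S T \<Longrightarrow> x \<in> carrier (Obj M S) \<Longrightarrow> s \<in> carrier S \<Longrightarrow>
      Mor M S T f (s \<odot>\<^bsub>Obj M S\<^esub> x) = f s \<odot>\<^bsub>Obj M T\<^esub> Mor M S T f x"
    "\<And>T f x. T \<in> CAlg B \<Longrightarrow> f \<in> alg_hom B S T \<Longrightarrow> x \<in> carrier (Obj M S) \<Longrightarrow>
      Mor M S T f x \<in> carrier (Obj M T)"
    "\<And>x. x \<in> carrier (Obj M S) \<Longrightarrow> Mor M S S (\<lambda>a\<in>carrier S. a) x = x"
    "\<And>T U f g x. T \<in> CAlg B \<Longrightarrow> U \<in> CAlg B \<Longrightarrow> f \<in> alg_hom B S T \<Longrightarrow> g \<in> alg_hom B T U \<Longrightarrow>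
      x \<in> carrier (Obj M S) \<Longrightarrow> Mor M S U (compose (carrier S) g f) x = Mor M T U g (Mor M S T f x)"
  using assms set_functorD[of B M S] unfolding linear_functor_def by blast+

lemma monoid_functorD:
  assumes "monoid_functor B G" "S \<in> CAlg B"
  shows "set_functor B G" "monoid (Obj G S)"
    "\<And>T f x. T \<in> CAlg B \<Longrightarrow> f \<in> alg_hom B S T \<Longrightarrow> x \<in> carrier (Obj G S) \<Longrightarrow>
      Mor G S T f x \<in> carrier (Obj G T)"
    "\<And>x. x \<in> carrier (Obj G S) \<Longrightarrow> Mor G S S (\<lambda>a\<in>carrier S. a) x = x"
    "\<And>T U f g x. T \<in> CAlg B \<Longrightarrow> U \<in> CAlg B \<Longrightarrow> f \<in> alg_hom B S T \<Longrightarrow> g \<in> alg_hom B T U \<Longrightarrow>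
      x \<in> carrier (Obj G S) \<Longrightarrow> Mor G S U (compose (carrier S) g f) x = Mor G T U g (Mor G S T f x)"
    "\<And>T f x y. T \<in> CAlg B \<Longrightarrow> f \<in> alg_hom B S T \<Longrightarrow> x \<in> carrier (Obj G S) \<Longrightarrow> y \<in> carrier (Obj G S) \<Longrightarrow>
      Mor G S T f (x \<otimes>\<^bsub>Obj G S\<^esub> y) = Mor G S T f x \<otimes>\<^bsub>Obj G T\<^esub> Mor G S T f y"
    "\<And>T f. T \<in> CAlg B \<Longrightarrow> f \<in> alg_hom B S T \<Longrightarrow> Mor G S T f \<one>\<^bsub>Obj G S\<^esub> = \<one>\<^bsub>Obj G T\<^esub>"
  using assms set_functorD[of B G S] unfolding monoid_functor_def by (blast dest: hom_mult)+

section \<open>Natural families indexed by arrows out of S\<close>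

context base_ring
begin

text \<open>Builds the extensional family over \<open>CAlg S\<close> from components
  \<open>p R f\<close> given at arrows \<open>f : S \<rightarrow> R\<close>. Nearly all elements of
  internal Homs below are produced in this way.\<close>

definition fam where
  "fam S X p = (\<lambda>T\<in>CAlg S. \<lambda>x\<in>carrier (Obj X (res K S T)). p (res K S T) (smap T) x)"

lemma fam_app [simp]:
  "R \<in> A \<Longrightarrow> f \<in> hm S R \<Longrightarrow> x \<in> carrier (Obj X R) \<Longrightarrow> fam S X p (along R f) x = p R f x"
  by (simp add: fam_def)

lemma fam_cong:
  assumes "S \<in> A" "\<And>R f x. R \<in> A \<Longrightarrow> f \<in> hm S R \<Longrightarrow> x \<in> carrier (Obj X R) \<Longrightarrow> p R f x = q R f x"
  shows "fam S X p = fam S X q"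
  using assms res_A[of S] unfolding fam_def by (intro restrict_ext) auto

text \<open>A morphism under \<open>S\<close> from \<open>f\<close> to another arrow is an
  \<open>h\<close> whose composite with \<open>f\<close> is that arrow, so the target arrow can be
  substituted away and naturality mentions only \<open>f\<close> and \<open>h\<close>.\<close>

lemma nat_iff:
  assumes "S \<in> A"
  shows "\<eta> \<in> nat_trans S (restr K S X) (restr K S Y) \<longleftrightarrow>
    \<eta> \<in> extensional (CAlg S) \<and>
    (\<forall>R\<in>A. \<forall>f\<in>hm S R. \<eta> (along R f) \<in> carrier (Obj X R) \<rightarrow>\<^sub>E carrier (Obj Y R)) \<and>
    (\<forall>R\<in>A. \<forall>Q\<in>A. \<forall>f\<in>hm S R. \<forall>h\<in>hm R Q. \<forall>x\<in>carrier (Obj X R).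
       \<eta> (along Q (cmp S h f)) (Mor X R Q h x) = Mor Y R Q h (\<eta> (along R f) x))"
proof -
  have 1: "\<eta> \<in> (\<Pi>\<^sub>E T\<in>CAlg S. carrier (Obj X (res K S T)) \<rightarrow>\<^sub>E carrier (Obj Y (res K S T))) \<longleftrightarrow>
     \<eta> \<in> extensional (CAlg S) \<and>
    (\<forall>R\<in>A. \<forall>f\<in>hm S R. \<eta> (along R f) \<in> carrier (Obj X R) \<rightarrow>\<^sub>E carrier (Obj Y R))"
    unfolding PiE_iff[of \<eta> "CAlg S"] ball_CAlg[OF assms] using assms by auto
  show ?thesis
    unfolding nat_trans_def mem_Collect_eq restr_sel 1 ball_CAlg[OF assms]
    using assms by (auto simp: alg_hom_along)
qed

lemma nat_transD:
  assumes "\<eta> \<in> nat_trans S (restr K S X) (restr K S Y)" "S \<in> A" "R \<in> A" "f \<in> hm S R"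
  shows "\<And>x. x \<in> carrier (Obj X R) \<Longrightarrow> \<eta> (along R f) x \<in> carrier (Obj Y R)"
    "\<And>Q h x. Q \<in> A \<Longrightarrow> h \<in> hm R Q \<Longrightarrow> x \<in> carrier (Obj X R) \<Longrightarrow>
       \<eta> (along Q (cmp S h f)) (Mor X R Q h x) = Mor Y R Q h (\<eta> (along R f) x)"
  using assms unfolding nat_iff[OF assms(2)] by (auto simp: PiE_iff)

lemma nat_trans_ext:
  assumes "\<eta> \<in> nat_trans S (restr K S X) (restr K S Y)" "\<theta> \<in> nat_trans S (restr K S X) (restr K S Y')"
    "S \<in> A" "\<And>R f x. R \<in> A \<Longrightarrow> f \<in> hm S R \<Longrightarrow> x \<in> carrier (Obj X R) \<Longrightarrow> \<eta> (along R f) x = \<theta> (along R f) x"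
  shows "\<eta> = \<theta>"
proof (rule extensionalityI)
  show "\<eta> \<in> extensional (CAlg S)" "\<theta> \<in> extensional (CAlg S)"
    using assms by (simp_all add: nat_iff)
  fix T assume "T \<in> CAlg S"
  then have T: "res K S T \<in> A" "smap T \<in> hm S (res K S T)" "along (res K S T) (smap T) = T"
    using res_A assms(3) by auto
  show "\<eta> T = \<theta> T"
  proof (rule extensionalityI)
    have "\<eta> (along R f) \<in> extensional (carrier (Obj X R))" "\<theta> (along R f) \<in> extensional (carrier (Obj X R))"
      if "R \<in> A" "f \<in> hm S R" for R f
      using assms(1,2) that unfolding nat_iff[OF assms(3)] PiE_def by blast+
    from this[OF T(1,2)] show "\<eta> T \<in> extensional (carrier (Obj X (res K S T)))"
      "\<theta> T \<in> extensional (carrier (Obj X (res K S T)))"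
      unfolding T(3) .
  qed (use assms(4)[OF T(1,2)] T(3) in simp)
qed

lemma fam_nat:
  assumes "S \<in> A" "set_functor K X"
    "\<And>R f x. R \<in> A \<Longrightarrow> f \<in> hm S R \<Longrightarrow> x \<in> carrier (Obj X R) \<Longrightarrow> p R f x \<in> carrier (Obj Y R)"
    "\<And>R Q f h x. R \<in> A \<Longrightarrow> Q \<in> A \<Longrightarrow> f \<in> hm S R \<Longrightarrow> h \<in> hm R Q \<Longrightarrow> x \<in> carrier (Obj X R) \<Longrightarrow>
       p Q (cmp S h f) (Mor X R Q h x) = Mor Y R Q h (p R f x)"
  shows "fam S X p \<in> nat_trans S (restr K S X) (restr K S Y)"
  unfolding nat_iff[OF assms(1)]
proof (intro conjI ballI)
  show "fam S X p \<in> extensional (CAlg S)" by (simp add: fam_def)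
  show "fam S X p (along R f) \<in> carrier (Obj X R) \<rightarrow>\<^sub>E carrier (Obj Y R)" if "R \<in> A" "f \<in> hm S R" for R f
    using assms that by (auto simp: PiE_iff) (simp add: fam_def)
  show "fam S X p (along Q (cmp S h f)) (Mor X R Q h x) = Mor Y R Q h (fam S X p (along R f) x)"
    if "R \<in> A" "Q \<in> A" "f \<in> hm S R" "h \<in> hm R Q" "x \<in> carrier (Obj X R)" for R Q f h x
    using assms that by (simp add: set_functorD)
qed

section \<open>Elements of internal Homs and duals\<close>

lemma carrier_HOM: "carrier (Obj (HOM K M N) S) = lin_trans S (restr K S M) (restr K S N)"
  by (simp add: HOM_def)

lemma lin_iff:
  assumes "S \<in> A"
  shows "\<eta> \<in> lin_trans S (restr K S M) (restr K S N) \<longleftrightarrow>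
    \<eta> \<in> nat_trans S (restr K S M) (restr K S N) \<and>
    (\<forall>R\<in>A. \<forall>f\<in>hm S R. \<forall>x\<in>carrier (Obj M R).
      (\<forall>y\<in>carrier (Obj M R). \<eta> (along R f) (x \<oplus>\<^bsub>Obj M R\<^esub> y) = \<eta> (along R f) x \<oplus>\<^bsub>Obj N R\<^esub> \<eta> (along R f) y) \<and>
      (\<forall>s\<in>carrier R. \<eta> (along R f) (s \<odot>\<^bsub>Obj M R\<^esub> x) = s \<odot>\<^bsub>Obj N R\<^esub> \<eta> (along R f) x))"
  unfolding lin_trans_def mem_Collect_eq restr_sel ball_CAlg[OF assms] using assms by auto

lemma HOM_D:
  assumes "\<eta> \<in> carrier (Obj (HOM K M N) S)" "S \<in> A" "R \<in> A" "f \<in> hm S R"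
  shows "\<And>x. x \<in> carrier (Obj M R) \<Longrightarrow> \<eta> (along R f) x \<in> carrier (Obj N R)"
    "\<And>Q h x. Q \<in> A \<Longrightarrow> h \<in> hm R Q \<Longrightarrow> x \<in> carrier (Obj M R) \<Longrightarrow>
       \<eta> (along Q (cmp S h f)) (Mor M R Q h x) = Mor N R Q h (\<eta> (along R f) x)"
    "\<And>x y. x \<in> carrier (Obj M R) \<Longrightarrow> y \<in> carrier (Obj M R) \<Longrightarrow>
       \<eta> (along R f) (x \<oplus>\<^bsub>Obj M R\<^esub> y) = \<eta> (along R f) x \<oplus>\<^bsub>Obj N R\<^esub> \<eta> (along R f) y"
    "\<And>s x. s \<in> carrier R \<Longrightarrow> x \<in> carrier (Obj M R) \<Longrightarrow>
       \<eta> (along R f) (s \<odot>\<^bsub>Obj M R\<^esub> x) = s \<odot>\<^bsub>Obj N R\<^esub> \<eta> (along R f) x"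
  using assms unfolding carrier_HOM lin_iff[OF assms(2)] by (auto simp: nat_transD)

lemma HOM_ext:
  assumes "\<eta> \<in> carrier (Obj (HOM K M N) S)" "\<theta> \<in> carrier (Obj (HOM K M N) S)"
    "S \<in> A" "\<And>R f x. R \<in> A \<Longrightarrow> f \<in> hm S R \<Longrightarrow> x \<in> carrier (Obj M R) \<Longrightarrow> \<eta> (along R f) x = \<theta> (along R f) x"
  shows "\<eta> = \<theta>"
  using assms nat_trans_ext unfolding carrier_HOM lin_iff[OF assms(3)] by blast

lemma fam_HOM:
  assumes "S \<in> A" "linear_functor K M"
    "\<And>R f x. R \<in> A \<Longrightarrow> f \<in> hm S R \<Longrightarrow> x \<in> carrier (Obj M R) \<Longrightarrow> p R f x \<in> carrier (Obj N R)"
    "\<And>R Q f h x. R \<in> A \<Longrightarrow> Q \<in> A \<Longrightarrow> f \<in> hm S R \<Longrightarrow> h \<in> hm R Q \<Longrightarrow> x \<in> carrier (Obj M R) \<Longrightarrow>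
       p Q (cmp S h f) (Mor M R Q h x) = Mor N R Q h (p R f x)"
    "\<And>R f x y. R \<in> A \<Longrightarrow> f \<in> hm S R \<Longrightarrow> x \<in> carrier (Obj M R) \<Longrightarrow> y \<in> carrier (Obj M R) \<Longrightarrow>
       p R f (x \<oplus>\<^bsub>Obj M R\<^esub> y) = p R f x \<oplus>\<^bsub>Obj N R\<^esub> p R f y"
    "\<And>R f s x. R \<in> A \<Longrightarrow> f \<in> hm S R \<Longrightarrow> s \<in> carrier R \<Longrightarrow> x \<in> carrier (Obj M R) \<Longrightarrow>
       p R f (s \<odot>\<^bsub>Obj M R\<^esub> x) = s \<odot>\<^bsub>Obj N R\<^esub> p R f x"
  shows "fam S M p \<in> carrier (Obj (HOM K M N) S)"
  unfolding carrier_HOM lin_iff[OF assms(1)]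
proof (intro conjI ballI)
  show "fam S M p \<in> nat_trans S (restr K S M) (restr K S N)"
    using assms(2) by (intro fam_nat assms) (auto simp: linear_functor_def)
qed (use assms linear_functorD(1,2)[OF assms(2)] in simp_all)

lemma Mor_HOM [simp]:
  "Q \<in> A \<Longrightarrow> g \<in> hm R Q \<Longrightarrow> Mor (HOM K M N) S R f \<eta> (along Q g) = \<eta> (along Q (cmp S g f))"
  by (simp add: HOM_def)

lemma Mor_HOM_self:
  assumes "S \<in> A" "R \<in> A" "f \<in> hm S R"
  shows "Mor (HOM K M N) S R f \<eta> (self R) = \<eta> (along R f)"
  using assms by (simp add: self_eq_along)

lemma Mor_HOM_closed:
  assumes "\<eta> \<in> carrier (Obj (HOM K M N) S)" "S \<in> A" "R \<in> A" "f \<in> hm S R"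
  shows "Mor (HOM K M N) S R f \<eta> \<in> carrier (Obj (HOM K M N) R)"
proof -
  have ext: "Mor (HOM K M N) S R f \<eta> \<in> extensional (CAlg R)" by (simp add: HOM_def)
  show ?thesis
    using assms(1) ext unfolding carrier_HOM lin_iff[OF assms(2)] lin_iff[OF assms(3)]
      nat_iff[OF assms(2)] nat_iff[OF assms(3)] carrier_HOM
    using assms by (auto simp: cmp_assoc[OF assms(4), symmetric])
qed

lemma HOM_ops [simp]:
  assumes "R \<in> A" "f \<in> hm S R" "x \<in> carrier (Obj M R)"
  shows "(\<eta> \<oplus>\<^bsub>Obj (HOM K M N) S\<^esub> \<theta>) (along R f) x = \<eta> (along R f) x \<oplus>\<^bsub>Obj N R\<^esub> \<theta> (along R f) x"
   "(s \<odot>\<^bsub>Obj (HOM K M N) S\<^esub> \<eta>) (along R f) x = f s \<odot>\<^bsub>Obj N R\<^esub> \<eta> (along R f) x"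
  using assms by (simp_all add: HOM_def)

lemma HOM_add_fam:
  "S \<in> A \<Longrightarrow> \<eta> \<oplus>\<^bsub>Obj (HOM K M N) S\<^esub> \<theta> = fam S M (\<lambda>R f x. \<eta> (along R f) x \<oplus>\<^bsub>Obj N R\<^esub> \<theta> (along R f) x)"
  using res_A[of S] by (auto simp: HOM_def fam_def intro!: restrict_ext)

lemma HOM_smult_fam:
  "S \<in> A \<Longrightarrow> s \<odot>\<^bsub>Obj (HOM K M N) S\<^esub> \<eta> = fam S M (\<lambda>R f x. f s \<odot>\<^bsub>Obj N R\<^esub> \<eta> (along R f) x)"
  using res_A[of S] by (auto simp: HOM_def fam_def intro!: restrict_ext)

lemmas dual_D = HOM_D[where N = scal, folded dual_def, simplified]
lemmas dual_ext = HOM_ext[where N = scal, folded dual_def]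
lemmas fam_dual = fam_HOM[where N = scal, folded dual_def, simplified]
lemmas Mor_dual [simp] = Mor_HOM[where N = scal, folded dual_def]
lemmas Mor_dual_self = Mor_HOM_self[where N = scal, folded dual_def]
lemmas Mor_dual_closed = Mor_HOM_closed[where N = scal, folded dual_def]
lemmas dual_ops [simp] = HOM_ops[where N = scal, folded dual_def, simplified]
lemmas dual_add_fam = HOM_add_fam[where N = scal, folded dual_def, simplified]
lemmas dual_smult_fam = HOM_smult_fam[where N = scal, folded dual_def, simplified]

text \<open>The component at the identity arrow. By naturality it fixes the component at
  \<open>h\<close> on vectors that come from \<open>S\<close>; on other vectors over
  \<open>Q\<close> the two may be unrelated.\<close>

lemma dual_self_D:
  assumes "\<eta> \<in> carrier (Obj (dual K M) S)" "S \<in> A"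
  shows "\<And>x. x \<in> carrier (Obj M S) \<Longrightarrow> \<eta> (self S) x \<in> carrier S"
    "\<And>x y. x \<in> carrier (Obj M S) \<Longrightarrow> y \<in> carrier (Obj M S) \<Longrightarrow>
       \<eta> (self S) (x \<oplus>\<^bsub>Obj M S\<^esub> y) = \<eta> (self S) x \<oplus>\<^bsub>S\<^esub> \<eta> (self S) y"
    "\<And>s x. s \<in> carrier S \<Longrightarrow> x \<in> carrier (Obj M S) \<Longrightarrow>
       \<eta> (self S) (s \<odot>\<^bsub>Obj M S\<^esub> x) = s \<otimes>\<^bsub>S\<^esub> \<eta> (self S) x"
    "\<And>Q h x. Q \<in> A \<Longrightarrow> h \<in> hm S Q \<Longrightarrow> x \<in> carrier (Obj M S) \<Longrightarrow>
       \<eta> (along Q h) (Mor M S Q h x) = h (\<eta> (self S) x)"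
  using dual_D[OF assms assms(2) ids_hm[OF assms(2)]] assms(2)
  by (auto simp: self_eq_along)

lemma set_functor_HOM: "set_functor K (HOM K M N)"
  unfolding set_functor_def
proof (intro conjI ballI)
  fix S T f assume *: "S \<in> A" "T \<in> A" "f \<in> hm S T"
  then show "Mor (HOM K M N) S T f \<in> carrier (Obj (HOM K M N) S) \<rightarrow> carrier (Obj (HOM K M N) T)"
    by (simp add: Mor_HOM_closed)
  fix U g \<eta> assume **: "U \<in> A" "g \<in> hm T U" "\<eta> \<in> carrier (Obj (HOM K M N) S)"
  show "Mor (HOM K M N) S U (cmp S g f) \<eta> = Mor (HOM K M N) T U g (Mor (HOM K M N) S T f \<eta>)"
    using * ** by (intro HOM_ext[of _ M N U]) (auto simp: Mor_HOM_closed cmp_assoc[of f S T])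
next
  fix S \<eta> assume "S \<in> A" "\<eta> \<in> carrier (Obj (HOM K M N) S)"
  then show "Mor (HOM K M N) S S (ids S) \<eta> = \<eta>"
    by (intro HOM_ext[of _ M N S]) (auto simp: Mor_HOM_closed)
qed

text \<open>Allows the dual to be dualised again, as the bidual and distributions on
  \<open>A_G\<close> require.\<close>

lemma linear_functor_dual:
  assumes "linear_functor K M"
  shows "linear_functor K (dual K M)"
proof -
  have cl: "\<eta> \<oplus>\<^bsub>Obj (dual K M) S\<^esub> \<theta> \<in> carrier (Obj (dual K M) S)"
    if "S \<in> A" "\<eta> \<in> carrier (Obj (dual K M) S)" "\<theta> \<in> carrier (Obj (dual K M) S)" for S \<eta> \<theta>
    unfolding dual_add_fam[OF that(1)]
  proof (rule fam_dual[OF that(1) assms])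
    fix R f assume R: "R \<in> A" "f \<in> hm S R"
    interpret cring R using R by (simp add: CAlgD)
    note D = dual_D[OF that(2,1) R] dual_D[OF that(3,1) R]
    show "\<eta> (along R f) x \<oplus>\<^bsub>R\<^esub> \<theta> (along R f) x \<in> carrier R" if "x \<in> carrier (Obj M R)" for x
      using that D by auto
    show "\<eta> (along R f) (x \<oplus>\<^bsub>Obj M R\<^esub> y) \<oplus>\<^bsub>R\<^esub> \<theta> (along R f) (x \<oplus>\<^bsub>Obj M R\<^esub> y) =
       \<eta> (along R f) x \<oplus>\<^bsub>R\<^esub> \<theta> (along R f) x \<oplus>\<^bsub>R\<^esub> (\<eta> (along R f) y \<oplus>\<^bsub>R\<^esub> \<theta> (along R f) y)"
      if "x \<in> carrier (Obj M R)" "y \<in> carrier (Obj M R)" for x y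
      using that D by (simp add: a_ac)
    show "\<eta> (along R f) (s \<odot>\<^bsub>Obj M R\<^esub> x) \<oplus>\<^bsub>R\<^esub> \<theta> (along R f) (s \<odot>\<^bsub>Obj M R\<^esub> x) =
       s \<otimes>\<^bsub>R\<^esub> (\<eta> (along R f) x \<oplus>\<^bsub>R\<^esub> \<theta> (along R f) x)"
      if "s \<in> carrier R" "x \<in> carrier (Obj M R)" for s x
      using that D by (simp add: r_distr)
    fix Q h x assume "Q \<in> A" "h \<in> hm R Q" "x \<in> carrier (Obj M R)"
    then show "\<eta> (along Q (cmp S h f)) (Mor M R Q h x) \<oplus>\<^bsub>Q\<^esub> \<theta> (along Q (cmp S h f)) (Mor M R Q h x) =
       h (\<eta> (along R f) x \<oplus>\<^bsub>R\<^esub> \<theta> (along R f) x)"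
      using D alg_homD[of h K R Q] by simp
  qed
  have cs: "s \<odot>\<^bsub>Obj (dual K M) S\<^esub> \<eta> \<in> carrier (Obj (dual K M) S)"
    if "S \<in> A" "\<eta> \<in> carrier (Obj (dual K M) S)" "s \<in> carrier S" for S \<eta> s
    unfolding dual_smult_fam[OF that(1)]
  proof (rule fam_dual[OF that(1) assms])
    fix R f assume R: "R \<in> A" "f \<in> hm S R"
    interpret cring R using R by (simp add: CAlgD)
    note D = dual_D[OF that(2,1) R]
    have fs: "f s \<in> carrier R" using R that by (simp add: alg_homD)
    show "f s \<otimes>\<^bsub>R\<^esub> \<eta> (along R f) x \<in> carrier R" if "x \<in> carrier (Obj M R)" for x
      using that D fs by auto
    show "f s \<otimes>\<^bsub>R\<^esub> \<eta> (along R f) (x \<oplus>\<^bsub>Obj M R\<^esub> y) =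
       f s \<otimes>\<^bsub>R\<^esub> \<eta> (along R f) x \<oplus>\<^bsub>R\<^esub> f s \<otimes>\<^bsub>R\<^esub> \<eta> (along R f) y"
      if "x \<in> carrier (Obj M R)" "y \<in> carrier (Obj M R)" for x y
      using that D fs by (simp add: r_distr)
    show "f s \<otimes>\<^bsub>R\<^esub> \<eta> (along R f) (t \<odot>\<^bsub>Obj M R\<^esub> x) = t \<otimes>\<^bsub>R\<^esub> (f s \<otimes>\<^bsub>R\<^esub> \<eta> (along R f) x)"
      if "t \<in> carrier R" "x \<in> carrier (Obj M R)" for t x
      using that D fs by (simp add: m_ac)
    fix Q h x assume "Q \<in> A" "h \<in> hm R Q" "x \<in> carrier (Obj M R)"
    then show "cmp S h f s \<otimes>\<^bsub>Q\<^esub> \<eta> (along Q (cmp S h f)) (Mor M R Q h x) =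
       h (f s \<otimes>\<^bsub>R\<^esub> \<eta> (along R f) x)"
      using D alg_homD[of h K R Q] fs that by simp
  qed
  show ?thesis
    unfolding linear_functor_def
  proof (intro conjI ballI)
    show "set_functor K (dual K M)" by (simp add: dual_def set_functor_HOM)
    fix S T f \<eta> assume S: "S \<in> A" "T \<in> A" "f \<in> hm S T" "\<eta> \<in> carrier (Obj (dual K M) S)"
    show "Mor (dual K M) S T f (\<eta> \<oplus>\<^bsub>Obj (dual K M) S\<^esub> \<theta>) =
       Mor (dual K M) S T f \<eta> \<oplus>\<^bsub>Obj (dual K M) T\<^esub> Mor (dual K M) S T f \<theta>"
      if "\<theta> \<in> carrier (Obj (dual K M) S)" for \<theta>
      using S that by (intro dual_ext[of _ M T]) (auto simp: Mor_dual_closed cl)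
    show "Mor (dual K M) S T f (s \<odot>\<^bsub>Obj (dual K M) S\<^esub> \<eta>) =
       f s \<odot>\<^bsub>Obj (dual K M) T\<^esub> Mor (dual K M) S T f \<eta>"
      if "s \<in> carrier S" for s
      using S that by (intro dual_ext[of _ M T]) (auto simp: Mor_dual_closed cs alg_homD)
  qed (auto simp: cl cs)
qed

section \<open>Functions on a functor of sets\<close>

lemma carrier_FUN: "carrier (Obj (fun_functor K X) S) = nat_trans S (restr K S X) (restr K S scal)"
  by (simp add: fun_functor_def)

lemmas FUN_D = nat_transD[where Y = scal, folded carrier_FUN, simplified]
lemmas FUN_ext = nat_trans_ext[where Y = scal and Y' = scal, folded carrier_FUN]
lemmas fam_FUN = fam_nat[where Y = scal, folded carrier_FUN, simplified]

lemma FUN_self_D: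
  assumes "\<eta> \<in> carrier (Obj (fun_functor K X) S)" "S \<in> A"
  shows "\<And>x. x \<in> carrier (Obj X S) \<Longrightarrow> \<eta> (self S) x \<in> carrier S"
    "\<And>Q h x. Q \<in> A \<Longrightarrow> h \<in> hm S Q \<Longrightarrow> x \<in> carrier (Obj X S) \<Longrightarrow>
       \<eta> (along Q h) (Mor X S Q h x) = h (\<eta> (self S) x)"
  using FUN_D[OF assms assms(2) ids_hm[OF assms(2)]] assms(2)
  by (auto simp: self_eq_along)

lemma Mor_FUN [simp]:
  "Q \<in> A \<Longrightarrow> g \<in> hm R Q \<Longrightarrow> Mor (fun_functor K X) S R f \<eta> (along Q g) = \<eta> (along Q (cmp S g f))"
  by (simp add: fun_functor_def)

lemma Mor_FUN_self:
  assumes "S \<in> A" "R \<in> A" "f \<in> hm S R"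
  shows "Mor (fun_functor K X) S R f \<eta> (self R) = \<eta> (along R f)"
  using assms by (simp add: self_eq_along)

lemma Mor_FUN_closed:
  assumes "\<eta> \<in> carrier (Obj (fun_functor K X) S)" "S \<in> A" "R \<in> A" "f \<in> hm S R"
  shows "Mor (fun_functor K X) S R f \<eta> \<in> carrier (Obj (fun_functor K X) R)"
proof -
  have ext: "Mor (fun_functor K X) S R f \<eta> \<in> extensional (CAlg R)" by (simp add: fun_functor_def)
  show ?thesis
    using assms(1) ext unfolding carrier_FUN nat_iff[OF assms(2)] nat_iff[OF assms(3)]
    using assms by (auto simp: cmp_assoc[OF assms(4), symmetric])
qed

lemma FUN_ops [simp]:
  assumes "R \<in> A" "f \<in> hm S R" "x \<in> carrier (Obj X R)"
  shows "(\<eta> \<oplus>\<^bsub>Obj (fun_functor K X) S\<^esub> \<theta>) (along R f) x = \<eta> (along R f) x \<oplus>\<^bsub>R\<^esub> \<theta> (along R f) x"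
   "(s \<odot>\<^bsub>Obj (fun_functor K X) S\<^esub> \<eta>) (along R f) x = f s \<otimes>\<^bsub>R\<^esub> \<eta> (along R f) x"
  using assms by (simp_all add: fun_functor_def)

lemma FUN_ops_fam:
  assumes "S \<in> A"
  shows "\<eta> \<oplus>\<^bsub>Obj (fun_functor K X) S\<^esub> \<theta> = fam S X (\<lambda>R f x. \<eta> (along R f) x \<oplus>\<^bsub>R\<^esub> \<theta> (along R f) x)"
   "s \<odot>\<^bsub>Obj (fun_functor K X) S\<^esub> \<eta> = fam S X (\<lambda>R f x. f s \<otimes>\<^bsub>R\<^esub> \<eta> (along R f) x)"
  using res_A[OF assms] by (auto simp: fun_functor_def fam_def intro!: restrict_ext)

lemma linear_functor_FUN:
  assumes "set_functor K X"
  shows "linear_functor K (fun_functor K X)"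
proof -
  have cl: "\<eta> \<oplus>\<^bsub>Obj (fun_functor K X) S\<^esub> \<theta> \<in> carrier (Obj (fun_functor K X) S)"
    if "S \<in> A" "\<eta> \<in> carrier (Obj (fun_functor K X) S)" "\<theta> \<in> carrier (Obj (fun_functor K X) S)" for S \<eta> \<theta>
    unfolding FUN_ops_fam[OF that(1)]
  proof (rule fam_FUN[OF that(1) assms])
    fix R f x assume R: "R \<in> A" "f \<in> hm S R" and x: "x \<in> carrier (Obj X R)"
    interpret cring R using R by (simp add: CAlgD)
    note D = FUN_D[OF that(2,1) R] FUN_D[OF that(3,1) R]
    show "\<eta> (along R f) x \<oplus>\<^bsub>R\<^esub> \<theta> (along R f) x \<in> carrier R"
      using D x by auto
    fix Q h assume "Q \<in> A" "h \<in> hm R Q"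
    then show "\<eta> (along Q (cmp S h f)) (Mor X R Q h x) \<oplus>\<^bsub>Q\<^esub> \<theta> (along Q (cmp S h f)) (Mor X R Q h x) =
       h (\<eta> (along R f) x \<oplus>\<^bsub>R\<^esub> \<theta> (along R f) x)"
      using D x alg_homD[of h K R Q] by simp
  qed
  have cs: "s \<odot>\<^bsub>Obj (fun_functor K X) S\<^esub> \<eta> \<in> carrier (Obj (fun_functor K X) S)"
    if "S \<in> A" "\<eta> \<in> carrier (Obj (fun_functor K X) S)" "s \<in> carrier S" for S \<eta> s
    unfolding FUN_ops_fam[OF that(1)]
  proof (rule fam_FUN[OF that(1) assms])
    fix R f x assume R: "R \<in> A" "f \<in> hm S R" and x: "x \<in> carrier (Obj X R)"
    interpret cring R using R by (simp add: CAlgD)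
    note D = FUN_D[OF that(2,1) R]
    have fs: "f s \<in> carrier R" using R that by (simp add: alg_homD)
    show "f s \<otimes>\<^bsub>R\<^esub> \<eta> (along R f) x \<in> carrier R"
      using x D fs by auto
    fix Q h assume "Q \<in> A" "h \<in> hm R Q"
    then show "cmp S h f s \<otimes>\<^bsub>Q\<^esub> \<eta> (along Q (cmp S h f)) (Mor X R Q h x) =
       h (f s \<otimes>\<^bsub>R\<^esub> \<eta> (along R f) x)"
      using D x alg_homD[of h K R Q] fs that by simp
  qed
  show ?thesis
    unfolding linear_functor_def
  proof (intro conjI ballI)
    fix S T f \<eta> assume S: "S \<in> A" "T \<in> A" "f \<in> hm S T" "\<eta> \<in> carrier (Obj (fun_functor K X) S)"
    show "Mor (fun_functor K X) S T f (\<eta> \<oplus>\<^bsub>Obj (fun_functor K X) S\<^esub> \<theta>) =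
       Mor (fun_functor K X) S T f \<eta> \<oplus>\<^bsub>Obj (fun_functor K X) T\<^esub> Mor (fun_functor K X) S T f \<theta>"
      if "\<theta> \<in> carrier (Obj (fun_functor K X) S)" for \<theta>
      using S that by (intro FUN_ext[of _ X T]) (auto simp: Mor_FUN_closed cl)
    show "Mor (fun_functor K X) S T f (s \<odot>\<^bsub>Obj (fun_functor K X) S\<^esub> \<eta>) =
       f s \<odot>\<^bsub>Obj (fun_functor K X) T\<^esub> Mor (fun_functor K X) S T f \<eta>"
      if "s \<in> carrier S" for s
      using S that by (intro FUN_ext[of _ X T]) (auto simp: Mor_FUN_closed cs alg_homD)
  next
    show "set_functor K (fun_functor K X)"
      unfolding set_functor_def
    proof (intro conjI ballI)
      fix S T f assume *: "S \<in> A" "T \<in> A" "f \<in> hm S T"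
      then show "Mor (fun_functor K X) S T f \<in> carrier (Obj (fun_functor K X) S) \<rightarrow> carrier (Obj (fun_functor K X) T)"
        by (simp add: Mor_FUN_closed)
      fix U g \<eta> assume **: "U \<in> A" "g \<in> hm T U" "\<eta> \<in> carrier (Obj (fun_functor K X) S)"
      show "Mor (fun_functor K X) S U (cmp S g f) \<eta> = Mor (fun_functor K X) T U g (Mor (fun_functor K X) S T f \<eta>)"
        using * ** by (intro FUN_ext[of _ X U]) (auto simp: Mor_FUN_closed cmp_assoc[of f S T])
    next
      fix S \<eta> assume "S \<in> A" "\<eta> \<in> carrier (Obj (fun_functor K X) S)"
      then show "Mor (fun_functor K X) S S (ids S) \<eta> = \<eta>"
        by (intro FUN_ext[of _ X S]) (auto simp: Mor_FUN_closed)
    qed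
  qed (auto simp: cl cs)
qed

end

section \<open>Tensor products\<close>

text \<open>With this comparison on generators, \<open>Union_coset\<close> identifies a map given on
  representatives with one given on classes.\<close>

lemma hom_frag_eq:
  assumes "comm_group H" "h \<in> hom (free_Abelian_group B) H" "h' \<in> hom (free_Abelian_group B) H"
    "\<And>b. b \<in> B \<Longrightarrow> h (frag_of b) = h' (frag_of b)" "x \<in> carrier (free_Abelian_group B)"
  shows "h x = h' x"
proof -
  interpret h: group_hom "free_Abelian_group B" H h
    using assms by (simp add: group_hom_def group_hom_axioms_def comm_group_def)
  interpret h': group_hom "free_Abelian_group B" H h'
    using assms by (simp add: group_hom_def group_hom_axioms_def comm_group_def)
  have diff: "x - y = x \<otimes>\<^bsub>free_Abelian_group B\<^esub> inv\<^bsub>free_Abelian_group B\<^esub> y"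
    if "Poly_Mapping.keys y \<subseteq> B" for x y using that by simp
  have "Poly_Mapping.keys x \<subseteq> B"
    using assms(5) by simp
  then show ?thesis
  proof (induction rule: free_Abelian_group_induct[consumes 1])
    case 1
    show ?case using h.hom_one h'.hom_one by simp
  next
    case (2 x y)
    then have "h (x - y) = h x \<otimes>\<^bsub>H\<^esub> inv\<^bsub>H\<^esub> h y" "h' (x - y) = h' x \<otimes>\<^bsub>H\<^esub> inv\<^bsub>H\<^esub> h' y"
      using h.hom_mult[of x "inv\<^bsub>free_Abelian_group B\<^esub> y"] h'.hom_mult[of x "inv\<^bsub>free_Abelian_group B\<^esub> y"]
        h.hom_inv[of y] h'.hom_inv[of y] by simp_all
    with 2 show ?case by simp
  qed (use assms(4) in blast)
qed

lemma abelian_group_iff: "abelian_group N \<longleftrightarrow> comm_group (add_monoid N)"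
  by (auto simp: abelian_group_def abelian_group_axioms_def abelian_monoid_def comm_group_def)

section \<open>Construction and universal property of the tensor product\<close>

locale tensor_product = base_ring K for K :: "'u ring" +
  fixes M :: "('u, 'm) module" and S :: "'u calg"
  assumes module_M: "module K M" and S_A: "S \<in> A"
begin

sublocale M: module K M by (rule module_M)
sublocale S: cring S using S_A by (rule CAlgD)

lemma smap_closed [simp]: "k \<in> carrier K \<Longrightarrow> smap S k \<in> carrier S"
  using CAlgD[OF S_A] by simp

abbreviation "P \<equiv> pair_group M S"
abbreviation "Rl \<equiv> tensor_rels K M S"
abbreviation "T \<equiv> tensor K M S"
abbreviation cos where "cos x \<equiv> Rl #>\<^bsub>P\<^esub> x"

sublocale P: comm_group P
  by (simp add: pair_group_def abelian_free_Abelian_group)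

lemma P_simps [simp]: "x \<in> carrier P \<longleftrightarrow> Poly_Mapping.keys x \<subseteq> carrier M \<times> carrier S"
  "x \<otimes>\<^bsub>P\<^esub> y = x + y" "\<one>\<^bsub>P\<^esub> = 0"
  by (simp_all add: pair_group_def)

lemma P_diff: "x \<in> carrier P \<Longrightarrow> y \<in> carrier P \<Longrightarrow> x - y = x \<otimes>\<^bsub>P\<^esub> inv\<^bsub>P\<^esub> y"
  by (simp add: pair_group_def)

text \<open>The relations inside \<open>tensor_rels\<close>, named so that the subgroup they
  generate can be compared with a kernel.\<close>

definition "gens \<equiv> {frag_of (m \<oplus>\<^bsub>M\<^esub> m', s) - frag_of (m, s) - frag_of (m', s) | m m' s.
         m \<in> carrier M \<and> m' \<in> carrier M \<and> s \<in> carrier S} \<union>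
      {frag_of (m, s \<oplus>\<^bsub>S\<^esub> s') - frag_of (m, s) - frag_of (m, s') | m s s'.
         m \<in> carrier M \<and> s \<in> carrier S \<and> s' \<in> carrier S} \<union>
      {frag_of (k \<odot>\<^bsub>M\<^esub> m, s) - frag_of (m, smap S k \<otimes>\<^bsub>S\<^esub> s) | k m s.
         k \<in> carrier K \<and> m \<in> carrier M \<and> s \<in> carrier S}"

lemma Rl_eq: "Rl = generate P gens"
  by (simp add: tensor_rels_def gens_def)

lemma diff_carrier: "x \<in> carrier P \<Longrightarrow> y \<in> carrier P \<Longrightarrow> x - y \<in> carrier P"
  using P_diff P.m_closed P.inv_closed by metis

lemma gens_carrier: "gens \<subseteq> carrier P"
  unfolding gens_def by (intro Un_least subsetI; clarify; intro diff_carrier) auto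

lemma subgroup_Rl: "subgroup Rl P"
  unfolding Rl_eq by (rule P.generate_is_subgroup) (rule gens_carrier)

sublocale Rl: normal Rl P
  by (rule P.subgroup_imp_normal) (rule subgroup_Rl)

lemma tensor_ops:
  "carrier T = carrier (P Mod Rl)" "ring.add T = monoid.mult (P Mod Rl)" "ring.zero T = monoid.one (P Mod Rl)"
  by (simp_all add: tensor_def Let_def)

lemma carrier_T: "carrier T = cos ` carrier P"
  by (simp add: tensor_def Let_def carrier_FactGroup)

sublocale T: abelian_group T
proof -
  interpret Q: comm_group "P Mod Rl"
    by (rule P.abelian_FactGroup) (rule subgroup_Rl)
  show "abelian_group T"
  proof (intro abelian_groupI; unfold tensor_ops)
    show "\<exists>y\<in>carrier (P Mod Rl). y \<otimes>\<^bsub>P Mod Rl\<^esub> x = \<one>\<^bsub>P Mod Rl\<^esub>" if "x \<in> carrier (P Mod Rl)" for x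
      using that Q.inv_closed Q.l_inv by blast
  qed (simp_all add: Q.m_ac del: mult_FactGroup one_FactGroup)
qed

lemma comm_group_T: "comm_group (add_monoid T)"
  using T.abelian_group_axioms by (simp add: abelian_group_iff)

lemma cos_add: "x \<in> carrier P \<Longrightarrow> y \<in> carrier P \<Longrightarrow> cos x \<oplus>\<^bsub>T\<^esub> cos y = cos (x + y)"
  using Rl.rcos_sum[of x y] by (simp add: tensor_def Let_def)

lemma cos_closed [simp]: "Poly_Mapping.keys x \<subseteq> carrier M \<times> carrier S \<Longrightarrow> cos x \<in> carrier T"
  by (auto simp: carrier_T)

lemma cos_hom: "cos \<in> hom P (add_monoid T)"
  by (rule homI) (use cos_add in auto)

lemma cos_0: "cos 0 = \<zero>\<^bsub>T\<^esub>"
  using P.coset_mult_one[of Rl] subgroup.subset[OF subgroup_Rl] by (simp add: tensor_def Let_def)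

lemma cos_eq: "x \<in> carrier P \<Longrightarrow> y \<in> carrier P \<Longrightarrow> x - y \<in> Rl \<Longrightarrow> cos x = cos y"
  by (metis P.coset_join2 P.coset_mult_inv1 P_diff Rl.subset subgroup_Rl P.inv_closed P.m_closed P.inv_inv)

lemma tens_eq: "tens K M S m s = cos (frag_of (m, s))"
  by (simp add: tens_def)

lemma tens_closed [simp]: "m \<in> carrier M \<Longrightarrow> s \<in> carrier S \<Longrightarrow> tens K M S m s \<in> carrier T"
  by (simp add: tens_eq)

lemma tens_add_left:
  assumes "m \<in> carrier M" "m' \<in> carrier M" "s \<in> carrier S"
  shows "tens K M S (m \<oplus>\<^bsub>M\<^esub> m') s = tens K M S m s \<oplus>\<^bsub>T\<^esub> tens K M S m' s"
proof -
  have "frag_of (m \<oplus>\<^bsub>M\<^esub> m', s) - (frag_of (m, s) + frag_of (m', s)) \<in> gens"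
    using assms unfolding gens_def diff_diff_eq by blast
  then have "frag_of (m \<oplus>\<^bsub>M\<^esub> m', s) - (frag_of (m, s) + frag_of (m', s)) \<in> Rl"
    unfolding Rl_eq by (rule generate.incl)
  then show ?thesis
    using assms P.m_closed[of "frag_of (m, s)" "frag_of (m', s)"]
    unfolding tens_eq by (subst cos_add) (simp_all add: cos_eq)
qed

lemma tens_add_right:
  assumes "m \<in> carrier M" "s' \<in> carrier S" "s \<in> carrier S"
  shows "tens K M S m (s \<oplus>\<^bsub>S\<^esub> s') = tens K M S m s \<oplus>\<^bsub>T\<^esub> tens K M S m s'"
proof -
  have "frag_of (m, s \<oplus>\<^bsub>S\<^esub> s') - (frag_of (m, s) + frag_of (m, s')) \<in> gens"
    using assms unfolding gens_def diff_diff_eq by blast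
  then have "frag_of (m, s \<oplus>\<^bsub>S\<^esub> s') - (frag_of (m, s) + frag_of (m, s')) \<in> Rl"
    unfolding Rl_eq by (rule generate.incl)
  then show ?thesis
    using assms P.m_closed[of "frag_of (m, s)" "frag_of (m, s')"]
    unfolding tens_eq by (subst cos_add) (simp_all add: cos_eq)
qed

lemma tens_balanced:
  assumes "k \<in> carrier K" "m \<in> carrier M" "s \<in> carrier S"
  shows "tens K M S (k \<odot>\<^bsub>M\<^esub> m) s = tens K M S m (smap S k \<otimes>\<^bsub>S\<^esub> s)"
proof -
  have "frag_of (k \<odot>\<^bsub>M\<^esub> m, s) - frag_of (m, smap S k \<otimes>\<^bsub>S\<^esub> s) \<in> gens"
    using assms unfolding gens_def by blast
  then have "frag_of (k \<odot>\<^bsub>M\<^esub> m, s) - frag_of (m, smap S k \<otimes>\<^bsub>S\<^esub> s) \<in> Rl"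
    unfolding Rl_eq by (rule generate.incl)
  then show ?thesis
    using assms unfolding tens_eq by (intro cos_eq) simp_all
qed

lemma tens_zero_left [simp]: "s \<in> carrier S \<Longrightarrow> tens K M S \<zero>\<^bsub>M\<^esub> s = \<zero>\<^bsub>T\<^esub>"
  using tens_add_left[of "\<zero>\<^bsub>M\<^esub>" "\<zero>\<^bsub>M\<^esub>" s] T.add.r_cancel_one'[of "tens K M S \<zero>\<^bsub>M\<^esub> s" "tens K M S \<zero>\<^bsub>M\<^esub> s"] by simp

lemma tens_zero_right [simp]: "m \<in> carrier M \<Longrightarrow> tens K M S m \<zero>\<^bsub>S\<^esub> = \<zero>\<^bsub>T\<^esub>"
  using tens_add_right[of m "\<zero>\<^bsub>S\<^esub>" "\<zero>\<^bsub>S\<^esub>"] T.add.r_cancel_one'[of "tens K M S m \<zero>\<^bsub>S\<^esub>" "tens K M S m \<zero>\<^bsub>S\<^esub>"] by simp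

text \<open>A negative generator is again a pure tensor. Hence every class is a plain sum of pure
  tensors, and \<open>tensor_induct\<close> needs no case for inverses.\<close>

lemma cos_neg_frag:
  assumes "m \<in> carrier M" "s \<in> carrier S"
  shows "cos (- frag_of (m, s)) = tens K M S (\<ominus>\<^bsub>M\<^esub> m) s"
proof -
  have "cos (- frag_of (m, s)) \<oplus>\<^bsub>T\<^esub> tens K M S m s = \<zero>\<^bsub>T\<^esub>"
    unfolding tens_eq using assms by (subst cos_add) (auto simp: cos_0)
  moreover have "tens K M S (\<ominus>\<^bsub>M\<^esub> m) s \<oplus>\<^bsub>T\<^esub> tens K M S m s = \<zero>\<^bsub>T\<^esub>"
    using assms by (simp add: tens_add_left[symmetric] M.M.l_neg)
  ultimately show ?thesis
    using assms T.add.right_cancel[of "tens K M S m s" "cos (- frag_of (m, s))" "tens K M S (\<ominus>\<^bsub>M\<^esub> m) s"]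
    by simp
qed

lemma tensor_induct [consumes 1, case_names tens add]:
  assumes "X \<in> carrier T"
    and tens: "\<And>m s. m \<in> carrier M \<Longrightarrow> s \<in> carrier S \<Longrightarrow> Q (tens K M S m s)"
    and add: "\<And>X Y. X \<in> carrier T \<Longrightarrow> Y \<in> carrier T \<Longrightarrow> Q X \<Longrightarrow> Q Y \<Longrightarrow> Q (X \<oplus>\<^bsub>T\<^esub> Y)"
  shows "Q X"
proof -
  obtain x where x: "Poly_Mapping.keys x \<subseteq> carrier M \<times> carrier S" "X = cos x"
    using assms(1) by (auto simp: carrier_T)
  \<comment> \<open>Induction on the free abelian group goes through differences, so the claim is
    carried for \<open>x\<close> and \<open>- x\<close> together.\<close>
  have "Q (cos x) \<and> Q (cos (- x))"
    using x(1)
  proof (induction rule: free_Abelian_group_induct[consumes 1])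
    case 1
    have "Q (tens K M S \<zero>\<^bsub>M\<^esub> \<zero>\<^bsub>S\<^esub>)" by (rule tens) auto
    then show ?case by (simp add: cos_0)
  next
    case (2 x y)
    have "cos (x - y) = cos x \<oplus>\<^bsub>T\<^esub> cos (- y)" "cos (- (x - y)) = cos y \<oplus>\<^bsub>T\<^esub> cos (- x)"
      using 2 by (simp_all add: cos_add)
    with 2 show ?case by (auto intro!: add)
  next
    case (3 a)
    then show ?case
      using tens by (cases a) (auto simp: cos_neg_frag tens_eq[symmetric])
  qed
  with x show ?thesis by simp
qed

text \<open>The target is only an abelian group: scalars of \<open>K\<close> move from the left
  factor to the right one instead of out of the value.\<close>

definition balanced :: "('n, 'y) ring_scheme \<Rightarrow> ('m \<Rightarrow> 'u \<Rightarrow> 'n) \<Rightarrow> bool" where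
  "balanced N \<beta> \<longleftrightarrow>
     (\<forall>m\<in>carrier M. \<forall>s\<in>carrier S. \<beta> m s \<in> carrier N \<and>
       (\<forall>m'\<in>carrier M. \<beta> (m \<oplus>\<^bsub>M\<^esub> m') s = \<beta> m s \<oplus>\<^bsub>N\<^esub> \<beta> m' s) \<and>
       (\<forall>s'\<in>carrier S. \<beta> m (s \<oplus>\<^bsub>S\<^esub> s') = \<beta> m s \<oplus>\<^bsub>N\<^esub> \<beta> m s') \<and>
       (\<forall>k\<in>carrier K. \<beta> (k \<odot>\<^bsub>M\<^esub> m) s = \<beta> m (smap S k \<otimes>\<^bsub>S\<^esub> s)))"

text \<open>The homomorphism on the free abelian group kills the three kinds of relations
  (\<open>g1\<close>, \<open>g2\<close>, \<open>g3\<close>), so its kernel contains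
  \<open>Rl\<close> and it descends to the quotient.\<close>

lemma tensor_lift_exists:
  assumes "abelian_group N" "balanced N \<beta>"
  shows "\<exists>L\<in>hom (add_monoid T) (add_monoid N). \<forall>m\<in>carrier M. \<forall>s\<in>carrier S. L (tens K M S m s) = \<beta> m s"
proof -
  interpret N: abelian_group N by fact
  note b = assms(2)[unfolded balanced_def, rule_format]
  obtain h where h: "h \<in> hom P (add_monoid N)"
    "\<And>x. x \<in> carrier M \<times> carrier S \<Longrightarrow> h (frag_of x) = case_prod \<beta> x"
    by (rule comm_group.free_Abelian_group_universal[OF N.a_comm_group, where f = "case_prod \<beta>"
          and S = "carrier M \<times> carrier S", folded pair_group_def])
      (use b in auto)
  interpret h: group_hom P "add_monoid N" h
    using h N.add.is_group by (simp add: group_hom_def group_hom_axioms_def)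
  have hd: "h (x - y) = h x \<ominus>\<^bsub>N\<^esub> h y" if "x \<in> carrier P" "y \<in> carrier P" for x y
    using h.hom_mult[OF that(1) P.inv_closed[OF that(2)]] h.hom_inv[OF that(2)]
    unfolding P_diff[OF that] by (simp add: a_minus_def a_inv_def)
  have g1: "h (frag_of (m \<oplus>\<^bsub>M\<^esub> m', s) - frag_of (m, s) - frag_of (m', s)) = \<zero>\<^bsub>N\<^esub>"
    if *: "m \<in> carrier M" "m' \<in> carrier M" "s \<in> carrier S" for m m' s
  proof -
    have "h (frag_of (m \<oplus>\<^bsub>M\<^esub> m', s) - frag_of (m, s) - frag_of (m', s)) =
       \<beta> (m \<oplus>\<^bsub>M\<^esub> m') s \<ominus>\<^bsub>N\<^esub> \<beta> m s \<ominus>\<^bsub>N\<^esub> \<beta> m' s"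
      using * diff_carrier[of "frag_of (m \<oplus>\<^bsub>M\<^esub> m', s)" "frag_of (m, s)"] by (simp add: hd h(2))
    with * b show ?thesis by (simp add: a_minus_def N.minus_add N.a_ac N.r_neg N.r_neg1 N.r_neg2)
  qed
  have g2: "h (frag_of (m, s \<oplus>\<^bsub>S\<^esub> s') - frag_of (m, s) - frag_of (m, s')) = \<zero>\<^bsub>N\<^esub>"
    if *: "m \<in> carrier M" "s \<in> carrier S" "s' \<in> carrier S" for m s s'
  proof -
    have "h (frag_of (m, s \<oplus>\<^bsub>S\<^esub> s') - frag_of (m, s) - frag_of (m, s')) =
       \<beta> m (s \<oplus>\<^bsub>S\<^esub> s') \<ominus>\<^bsub>N\<^esub> \<beta> m s \<ominus>\<^bsub>N\<^esub> \<beta> m s'"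
      using * diff_carrier[of "frag_of (m, s \<oplus>\<^bsub>S\<^esub> s')" "frag_of (m, s)"] by (simp add: hd h(2))
    with * b show ?thesis by (simp add: a_minus_def N.minus_add N.a_ac N.r_neg N.r_neg1 N.r_neg2)
  qed
  have g3: "h (frag_of (k \<odot>\<^bsub>M\<^esub> m, s) - frag_of (m, smap S k \<otimes>\<^bsub>S\<^esub> s)) = \<zero>\<^bsub>N\<^esub>"
    if "k \<in> carrier K" "m \<in> carrier M" "s \<in> carrier S" for k m s
    using that b by (simp add: hd h(2) a_minus_def N.r_neg)
  have "h x = \<zero>\<^bsub>N\<^esub>" if "x \<in> gens" for x
    using that unfolding gens_def by (elim UnE CollectE exE conjE) (simp_all only: g1 g2 g3)
  then have "gens \<subseteq> kernel P (add_monoid N) h"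
    using gens_carrier by (auto simp: kernel_def simp del: P_simps(1))
  then have "Rl \<subseteq> kernel P (add_monoid N) h"
    unfolding Rl_eq by (intro P.generate_subgroup_incl h.subgroup_kernel)
  then obtain L where "L \<in> hom (P Mod Rl) (add_monoid N)" "\<And>x. x \<in> carrier P \<Longrightarrow> L (cos x) = h x"
    using h.FactGroup_universal_kernel[OF Rl.normal_axioms] by blast
  then show ?thesis
    by (intro bexI[of _ L]) (auto simp: tens_eq h(2) hom_def tensor_ops)
qed

definition lift :: "('n, 'y) ring_scheme \<Rightarrow> ('m \<Rightarrow> 'u \<Rightarrow> 'n) \<Rightarrow> ('m, 'u) tensor_elt \<Rightarrow> 'n" where
  "lift N \<beta> = (SOME L. L \<in> hom (add_monoid T) (add_monoid N) \<and>
     (\<forall>m\<in>carrier M. \<forall>s\<in>carrier S. L (tens K M S m s) = \<beta> m s))"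

lemma lift:
  assumes "abelian_group N" "balanced N \<beta>"
  shows lift_hom: "lift N \<beta> \<in> hom (add_monoid T) (add_monoid N)"
    and lift_tens: "\<And>m s. m \<in> carrier M \<Longrightarrow> s \<in> carrier S \<Longrightarrow> lift N \<beta> (tens K M S m s) = \<beta> m s"
    and lift_closed: "\<And>X. X \<in> carrier T \<Longrightarrow> lift N \<beta> X \<in> carrier N"
    and lift_add: "\<And>X Y. X \<in> carrier T \<Longrightarrow> Y \<in> carrier T \<Longrightarrow> lift N \<beta> (X \<oplus>\<^bsub>T\<^esub> Y) = lift N \<beta> X \<oplus>\<^bsub>N\<^esub> lift N \<beta> Y"
proof -
  have *: "lift N \<beta> \<in> hom (add_monoid T) (add_monoid N) \<and>
     (\<forall>m\<in>carrier M. \<forall>s\<in>carrier S. lift N \<beta> (tens K M S m s) = \<beta> m s)"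
    using someI_ex[OF tensor_lift_exists[OF assms, unfolded Bex_def]] unfolding lift_def .
  then show "lift N \<beta> \<in> hom (add_monoid T) (add_monoid N)"
    "\<And>m s. m \<in> carrier M \<Longrightarrow> s \<in> carrier S \<Longrightarrow> lift N \<beta> (tens K M S m s) = \<beta> m s" by blast+
  show "\<And>X. X \<in> carrier T \<Longrightarrow> lift N \<beta> X \<in> carrier N"
    "\<And>X Y. X \<in> carrier T \<Longrightarrow> Y \<in> carrier T \<Longrightarrow> lift N \<beta> (X \<oplus>\<^bsub>T\<^esub> Y) = lift N \<beta> X \<oplus>\<^bsub>N\<^esub> lift N \<beta> Y"
    using * by (auto simp: hom_def)
qed

end

text \<open>\<open>tensor_map\<close> and \<open>qcoh_sub\<close> are written as unions over the representatives of a coset. Such a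
  union is the value of the induced homomorphism as soon as one exists.\<close>

lemma (in base_ring) Union_coset:
  assumes "tensor_product K M S" "tensor_product K M' S'"
    and L: "L \<in> hom (add_monoid (tensor K M S)) (add_monoid (tensor K M' S'))"
    and F: "F \<in> hom (pair_group M S) (pair_group M' S')"
    and eq: "\<And>m s. m \<in> carrier M \<Longrightarrow> s \<in> carrier S \<Longrightarrow>
      L (tens K M S m s) = tensor_rels K M' S' #>\<^bsub>pair_group M' S'\<^esub> F (frag_of (m, s))"
    and X: "X \<in> carrier (tensor K M S)"
  shows "(\<Union>x\<in>X. tensor_rels K M' S' #>\<^bsub>pair_group M' S'\<^esub> F x) = L X"
proof -
  interpret t: tensor_product K M S by fact
  interpret t': tensor_product K M' S' by fact
  have eq': "t'.cos (F x) = L (t.cos x)" if x: "x \<in> carrier t.P" for x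
  proof -
    have 1: "t'.cos \<circ> F \<in> hom (free_Abelian_group (carrier M \<times> carrier S)) (add_monoid t'.T)"
      using hom_compose[OF F t'.cos_hom] unfolding pair_group_def[of M S] .
    have 2: "L \<circ> t.cos \<in> hom (free_Abelian_group (carrier M \<times> carrier S)) (add_monoid t'.T)"
      using hom_compose[OF t.cos_hom L] unfolding pair_group_def[of M S] .
    have "(t'.cos \<circ> F) x = (L \<circ> t.cos) x"
    proof (rule hom_frag_eq[OF t'.comm_group_T 1 2])
      show "(t'.cos \<circ> F) (frag_of b) = (L \<circ> t.cos) (frag_of b)" if "b \<in> carrier M \<times> carrier S" for b
        using that eq by (auto simp: t.tens_eq)
    qed (use x in \<open>simp add: pair_group_def\<close>)
    then show ?thesis by simp
  qed
  obtain y where y: "y \<in> carrier t.P" "X = t.cos y"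
    using X unfolding t.carrier_T by blast
  \<comment> \<open>Every representative of the coset contributes the same set \<open>L X\<close>,
    and \<open>y\<close> shows that there is a representative.\<close>
  have "x \<in> carrier t.P \<and> t.cos x = X" if "x \<in> X" for x
    using that y t.P.repr_independence[OF _ y(1) t.subgroup_Rl]
      t.P.r_coset_subset_G[of t.Rl y] subgroup.subset[OF t.subgroup_Rl] by blast
  moreover have "y \<in> X"
    using y t.P.rcos_self t.subgroup_Rl by blast
  ultimately show ?thesis
    using eq' by auto
qed

section \<open>Functoriality of the tensor product in S and its module structure\<close>

context base_ring
begin

text \<open>Stated for additive \<open>K\<close>-linear \<open>h\<close> rather than for algebra
  morphisms, so that it also covers multiplication by an element of \<open>S\<close>, which defines
  the module structure.\<close>

lemma tensor_map:
  assumes "tensor_product K M S" "tensor_product K M R"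
    and h: "\<And>s. s \<in> carrier S \<Longrightarrow> h s \<in> carrier R"
      "\<And>s t. s \<in> carrier S \<Longrightarrow> t \<in> carrier S \<Longrightarrow> h (s \<oplus>\<^bsub>S\<^esub> t) = h s \<oplus>\<^bsub>R\<^esub> h t"
      "\<And>k s. k \<in> carrier K \<Longrightarrow> s \<in> carrier S \<Longrightarrow> h (smap S k \<otimes>\<^bsub>S\<^esub> s) = smap R k \<otimes>\<^bsub>R\<^esub> h s"
  shows tensor_map_closed: "\<And>X. X \<in> carrier (tensor K M S) \<Longrightarrow> tensor_map K M R h X \<in> carrier (tensor K M R)"
    and tensor_map_add: "\<And>X Y. X \<in> carrier (tensor K M S) \<Longrightarrow> Y \<in> carrier (tensor K M S) \<Longrightarrow>
      tensor_map K M R h (X \<oplus>\<^bsub>tensor K M S\<^esub> Y) = tensor_map K M R h X \<oplus>\<^bsub>tensor K M R\<^esub> tensor_map K M R h Y"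
    and tensor_map_tens: "\<And>m s. m \<in> carrier M \<Longrightarrow> s \<in> carrier S \<Longrightarrow>
      tensor_map K M R h (tens K M S m s) = tens K M R m (h s)"
proof -
  interpret t: tensor_product K M S by fact
  interpret r: tensor_product K M R by fact
  define L where "L = t.lift (tensor K M R) (\<lambda>m s. tens K M R m (h s))"
  have b: "t.balanced (tensor K M R) (\<lambda>m s. tens K M R m (h s))"
    unfolding t.balanced_def
    by (simp add: h r.tens_add_left r.tens_add_right r.tens_balanced)
  note L = t.lift[OF r.T.abelian_group_axioms b, folded L_def]
  have F: "frag_extend (\<lambda>(m, s). frag_of (m, h s)) \<in> hom t.P r.P"
  proof (rule homI)
    fix x assume "x \<in> carrier t.P"
    then have "(\<Union>a\<in>Poly_Mapping.keys x. Poly_Mapping.keys (case a of (m, s) \<Rightarrow> frag_of (m, h s)))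
        \<subseteq> carrier M \<times> carrier R"
      using h(1) by auto
    then show "frag_extend (\<lambda>(m, s). frag_of (m, h s)) x \<in> carrier r.P"
      using keys_frag_extend[of "\<lambda>(m, s). frag_of (m, h s)" x] by simp
  qed (simp add: frag_extend_add)
  have "L (tens K M S m s) = r.cos (frag_extend (\<lambda>(m, s). frag_of (m, h s)) (frag_of (m, s)))"
    if "m \<in> carrier M" "s \<in> carrier S" for m s
    using that by (simp add: L(2) r.tens_eq)
  then have eq: "tensor_map K M R h X = L X" if "X \<in> carrier (tensor K M S)" for X
    unfolding tensor_map_def using that by (rule Union_coset[OF assms(1,2) L(1) F])
  show "\<And>X. X \<in> carrier (tensor K M S) \<Longrightarrow> tensor_map K M R h X \<in> carrier (tensor K M R)"
    "\<And>X Y. X \<in> carrier (tensor K M S) \<Longrightarrow> Y \<in> carrier (tensor K M S) \<Longrightarrow>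
      tensor_map K M R h (X \<oplus>\<^bsub>tensor K M S\<^esub> Y) = tensor_map K M R h X \<oplus>\<^bsub>tensor K M R\<^esub> tensor_map K M R h Y"
    "\<And>m s. m \<in> carrier M \<Longrightarrow> s \<in> carrier S \<Longrightarrow>
      tensor_map K M R h (tens K M S m s) = tens K M R m (h s)"
    by (simp_all add: eq L)
qed

lemma tensor_productI: "module K M \<Longrightarrow> S \<in> A \<Longrightarrow> tensor_product K M S"
  by (simp add: tensor_product_def tensor_product_axioms_def base_ring_axioms)

lemma tensor_map_hm:
  assumes "module K M" "S \<in> A" "R \<in> A" "f \<in> hm S R"
  shows tensor_hm_closed: "\<And>X. X \<in> carrier (tensor K M S) \<Longrightarrow> tensor_map K M R f X \<in> carrier (tensor K M R)"
    and tensor_hm_add: "\<And>X Y. X \<in> carrier (tensor K M S) \<Longrightarrow> Y \<in> carrier (tensor K M S) \<Longrightarrow>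
      tensor_map K M R f (X \<oplus>\<^bsub>tensor K M S\<^esub> Y) = tensor_map K M R f X \<oplus>\<^bsub>tensor K M R\<^esub> tensor_map K M R f Y"
    and tensor_hm_tens: "\<And>m s. m \<in> carrier M \<Longrightarrow> s \<in> carrier S \<Longrightarrow>
      tensor_map K M R f (tens K M S m s) = tens K M R m (f s)"
  using tensor_map[OF tensor_productI[OF assms(1,2)] tensor_productI[OF assms(1,3)], of f]
    alg_homD[OF assms(4)] CAlgD[OF assms(2)]
  by auto

end

context tensor_product
begin

lemma smult_eq: "s \<odot>\<^bsub>T\<^esub> X = tensor_map K M S (\<lambda>t. s \<otimes>\<^bsub>S\<^esub> t) X"
  by (simp add: tensor_def Let_def)

lemma smult:
  assumes "s \<in> carrier S"
  shows smult_closed [simp]: "\<And>X. X \<in> carrier T \<Longrightarrow> s \<odot>\<^bsub>T\<^esub> X \<in> carrier T"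
    and smult_add: "\<And>X Y. X \<in> carrier T \<Longrightarrow> Y \<in> carrier T \<Longrightarrow> s \<odot>\<^bsub>T\<^esub> (X \<oplus>\<^bsub>T\<^esub> Y) = s \<odot>\<^bsub>T\<^esub> X \<oplus>\<^bsub>T\<^esub> s \<odot>\<^bsub>T\<^esub> Y"
    and smult_tens [simp]: "\<And>m t. m \<in> carrier M \<Longrightarrow> t \<in> carrier S \<Longrightarrow>
      s \<odot>\<^bsub>T\<^esub> tens K M S m t = tens K M S m (s \<otimes>\<^bsub>S\<^esub> t)"
  unfolding smult_eq
  using tensor_map[OF tensor_product_axioms tensor_product_axioms, of "\<lambda>t. s \<otimes>\<^bsub>S\<^esub> t"] assms
  by (simp_all add: S.r_distr S.m_lcomm)

lemma module_T: "module S T"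
proof (rule moduleI)
  fix a b X assume ab: "a \<in> carrier S" "b \<in> carrier S" and X: "X \<in> carrier T"
  from X show "(a \<oplus>\<^bsub>S\<^esub> b) \<odot>\<^bsub>T\<^esub> X = a \<odot>\<^bsub>T\<^esub> X \<oplus>\<^bsub>T\<^esub> b \<odot>\<^bsub>T\<^esub> X"
  proof (induction rule: tensor_induct)
    case (add X Y)
    then show ?case using ab by (simp add: smult_add T.a_ac)
  qed (use ab in \<open>simp add: S.l_distr tens_add_right\<close>)
  from X show "(a \<otimes>\<^bsub>S\<^esub> b) \<odot>\<^bsub>T\<^esub> X = a \<odot>\<^bsub>T\<^esub> (b \<odot>\<^bsub>T\<^esub> X)"
    by (induction rule: tensor_induct) (use ab in \<open>simp_all add: S.m_assoc smult_add\<close>)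
next
  fix X assume X: "X \<in> carrier T"
  from X show "\<one>\<^bsub>S\<^esub> \<odot>\<^bsub>T\<^esub> X = X"
    by (induction rule: tensor_induct) (simp_all add: smult_add)
qed (auto simp: smult_add S.is_cring T.abelian_group_axioms)

sublocale T: module S T by (rule module_T)

end

context base_ring
begin

lemma qcoh_sel [simp]: "Obj (qcoh K M) S = tensor K M S" "Mor (qcoh K M) S R f = tensor_map K M R f"
  by (simp_all add: qcoh_def)

lemma linear_functor_qcoh:
  assumes "module K M"
  shows "linear_functor K (qcoh K M)"
  unfolding linear_functor_def set_functor_def qcoh_sel
proof (intro conjI ballI funcsetI)
  fix S assume S: "S \<in> A"
  interpret s: tensor_product K M S using assms S by (rule tensor_productI)
  note maps = tensor_map_hm[OF assms]
  have idm: "tensor_map K M S i X = X" if "X \<in> carrier s.T" "i \<in> hm S S" "\<And>x. x \<in> carrier S \<Longrightarrow> i x = x" for X i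
    using that(1) by (induction rule: s.tensor_induct) (simp_all add: maps[OF S S that(2)] that(3))
  show "tensor_map K M S (ids S) X = X" if "X \<in> carrier s.T" for X
    by (rule idm[OF that ids_hm[OF S]]) simp
  show "X \<oplus>\<^bsub>s.T\<^esub> Y \<in> carrier s.T" if "X \<in> carrier s.T" "Y \<in> carrier s.T" for X Y
    using that by simp
  show "t \<odot>\<^bsub>s.T\<^esub> X \<in> carrier s.T" if "X \<in> carrier s.T" "t \<in> carrier S" for X t
    using that by simp
  fix R f assume R: "R \<in> A" and f: "f \<in> hm S R"
  interpret r: tensor_product K M R using assms R by (rule tensor_productI)
  note fm = maps[OF S R f] alg_homD[OF f]
  show "tensor_map K M R f X \<in> carrier r.T" if "X \<in> carrier s.T" for X
    using that by (simp add: fm)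
  show "tensor_map K M R f (X \<oplus>\<^bsub>s.T\<^esub> Y) = tensor_map K M R f X \<oplus>\<^bsub>r.T\<^esub> tensor_map K M R f Y"
    if "X \<in> carrier s.T" "Y \<in> carrier s.T" for X Y
    using that by (simp add: fm)
  show "tensor_map K M R f (t \<odot>\<^bsub>s.T\<^esub> X) = f t \<odot>\<^bsub>r.T\<^esub> tensor_map K M R f X"
    if "X \<in> carrier s.T" "t \<in> carrier S" for X t
    using that by (induction rule: s.tensor_induct) (simp_all add: fm r.smult_add s.smult_add)
  fix Q g X assume Q: "Q \<in> A" and g: "g \<in> hm R Q" and X: "X \<in> carrier s.T"
  show "tensor_map K M Q (cmp S g f) X = tensor_map K M Q g (tensor_map K M R f X)"
    using X by (induction rule: s.tensor_induct)
     (simp_all add: fm maps[OF R Q g] maps[OF S Q cmp_hm[OF f g S]])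
qed

text \<open>These maps are the points over \<open>S\<close> of the dual of \<open>qcoh K M\<close>;
  \<open>functional\<close> makes the passage.\<close>

definition linear_map :: "('u, 'm) module \<Rightarrow> 'u calg \<Rightarrow> ('m \<Rightarrow> 'u) \<Rightarrow> bool" where
  "linear_map M S p \<longleftrightarrow> (\<forall>m\<in>carrier M. p m \<in> carrier S \<and>
     (\<forall>m'\<in>carrier M. p (m \<oplus>\<^bsub>M\<^esub> m') = p m \<oplus>\<^bsub>S\<^esub> p m') \<and>
     (\<forall>k\<in>carrier K. p (k \<odot>\<^bsub>M\<^esub> m) = smap S k \<otimes>\<^bsub>S\<^esub> p m))"

lemma linear_mapD:
  assumes "linear_map M S p" "m \<in> carrier M"
  shows "p m \<in> carrier S" "\<And>m'. m' \<in> carrier M \<Longrightarrow> p (m \<oplus>\<^bsub>M\<^esub> m') = p m \<oplus>\<^bsub>S\<^esub> p m'"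
    "\<And>k. k \<in> carrier K \<Longrightarrow> p (k \<odot>\<^bsub>M\<^esub> m) = smap S k \<otimes>\<^bsub>S\<^esub> p m"
  using assms by (auto simp: linear_map_def)

lemma linear_map_hm:
  "linear_map M S p \<Longrightarrow> f \<in> hm S R \<Longrightarrow> S \<in> A \<Longrightarrow> linear_map M R (\<lambda>m. f (p m))"
  using alg_homD[of f K S R] CAlgD(4)[of S K] by (simp add: linear_map_def)

lemma linear_map_self: "linear_map M (self K) p \<Longrightarrow> S \<in> A \<Longrightarrow> linear_map M S (\<lambda>m. smap S (p m))"
  by (rule linear_map_hm[OF _ smap_hm self_A])

end

section \<open>Contraction of tensors by linear maps\<close>

context tensor_product
begin

text \<open>The \<open>S\<close>-linear extension to \<open>M \<otimes> S\<close> of a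
  \<open>K\<close>-linear map from \<open>M\<close> to \<open>S\<close>.\<close>

definition contract :: "('m \<Rightarrow> 'u) \<Rightarrow> ('m, 'u) tensor_elt \<Rightarrow> 'u" where
  "contract p = lift S (\<lambda>m s. p m \<otimes>\<^bsub>S\<^esub> s)"

lemma contract:
  assumes "linear_map M S p"
  shows contract_tens: "\<And>m s. m \<in> carrier M \<Longrightarrow> s \<in> carrier S \<Longrightarrow> contract p (tens K M S m s) = p m \<otimes>\<^bsub>S\<^esub> s"
    and contract_closed: "\<And>X. X \<in> carrier T \<Longrightarrow> contract p X \<in> carrier S"
    and contract_add: "\<And>X Y. X \<in> carrier T \<Longrightarrow> Y \<in> carrier T \<Longrightarrow> contract p (X \<oplus>\<^bsub>T\<^esub> Y) = contract p X \<oplus>\<^bsub>S\<^esub> contract p Y"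
    and contract_smult: "\<And>X s. X \<in> carrier T \<Longrightarrow> s \<in> carrier S \<Longrightarrow> contract p (s \<odot>\<^bsub>T\<^esub> X) = s \<otimes>\<^bsub>S\<^esub> contract p X"
proof -
  have b: "balanced S (\<lambda>m s. p m \<otimes>\<^bsub>S\<^esub> s)"
    using linear_mapD[OF assms] unfolding balanced_def by (simp add: S.l_distr S.r_distr S.m_ac)
  note L = lift[OF S.abelian_group_axioms b, folded contract_def]
  show tens: "\<And>m s. m \<in> carrier M \<Longrightarrow> s \<in> carrier S \<Longrightarrow> contract p (tens K M S m s) = p m \<otimes>\<^bsub>S\<^esub> s"
    by (rule L)
  show cl: "\<And>X. X \<in> carrier T \<Longrightarrow> contract p X \<in> carrier S"
    by (rule L)
  show add: "\<And>X Y. X \<in> carrier T \<Longrightarrow> Y \<in> carrier T \<Longrightarrow> contract p (X \<oplus>\<^bsub>T\<^esub> Y) = contract p X \<oplus>\<^bsub>S\<^esub> contract p Y"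
    by (rule L)
  show "contract p (s \<odot>\<^bsub>T\<^esub> X) = s \<otimes>\<^bsub>S\<^esub> contract p X" if "X \<in> carrier T" "s \<in> carrier S" for X s
    using that linear_mapD[OF assms]
    by (induction rule: tensor_induct) (simp_all add: smult_add tens cl add S.r_distr S.m_ac)
qed

lemma contract_hm:
  assumes "linear_map M S p" "R \<in> A" "f \<in> hm S R" "X \<in> carrier T"
  shows "tensor_product.contract K M R (\<lambda>m. f (p m)) (tensor_map K M R f X) = f (contract p X)"
proof -
  interpret r: tensor_product K M R using module_M assms(2) by (rule tensor_productI)
  note c = r.contract[OF linear_map_hm[OF assms(1,3) S_A]]
  note tm = tensor_map_hm[OF module_M S_A assms(2,3)]
  from assms(4) show ?thesis
    by (induction rule: tensor_induct) (use linear_mapD[OF assms(1)] alg_homD[OF assms(3)] in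
      \<open>simp_all add: tm c contract[OF assms(1)]\<close>)
qed

lemma contract_cong:
  assumes "linear_map M S p" "\<And>m. m \<in> carrier M \<Longrightarrow> q m = p m" "X \<in> carrier T"
  shows "contract q X = contract p X"
proof -
  have q: "linear_map M S q" using assms(1,2) by (simp add: linear_map_def)
  from assms(3) show ?thesis
    by (induction rule: tensor_induct) (simp_all add: contract[OF q] contract[OF assms(1)] assms(2))
qed

end

section \<open>Submodules of quasi-coherent modules\<close>

context tensor_product
begin

context
  fixes N assumes N: "submodule N K M"
begin

interpretation N: submodule N K M by (rule N)

lemma submodule_sub [simp]: "n \<in> N \<Longrightarrow> n \<in> carrier M"
  using N.subset by auto

lemma module_N: "module K (M\<lparr>carrier := N\<rparr>)"
  using N.submodule_is_module[OF module_M] .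

interpretation n: tensor_product K "M\<lparr>carrier := N\<rparr>" S
  using module_N S_A by (rule tensor_productI)

text \<open>The canonical map from \<open>N \<otimes> S\<close> to \<open>M \<otimes> S\<close>. Its
  injectivity is a matter of flatness and is proved over a field in \<open>incl_inj\<close>.\<close>

definition incl :: "('m, 'u) tensor_elt \<Rightarrow> ('m, 'u) tensor_elt" where
  "incl = n.lift T (tens K M S)"

lemma incl_balanced: "n.balanced T (tens K M S)"
  unfolding n.balanced_def by (simp add: tens_add_left tens_add_right tens_balanced)

lemmas incl = n.lift[OF T.abelian_group_axioms incl_balanced, folded incl_def, simplified]

text \<open>The identity on representatives induces \<open>incl\<close>, so
  \<open>Union_coset\<close> evaluates the union of cosets in \<open>qcoh_sub\<close>.\<close>

lemma qcoh_sub_eq: "qcoh_sub K M N S = incl ` carrier n.T"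
proof -
  have "(\<Union>x\<in>X. tensor_rels K M S #>\<^bsub>pair_group M S\<^esub> x) = incl X" if "X \<in> carrier n.T" for X
  proof (rule Union_coset[OF n.tensor_product_axioms tensor_product_axioms incl(1)])
    show "(\<lambda>x. x) \<in> hom n.P P"
      by (rule homI) (auto dest: subsetD)
  qed (use that in \<open>auto simp: incl(2) tens_eq\<close>)
  then show ?thesis
    using S_A by (simp add: qcoh_sub_def)
qed

lemma qcoh_sub_carrier: "qcoh_sub K M N S \<subseteq> carrier T"
  unfolding qcoh_sub_eq using incl by auto

lemma qcoh_sub_tens: "n \<in> N \<Longrightarrow> s \<in> carrier S \<Longrightarrow> tens K M S n s \<in> qcoh_sub K M N S"
  unfolding qcoh_sub_eq
  by (rule image_eqI[of _ _ "tens K (M\<lparr>carrier := N\<rparr>) S n s"]) (simp_all add: incl(2))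

lemma qcoh_sub_add: "X \<in> qcoh_sub K M N S \<Longrightarrow> Y \<in> qcoh_sub K M N S \<Longrightarrow> X \<oplus>\<^bsub>T\<^esub> Y \<in> qcoh_sub K M N S"
  unfolding qcoh_sub_eq by (auto simp: incl(4)[symmetric])

lemma qcoh_sub_induct [consumes 1, case_names tens add]:
  assumes "X \<in> qcoh_sub K M N S" "\<And>m s. m \<in> N \<Longrightarrow> s \<in> carrier S \<Longrightarrow> Q (tens K M S m s)"
    "\<And>X Y. X \<in> qcoh_sub K M N S \<Longrightarrow> Y \<in> qcoh_sub K M N S \<Longrightarrow> Q X \<Longrightarrow> Q Y \<Longrightarrow> Q (X \<oplus>\<^bsub>T\<^esub> Y)"
  shows "Q X"
proof -
  have "Q (incl X)" if "X \<in> carrier n.T" for X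
    using that
    by (induction rule: n.tensor_induct) (auto simp: incl qcoh_sub_eq intro!: assms(2,3))
  with assms(1) show ?thesis
    unfolding qcoh_sub_eq by auto
qed

lemma incl_smult: "X \<in> carrier n.T \<Longrightarrow> s \<in> carrier S \<Longrightarrow> incl (s \<odot>\<^bsub>n.T\<^esub> X) = s \<odot>\<^bsub>T\<^esub> incl X"
  by (induction rule: n.tensor_induct) (simp_all add: n.smult_add smult_add incl)

lemma qcoh_sub_submodule: "submodule (qcoh_sub K M N S) S T"
proof (rule T.submoduleI)
  show sm: "s \<odot>\<^bsub>T\<^esub> X \<in> qcoh_sub K M N S" if "s \<in> carrier S" "X \<in> qcoh_sub K M N S" for s X
    using that(2,1) by (induction rule: qcoh_sub_induct)
     (use qcoh_sub_carrier in \<open>auto simp: qcoh_sub_tens qcoh_sub_add smult_add subset_iff\<close>)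
  show "\<zero>\<^bsub>T\<^esub> \<in> qcoh_sub K M N S"
    using qcoh_sub_tens[OF subgroup.one_closed[OF N.subgroup_axioms] S.zero_closed] by simp
  show "\<ominus>\<^bsub>T\<^esub> X \<in> qcoh_sub K M N S" if "X \<in> qcoh_sub K M N S" for X
  proof -
    have "X \<in> carrier T" using that qcoh_sub_carrier by auto
    then have "\<ominus>\<^bsub>T\<^esub> X = (\<ominus>\<^bsub>S\<^esub> \<one>\<^bsub>S\<^esub>) \<odot>\<^bsub>T\<^esub> X" by (simp add: T.smult_l_minus)
    then show ?thesis using sm[OF _ that] by simp
  qed
qed (use qcoh_sub_carrier qcoh_sub_add in auto)

end

end

section \<open>Separation by linear functionals\<close>

text \<open>\<open>N + K y\<close>. One-generator enlargements serve both the construction of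
  hyperplanes and the exhaustion of \<open>M \<otimes> S\<close>.\<close>

definition adjoin :: "('u, 'b) ring_scheme \<Rightarrow> ('u, 'm, 'c) module_scheme \<Rightarrow> 'm set \<Rightarrow> 'm \<Rightarrow> 'm set" where
  "adjoin K M N y = {n \<oplus>\<^bsub>M\<^esub> k \<odot>\<^bsub>M\<^esub> y | n k. n \<in> N \<and> k \<in> carrier K}"

lemma (in module) submoduleD:
  assumes "submodule N R M"
  shows "\<And>n. n \<in> N \<Longrightarrow> n \<in> carrier M" "\<zero>\<^bsub>M\<^esub> \<in> N" "\<And>n. n \<in> N \<Longrightarrow> \<ominus>\<^bsub>M\<^esub> n \<in> N"
    "\<And>n m. n \<in> N \<Longrightarrow> m \<in> N \<Longrightarrow> n \<oplus>\<^bsub>M\<^esub> m \<in> N"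
    "\<And>k n. k \<in> carrier R \<Longrightarrow> n \<in> N \<Longrightarrow> k \<odot>\<^bsub>M\<^esub> n \<in> N"
  using submoduleE[OF assms] subgroup.one_closed[OF submodule.axioms(1)[OF assms]] by auto

lemma (in module) adjoin_submodule:
  assumes N: "submodule N R M" and y: "y \<in> carrier M"
  shows "submodule (adjoin R M N y) R M" "N \<subseteq> adjoin R M N y" "y \<in> adjoin R M N y"
proof -
  note D = submoduleD[OF N]
  show "submodule (adjoin R M N y) R M"
  proof (rule submoduleI)
    show "adjoin R M N y \<subseteq> carrier M"
      using y D by (auto simp: adjoin_def)
    have "\<zero>\<^bsub>M\<^esub> = \<zero>\<^bsub>M\<^esub> \<oplus>\<^bsub>M\<^esub> \<zero>\<^bsub>R\<^esub> \<odot>\<^bsub>M\<^esub> y" using y by simp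
    then show "\<zero>\<^bsub>M\<^esub> \<in> adjoin R M N y" using D(2) unfolding adjoin_def by blast
  next
    fix a assume "a \<in> adjoin R M N y"
    then obtain n k where a: "n \<in> N" "k \<in> carrier R" "a = n \<oplus>\<^bsub>M\<^esub> k \<odot>\<^bsub>M\<^esub> y" unfolding adjoin_def by blast
    then have "\<ominus>\<^bsub>M\<^esub> a = (\<ominus>\<^bsub>M\<^esub> n) \<oplus>\<^bsub>M\<^esub> (\<ominus> k) \<odot>\<^bsub>M\<^esub> y"
      using y D(1) by (simp add: M.minus_add smult_l_minus)
    then show "\<ominus>\<^bsub>M\<^esub> a \<in> adjoin R M N y" using a D(3) unfolding adjoin_def by blast
    show "r \<odot>\<^bsub>M\<^esub> a \<in> adjoin R M N y" if "r \<in> carrier R" for r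
    proof -
      have "r \<odot>\<^bsub>M\<^esub> a = r \<odot>\<^bsub>M\<^esub> n \<oplus>\<^bsub>M\<^esub> (r \<otimes> k) \<odot>\<^bsub>M\<^esub> y"
        using a y D(1) that by (simp add: smult_r_distr smult_assoc1)
      then show ?thesis using a D(5) that unfolding adjoin_def by blast
    qed
    fix b assume "b \<in> adjoin R M N y"
    then obtain n' k' where b: "n' \<in> N" "k' \<in> carrier R" "b = n' \<oplus>\<^bsub>M\<^esub> k' \<odot>\<^bsub>M\<^esub> y" unfolding adjoin_def by blast
    have "a \<oplus>\<^bsub>M\<^esub> b = (n \<oplus>\<^bsub>M\<^esub> n') \<oplus>\<^bsub>M\<^esub> (k \<oplus> k') \<odot>\<^bsub>M\<^esub> y"
      using a b y D(1) by (simp add: smult_l_distr M.a_ac)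
    then show "a \<oplus>\<^bsub>M\<^esub> b \<in> adjoin R M N y" using a b D(4) unfolding adjoin_def by blast
  qed
  show "N \<subseteq> adjoin R M N y"
  proof
    fix n assume n: "n \<in> N"
    then have "n = n \<oplus>\<^bsub>M\<^esub> \<zero> \<odot>\<^bsub>M\<^esub> y" using y D(1) by simp
    with n show "n \<in> adjoin R M N y" unfolding adjoin_def by blast
  qed
  have "y = \<zero>\<^bsub>M\<^esub> \<oplus>\<^bsub>M\<^esub> \<one> \<odot>\<^bsub>M\<^esub> y" using y by simp
  then show "y \<in> adjoin R M N y" using D(2) unfolding adjoin_def by blast
qed

locale base_field = base_ring K for K :: "'u ring" +
  assumes field_K: "field K"
begin

sublocale K: field K by (rule field_K)

lemma smult_inverse:
  assumes "module K M" "submodule N K M" "k \<in> carrier K" "k \<noteq> \<zero>\<^bsub>K\<^esub>" "m \<in> carrier M" "k \<odot>\<^bsub>M\<^esub> m \<in> N"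
  shows "m \<in> N"
proof -
  interpret M: module K M by fact
  have k: "inv\<^bsub>K\<^esub> k \<in> carrier K" "inv\<^bsub>K\<^esub> k \<otimes>\<^bsub>K\<^esub> k = \<one>\<^bsub>K\<^esub>"
    using assms(3,4) K.field_Units by auto
  have "inv\<^bsub>K\<^esub> k \<odot>\<^bsub>M\<^esub> (k \<odot>\<^bsub>M\<^esub> m) = m"
    using k assms by (simp add: M.smult_assoc1[symmetric])
  then show ?thesis
    using M.submoduleD(5)[OF assms(2) k(1) assms(6)] by simp
qed

text \<open>A submodule maximal among those avoiding \<open>x\<close> is a hyperplane complementing the line through \<open>x\<close>.\<close>

lemma separating_functional:
  assumes M: "module K M" and N: "submodule N K M" and x: "x \<in> carrier M" "x \<notin> N"
  shows "\<exists>\<omega>. linear_map M (self K) \<omega> \<and> (\<forall>n\<in>N. \<omega> n = \<zero>\<^bsub>K\<^esub>) \<and> \<omega> x = \<one>\<^bsub>K\<^esub>"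
proof -
  interpret M: module K M by fact
  define F where "F = {L. submodule L K M \<and> N \<subseteq> L \<and> x \<notin> L}"
  have "\<exists>L\<in>F. \<forall>X\<in>F. L \<subseteq> X \<longrightarrow> X = L"
  proof (rule subset_Zorn_nonempty)
    show "F \<noteq> {}" using N x unfolding F_def by blast
    fix C assume C: "C \<noteq> {}" "subset.chain F C"
    then have sub: "submodule L K M" "N \<subseteq> L" "x \<notin> L" if "L \<in> C" for L
      using that unfolding subset.chain_def F_def by auto
    have "submodule (\<Union>C) K M"
    proof (rule M.submoduleI)
      show "\<Union>C \<subseteq> carrier M" using M.submoduleD(1)[OF sub(1)] by blast
      show "\<zero>\<^bsub>M\<^esub> \<in> \<Union>C" using C(1) M.submoduleD(2)[OF sub(1)] by blast
      show "\<ominus>\<^bsub>M\<^esub> a \<in> \<Union>C" if "a \<in> \<Union>C" for a using that M.submoduleD(3)[OF sub(1)] by blast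
      show "k \<odot>\<^bsub>M\<^esub> a \<in> \<Union>C" if "k \<in> carrier K" "a \<in> \<Union>C" for k a using that M.submoduleD(5)[OF sub(1)] by blast
      fix a b assume "a \<in> \<Union>C" "b \<in> \<Union>C"
      then obtain L L' where L: "a \<in> L" "L \<in> C" "b \<in> L'" "L' \<in> C" by blast
      then have "L \<subseteq> L' \<or> L' \<subseteq> L" using C(2) unfolding subset.chain_def by blast
      then show "a \<oplus>\<^bsub>M\<^esub> b \<in> \<Union>C"
        using L M.submoduleD(4)[OF sub(1)] by blast
    qed
    then show "\<Union>C \<in> F" using C(1) sub unfolding F_def by blast
  qed
  then obtain L where LF: "L \<in> F" "\<forall>X\<in>F. L \<subseteq> X \<longrightarrow> X = L" by blast
  then have L: "submodule L K M" "N \<subseteq> L" "x \<notin> L" by (auto simp: F_def)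
  have max: "X = L" if "submodule X K M" "N \<subseteq> X" "x \<notin> X" "L \<subseteq> X" for X
    using LF(2) that by (auto simp: F_def)
  note D = M.submoduleD[OF L(1)]
  \<comment> \<open>If \<open>y\<close> is outside \<open>L\<close>, maximality puts
    \<open>x\<close> into \<open>L + K y\<close>. The coefficient of \<open>y\<close> is nonzero
    because \<open>x\<close> is not in \<open>L\<close>, so the relation can be solved for
    \<open>y\<close>.\<close>
  have ex: "\<exists>l\<in>L. \<exists>c\<in>carrier K. y = l \<oplus>\<^bsub>M\<^esub> c \<odot>\<^bsub>M\<^esub> x" if y: "y \<in> carrier M" for y
  proof (cases "y \<in> L")
    case True
    then have "y = y \<oplus>\<^bsub>M\<^esub> \<zero>\<^bsub>K\<^esub> \<odot>\<^bsub>M\<^esub> x" using x y by simp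
    with True show ?thesis by blast
  next
    case False
    note adj = M.adjoin_submodule[OF L(1) y]
    have "x \<in> adjoin K M L y"
      using max[OF adj(1)] adj(2,3) L(2) False by blast
    then obtain l k where lk: "l \<in> L" "k \<in> carrier K" "x = l \<oplus>\<^bsub>M\<^esub> k \<odot>\<^bsub>M\<^esub> y"
      unfolding adjoin_def by blast
    have "k \<noteq> \<zero>\<^bsub>K\<^esub>"
      using lk L(3) y D(1) by auto
    then have k: "inv\<^bsub>K\<^esub> k \<in> carrier K" "inv\<^bsub>K\<^esub> k \<otimes>\<^bsub>K\<^esub> k = \<one>\<^bsub>K\<^esub>"
      using lk(2) K.field_Units by auto
    have "inv\<^bsub>K\<^esub> k \<odot>\<^bsub>M\<^esub> x = inv\<^bsub>K\<^esub> k \<odot>\<^bsub>M\<^esub> l \<oplus>\<^bsub>M\<^esub> y"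
    proof -
      have "inv\<^bsub>K\<^esub> k \<odot>\<^bsub>M\<^esub> (k \<odot>\<^bsub>M\<^esub> y) = y"
        using M.smult_assoc1[OF k(1) lk(2) y] k(2) y by simp
      then show ?thesis
        unfolding lk(3) using M.smult_r_distr[OF k(1) D(1)[OF lk(1)] M.smult_closed[OF lk(2) y]] by simp
    qed
    then have "y = (\<ominus>\<^bsub>M\<^esub> (inv\<^bsub>K\<^esub> k \<odot>\<^bsub>M\<^esub> l)) \<oplus>\<^bsub>M\<^esub> inv\<^bsub>K\<^esub> k \<odot>\<^bsub>M\<^esub> x"
      using y k lk D(1) by (simp add: M.M.r_neg1)
    then show ?thesis
      using k lk D(3)[OF D(5)[OF k(1) lk(1)]] by blast
  qed
  \<comment> \<open>Two different coefficients would make a nonzero multiple of \<open>x\<close>,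
    hence \<open>x\<close> itself, an element of \<open>L\<close>.\<close>
  have uniq: "c = c'" if eq: "l \<oplus>\<^bsub>M\<^esub> c \<odot>\<^bsub>M\<^esub> x = l' \<oplus>\<^bsub>M\<^esub> c' \<odot>\<^bsub>M\<^esub> x" and
    l: "l \<in> L" "l' \<in> L" "c \<in> carrier K" "c' \<in> carrier K" for l l' c c'
  proof (rule ccontr)
    assume "c \<noteq> c'"
    then have nz: "c \<ominus>\<^bsub>K\<^esub> c' \<noteq> \<zero>\<^bsub>K\<^esub>"
      using l K.minus_equality[of c "\<ominus>\<^bsub>K\<^esub> c'"] by (auto simp: a_minus_def)
    have "(c \<ominus>\<^bsub>K\<^esub> c') \<odot>\<^bsub>M\<^esub> x = c \<odot>\<^bsub>M\<^esub> x \<oplus>\<^bsub>M\<^esub> \<ominus>\<^bsub>M\<^esub> (c' \<odot>\<^bsub>M\<^esub> x)"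
      using l x by (simp add: a_minus_def M.smult_l_distr M.smult_l_minus)
    also have "c \<odot>\<^bsub>M\<^esub> x = \<ominus>\<^bsub>M\<^esub> l \<oplus>\<^bsub>M\<^esub> (l' \<oplus>\<^bsub>M\<^esub> c' \<odot>\<^bsub>M\<^esub> x)"
      unfolding eq[symmetric] using l x D(1) by (simp add: M.M.r_neg1)
    finally have "(c \<ominus>\<^bsub>K\<^esub> c') \<odot>\<^bsub>M\<^esub> x = \<ominus>\<^bsub>M\<^esub> l \<oplus>\<^bsub>M\<^esub> l'"
      using l x D(1) by (simp add: M.M.a_assoc M.M.r_neg)
    then have "(c \<ominus>\<^bsub>K\<^esub> c') \<odot>\<^bsub>M\<^esub> x \<in> L" using l D(3,4) by simp
    then show False
      using smult_inverse[OF M L(1) _ nz x(1)] l L(3) by simp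
  qed
  \<comment> \<open>The functional reads off the coefficient of \<open>x\<close> with respect to the
    hyperplane \<open>L\<close>.\<close>
  define \<omega> where "\<omega> y = (THE c. c \<in> carrier K \<and> (\<exists>l\<in>L. y = l \<oplus>\<^bsub>M\<^esub> c \<odot>\<^bsub>M\<^esub> x))" for y
  have \<omega>: "\<omega> (l \<oplus>\<^bsub>M\<^esub> c \<odot>\<^bsub>M\<^esub> x) = c" if "l \<in> L" "c \<in> carrier K" for l c
    unfolding \<omega>_def using that uniq by (intro the_equality) blast+
  have "linear_map M (self K) \<omega>"
    unfolding linear_map_def
  proof (intro ballI conjI)
    fix y assume "y \<in> carrier M"
    then obtain l c where y: "l \<in> L" "c \<in> carrier K" "y = l \<oplus>\<^bsub>M\<^esub> c \<odot>\<^bsub>M\<^esub> x" using ex by blast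
    then show "\<omega> y \<in> carrier (self K)" by (simp add: \<omega>)
    show "\<omega> (k \<odot>\<^bsub>M\<^esub> y) = smap (self K) k \<otimes>\<^bsub>self K\<^esub> \<omega> y" if k: "k \<in> carrier K" for k
    proof -
      have "k \<odot>\<^bsub>M\<^esub> y = k \<odot>\<^bsub>M\<^esub> l \<oplus>\<^bsub>M\<^esub> (k \<otimes>\<^bsub>K\<^esub> c) \<odot>\<^bsub>M\<^esub> x"
        using y k x D(1) by (simp add: M.smult_r_distr M.smult_assoc1)
      then show ?thesis using y k D(5) by (simp add: \<omega>)
    qed
    fix y' assume "y' \<in> carrier M"
    then obtain l' c' where y': "l' \<in> L" "c' \<in> carrier K" "y' = l' \<oplus>\<^bsub>M\<^esub> c' \<odot>\<^bsub>M\<^esub> x" using ex by blast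
    have "y \<oplus>\<^bsub>M\<^esub> y' = (l \<oplus>\<^bsub>M\<^esub> l') \<oplus>\<^bsub>M\<^esub> (c \<oplus>\<^bsub>K\<^esub> c') \<odot>\<^bsub>M\<^esub> x"
      using y y' x D(1) by (simp add: M.smult_l_distr M.M.a_ac)
    then show "\<omega> (y \<oplus>\<^bsub>M\<^esub> y') = \<omega> y \<oplus>\<^bsub>self K\<^esub> \<omega> y'" using y y' D(4) by (simp add: \<omega>)
  qed
  moreover have "\<omega> n = \<zero>\<^bsub>K\<^esub>" if "n \<in> N" for n
    using \<omega>[of n "\<zero>\<^bsub>K\<^esub>"] that L(2) x D(1) by auto
  moreover have "\<omega> x = \<one>\<^bsub>K\<^esub>"
    using \<omega>[OF D(2) K.one_closed] x by simp
  ultimately show ?thesis by blast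
qed

text \<open>Extension reduces to separation. If \<open>\<omega>\<close> is nonzero, scale some
  vector to \<open>n1\<close> with \<open>\<omega> n1 = 1\<close> and separate \<open>n1\<close>
  from the kernel \<open>Z\<close> of \<open>\<omega>\<close>. Since \<open>N = Z + K n1\<close>,
  the separating functional agrees with \<open>\<omega>\<close> on \<open>N\<close>.\<close>

lemma extend_functional:
  assumes M: "module K M" and N: "submodule N K M" and \<omega>: "linear_map (M\<lparr>carrier := N\<rparr>) (self K) \<omega>"
  shows "\<exists>\<omega>'. linear_map M (self K) \<omega>' \<and> (\<forall>n\<in>N. \<omega>' n = \<omega> n)"
proof -
  interpret M: module K M by fact
  note D = M.submoduleD[OF N]
  have \<omega>D: "\<omega> m \<in> carrier K" "\<And>m'. m' \<in> N \<Longrightarrow> \<omega> (m \<oplus>\<^bsub>M\<^esub> m') = \<omega> m \<oplus>\<^bsub>K\<^esub> \<omega> m'"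
    "\<And>k. k \<in> carrier K \<Longrightarrow> \<omega> (k \<odot>\<^bsub>M\<^esub> m) = k \<otimes>\<^bsub>K\<^esub> \<omega> m" if "m \<in> N" for m
    using linear_mapD[OF \<omega>, of m] that by auto
  show ?thesis
  proof (cases "\<forall>n\<in>N. \<omega> n = \<zero>\<^bsub>K\<^esub>")
    case True
    have "linear_map M (self K) (\<lambda>_. \<zero>\<^bsub>K\<^esub>)" by (simp add: linear_map_def)
    with True show ?thesis by fastforce
  next
    case False
    then obtain n0 where n0: "n0 \<in> N" "\<omega> n0 \<noteq> \<zero>\<^bsub>K\<^esub>" by blast
    define n1 where "n1 = inv\<^bsub>K\<^esub> (\<omega> n0) \<odot>\<^bsub>M\<^esub> n0"
    have k: "inv\<^bsub>K\<^esub> (\<omega> n0) \<in> carrier K" "inv\<^bsub>K\<^esub> (\<omega> n0) \<otimes>\<^bsub>K\<^esub> \<omega> n0 = \<one>\<^bsub>K\<^esub>"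
      using n0 \<omega>D(1)[OF n0(1)] K.field_Units by auto
    have n1: "n1 \<in> N" "\<omega> n1 = \<one>\<^bsub>K\<^esub>"
      unfolding n1_def using k n0 by (simp_all add: \<omega>D D(5))
    define Z where "Z = {n \<in> N. \<omega> n = \<zero>\<^bsub>K\<^esub>}"
    have neg: "\<ominus>\<^bsub>M\<^esub> n = (\<ominus>\<^bsub>K\<^esub> \<one>\<^bsub>K\<^esub>) \<odot>\<^bsub>M\<^esub> n" if "n \<in> N" for n
      using that D(1) by (simp add: M.smult_l_minus)
    have "\<omega> \<zero>\<^bsub>M\<^esub> = \<zero>\<^bsub>K\<^esub>"
      using \<omega>D(3)[OF D(2) K.zero_closed] \<omega>D(1)[OF D(2)] by simp
    then have Z: "submodule Z K M"
      by (intro M.submoduleI) (auto simp: Z_def D \<omega>D neg)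
    have "n1 \<notin> Z" using n1 by (simp add: Z_def)
    then obtain \<omega>' where w: "linear_map M (self K) \<omega>'" "\<forall>n\<in>Z. \<omega>' n = \<zero>\<^bsub>K\<^esub>" "\<omega>' n1 = \<one>\<^bsub>K\<^esub>"
      using separating_functional[OF M Z D(1)[OF n1(1)]] by blast
    have "\<omega>' n = \<omega> n" if n: "n \<in> N" for n
    proof -
      let ?z = "n \<oplus>\<^bsub>M\<^esub> (\<ominus>\<^bsub>K\<^esub> \<omega> n) \<odot>\<^bsub>M\<^esub> n1"
      have z: "?z \<in> Z"
        using n n1 \<omega>D(1)[OF n] by (simp add: Z_def D \<omega>D K.r_neg)
      have "n = ?z \<oplus>\<^bsub>M\<^esub> \<omega> n \<odot>\<^bsub>M\<^esub> n1"
        using n n1 \<omega>D(1)[OF n] D(1) by (simp add: M.smult_l_minus M.M.a_assoc M.M.l_neg)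
      then have "\<omega>' n = \<omega>' ?z \<oplus>\<^bsub>K\<^esub> \<omega> n \<otimes>\<^bsub>K\<^esub> \<omega>' n1"
        using linear_mapD[OF w(1)] z n n1 \<omega>D(1)[OF n] D(1,5)
        by (metis (no_types, lifting) M.smult_closed Z_def mem_Collect_eq restrict_apply' self_sel(1,2,5,6))
      then show ?thesis using w z \<omega>D(1)[OF n] by simp
    qed
    with w show ?thesis by blast
  qed
qed

end

section \<open>Tensors over a field tested by linear functionals\<close>

locale vector_tensor = tensor_product K M S + base_field K for K :: "'u ring" and M :: "('u, 'm) module" and S
begin

lemma qcoh_sub_mono:
  assumes "submodule N K M" "submodule L K M" "N \<subseteq> L" "X \<in> qcoh_sub K M N S"
  shows "X \<in> qcoh_sub K M L S"
  using assms(4) by (induction rule: qcoh_sub_induct[OF assms(1), consumes 1])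
    (use assms(3) in \<open>auto intro: qcoh_sub_tens[OF assms(2)] qcoh_sub_add[OF assms(2)]\<close>)

abbreviation "vanishing N X \<equiv> \<forall>\<omega>. linear_map M (self K) \<omega> \<longrightarrow> (\<forall>n\<in>N. \<omega> n = \<zero>\<^bsub>K\<^esub>) \<longrightarrow>
   contract (\<lambda>m. smap S (\<omega> m)) X = \<zero>\<^bsub>S\<^esub>"

lemma smap_simps: "smap S \<zero>\<^bsub>K\<^esub> = \<zero>\<^bsub>S\<^esub>" "smap S \<one>\<^bsub>K\<^esub> = \<one>\<^bsub>S\<^esub>"
  using CAlgD[OF S_A] ring_hom_zero[of "smap S" K S] ring_hom_one[of "smap S" K S]
    cring.axioms(1)[OF cring_K] cring.axioms(1)[OF S.is_cring] by auto

lemma contract_vanish: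
  assumes N: "submodule N K M" and \<omega>: "linear_map M (self K) \<omega>" "\<forall>n\<in>N. \<omega> n = \<zero>\<^bsub>K\<^esub>"
    and X: "X \<in> qcoh_sub K M N S"
  shows "contract (\<lambda>m. smap S (\<omega> m)) X = \<zero>\<^bsub>S\<^esub>"
proof -
  note c = contract[OF linear_map_self[OF \<omega>(1) S_A]]
  show ?thesis
    using X by (induction rule: qcoh_sub_induct[OF N, consumes 1])
      (use \<omega>(2) M.submoduleD(1)[OF N] qcoh_sub_carrier[OF N] in \<open>auto simp: c smap_simps subset_iff\<close>)
qed

text \<open>Modulo the image of \<open>N \<otimes> S\<close> the tensor is
  \<open>m \<otimes> s\<close>. A functional that kills \<open>N\<close> and takes the value 1 at
  \<open>m\<close> reads off \<open>s\<close>, so \<open>s\<close> is zero.\<close>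

lemma adjoin_step:
  assumes N: "submodule N K M" and m: "m \<in> carrier M" and X: "X \<in> qcoh_sub K M (adjoin K M N m) S"
    and van: "vanishing N X"
  shows "X \<in> qcoh_sub K M N S"
proof (cases "m \<in> N")
  case True
  have "adjoin K M N m \<subseteq> N"
    using True M.submoduleD[OF N] by (auto simp: adjoin_def)
  then show ?thesis
    using qcoh_sub_mono[OF M.adjoin_submodule(1)[OF N m] N _ X] by blast
next
  case False
  obtain \<omega> where \<omega>: "linear_map M (self K) \<omega>" "\<forall>n\<in>N. \<omega> n = \<zero>\<^bsub>K\<^esub>" "\<omega> m = \<one>\<^bsub>K\<^esub>"
    using separating_functional[OF module_M N m False] by blast
  note c = contract[OF linear_map_self[OF \<omega>(1) S_A]]
  note D = M.submoduleD[OF N]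
  have sub: "X \<in> carrier T" if "X \<in> qcoh_sub K M N S" for X
    using qcoh_sub_carrier[OF N] that by blast
  have "\<exists>Y\<in>qcoh_sub K M N S. \<exists>s\<in>carrier S. X = Y \<oplus>\<^bsub>T\<^esub> tens K M S m s"
    using X
  proof (induction rule: qcoh_sub_induct[OF M.adjoin_submodule(1)[OF N m], consumes 1])
    case (1 a s)
    then obtain n k where a: "n \<in> N" "k \<in> carrier K" "a = n \<oplus>\<^bsub>M\<^esub> k \<odot>\<^bsub>M\<^esub> m" unfolding adjoin_def by blast
    have "tens K M S a s = tens K M S n s \<oplus>\<^bsub>T\<^esub> tens K M S m (smap S k \<otimes>\<^bsub>S\<^esub> s)"
      using a 1 m D(1) by (simp add: tens_add_left tens_balanced)
    then show ?case
      using qcoh_sub_tens[OF N a(1) 1(2)] 1(2) a(2) by (meson S.m_closed smap_closed)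
  next
    case (2 X X')
    then obtain Y s Y' s' where *: "Y \<in> qcoh_sub K M N S" "s \<in> carrier S" "X = Y \<oplus>\<^bsub>T\<^esub> tens K M S m s"
      "Y' \<in> qcoh_sub K M N S" "s' \<in> carrier S" "X' = Y' \<oplus>\<^bsub>T\<^esub> tens K M S m s'" by blast
    have "X \<oplus>\<^bsub>T\<^esub> X' = (Y \<oplus>\<^bsub>T\<^esub> Y') \<oplus>\<^bsub>T\<^esub> tens K M S m (s \<oplus>\<^bsub>S\<^esub> s')"
      using * m by (simp add: tens_add_right T.a_ac sub)
    then show ?case
      using qcoh_sub_add[OF N *(1,4)] *(2,5) by blast
  qed
  then obtain Y s where Y: "Y \<in> qcoh_sub K M N S" "s \<in> carrier S" "X = Y \<oplus>\<^bsub>T\<^esub> tens K M S m s" by blast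
  have "contract (\<lambda>m. smap S (\<omega> m)) X = s"
    using Y m \<omega>(3) contract_vanish[OF N \<omega>(1,2) Y(1)] by (simp add: c sub smap_simps)
  then have "s = \<zero>\<^bsub>S\<^esub>"
    using van \<omega> by simp
  then show ?thesis using Y m sub by simp
qed

text \<open>The submodules reached from \<open>N\<close> by finitely many one-generator steps. Each
  tensor already lies over one of them, so induction along the tower replaces the choice of a
  basis.\<close>

inductive_set tower for N where
  base: "N \<in> tower N"
| step: "L \<in> tower N \<Longrightarrow> m \<in> carrier M \<Longrightarrow> adjoin K M L m \<in> tower N"

lemma tower_submodule: "L \<in> tower N \<Longrightarrow> submodule N K M \<Longrightarrow> submodule L K M \<and> N \<subseteq> L"
  by (induction rule: tower.induct) (use M.adjoin_submodule in blast)+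

text \<open>Starting from an arbitrary member \<open>L\<close> of the tower lets the sum case
  continue from the member found for the left summand until it also accommodates the right
  one.\<close>

lemma tower_exhausts:
  assumes "X \<in> carrier T" "submodule N K M"
  shows "L \<in> tower N \<Longrightarrow> \<exists>L'\<in>tower N. L \<subseteq> L' \<and> X \<in> qcoh_sub K M L' S"
  using assms(1)
proof (induction arbitrary: L rule: tensor_induct)
  case (tens m s)
  have L: "submodule L K M" using tower_submodule tens assms by blast
  have "tens K M S m s \<in> qcoh_sub K M (adjoin K M L m) S"
    using M.adjoin_submodule[OF L tens(1)] tens(2) by (intro qcoh_sub_tens) auto
  then show ?case
    using tower.step[OF tens(3,1)] M.adjoin_submodule(2)[OF L tens(1)] by blast
next
  case (add X Y)
  obtain L' where L': "L' \<in> tower N" "L \<subseteq> L'" "X \<in> qcoh_sub K M L' S" using add by blast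
  obtain L'' where L'': "L'' \<in> tower N" "L' \<subseteq> L''" "Y \<in> qcoh_sub K M L'' S" using add L' by blast
  have sub: "submodule L' K M" "submodule L'' K M" using tower_submodule L' L'' assms by blast+
  show ?case
    using qcoh_sub_add[OF sub(2) qcoh_sub_mono[OF sub L''(2) L'(3)] L''(3)] L'(2) L''(1,2) by blast
qed

text \<open>Descend the tower one generator at a time. The hypothesis survives at every level
  \<open>L\<close>, because functionals that vanish on \<open>L\<close> also vanish on
  \<open>N\<close>.\<close>

lemma vanishing_imp_qcoh_sub:
  assumes N: "submodule N K M" and X: "X \<in> carrier T" and van: "vanishing N X"
  shows "X \<in> qcoh_sub K M N S"
proof -
  have "X \<in> qcoh_sub K M N S" if "L \<in> tower N" "X \<in> qcoh_sub K M L S" for L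
    using that
  proof (induction rule: tower.induct)
    case (step L m)
    have L: "submodule L K M" "N \<subseteq> L" using tower_submodule[OF step(1) N] by auto
    have "vanishing L X" using van L(2) by blast
    then show ?case
      using adjoin_step[OF L(1) step(2,4)] step.IH by blast
  qed
  then show ?thesis
    using tower_exhausts[OF X N tower.base] by blast
qed

text \<open>The zero submodule in \<open>vanishing_imp_qcoh_sub\<close>, applied to
  \<open>X - Y\<close>. The difference is written with the scalar \<open>-1\<close> so that
  linearity of contractions applies to it.\<close>

lemma contract_separates:
  assumes X: "X \<in> carrier T" and Y: "Y \<in> carrier T"
    and eq: "\<And>\<omega>. linear_map M (self K) \<omega> \<Longrightarrow> contract (\<lambda>m. smap S (\<omega> m)) X = contract (\<lambda>m. smap S (\<omega> m)) Y"
  shows "X = Y"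
proof -
  let ?Z = "X \<oplus>\<^bsub>T\<^esub> (\<ominus>\<^bsub>S\<^esub> \<one>\<^bsub>S\<^esub>) \<odot>\<^bsub>T\<^esub> Y"
  have N: "submodule {\<zero>\<^bsub>M\<^esub>} K M"
    by (rule M.submoduleI) auto
  have "contract (\<lambda>m. smap S (\<omega> m)) ?Z = \<zero>\<^bsub>S\<^esub>" if w: "linear_map M (self K) \<omega>" for \<omega>
  proof -
    note c = contract[OF linear_map_self[OF w S_A]]
    show ?thesis using X Y by (simp add: c eq[OF w] S.l_minus S.r_neg)
  qed
  then have "?Z \<in> qcoh_sub K M {\<zero>\<^bsub>M\<^esub>} S"
    using X Y by (intro vanishing_imp_qcoh_sub[OF N]) auto
  then have "?Z = \<zero>\<^bsub>T\<^esub>"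
    by (induction rule: qcoh_sub_induct[OF N, consumes 1]) auto
  then have "X \<oplus>\<^bsub>T\<^esub> \<ominus>\<^bsub>T\<^esub> Y = \<zero>\<^bsub>T\<^esub>"
    using X Y by (simp add: T.smult_l_minus)
  then show ?thesis
    using X Y T.minus_equality[of X "\<ominus>\<^bsub>T\<^esub> Y"] by simp
qed

text \<open>Flatness over a field: every functional on \<open>N\<close> extends to \<open>M\<close>,
  so the contractions that separate \<open>N \<otimes> S\<close> factor through
  \<open>incl\<close>.\<close>

lemma incl_inj:
  assumes N: "submodule N K M"
  shows "inj_on (incl N) (carrier (tensor K (M\<lparr>carrier := N\<rparr>) S))"
proof
  interpret n: vector_tensor K "M\<lparr>carrier := N\<rparr>" S
    using module_N[OF N] by (simp add: vector_tensor_def base_field_axioms tensor_productI S_A)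
  fix X Y assume XY: "X \<in> carrier n.T" "Y \<in> carrier n.T" "incl N X = incl N Y"
  show "X = Y"
  proof (rule n.contract_separates)
    fix \<omega> assume w: "linear_map (M\<lparr>carrier := N\<rparr>) (self K) \<omega>"
    obtain \<omega>' where w': "linear_map M (self K) \<omega>'" "\<forall>n\<in>N. \<omega>' n = \<omega> n"
      using extend_functional[OF module_M N w] by blast
    note c = contract[OF linear_map_self[OF w'(1) S_A]]
    note nc = n.contract[OF linear_map_self[OF w S_A]]
    have "n.contract (\<lambda>m. smap S (\<omega> m)) Z = contract (\<lambda>m. smap S (\<omega>' m)) (incl N Z)" if "Z \<in> carrier n.T" for Z
      using that by (induction rule: n.tensor_induct)
        (use w'(2) M.submoduleD(1)[OF N] in \<open>simp_all add: c nc incl[OF N]\<close>)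
    then show "n.contract (\<lambda>m. smap S (\<omega> m)) X = n.contract (\<lambda>m. smap S (\<omega> m)) Y"
      using XY by simp
  qed (use XY in auto)
qed

end

section \<open>Algebras with carrier in the universe\<close>

text \<open>Algebras must have their elements in the universe type, while tensor products and
  square-zero extensions arise in other types. The ring structure is transported along an injection
  \<open>e\<close> with inverse \<open>d\<close>.\<close>

definition embed_alg :: "('c \<Rightarrow> 'u) \<Rightarrow> ('c, 'z) ring_scheme \<Rightarrow> ('u \<Rightarrow> 'u) \<Rightarrow> 'u calg" where
  "embed_alg e R \<phi> = (let d = inv_into (carrier R) e in
     \<lparr>carrier = e ` carrier R, monoid.mult = (\<lambda>x y. e (d x \<otimes>\<^bsub>R\<^esub> d y)), monoid.one = e \<one>\<^bsub>R\<^esub>,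
      ring.zero = e \<zero>\<^bsub>R\<^esub>, ring.add = (\<lambda>x y. e (d x \<oplus>\<^bsub>R\<^esub> d y)), smap = \<phi>\<rparr>)"

lemma embed_alg_sel [simp]:
  "carrier (embed_alg e R \<phi>) = e ` carrier R" "\<one>\<^bsub>embed_alg e R \<phi>\<^esub> = e \<one>\<^bsub>R\<^esub>"
  "\<zero>\<^bsub>embed_alg e R \<phi>\<^esub> = e \<zero>\<^bsub>R\<^esub>" "smap (embed_alg e R \<phi>) = \<phi>"
  "inj_on e (carrier R) \<Longrightarrow> x \<in> carrier R \<Longrightarrow> y \<in> carrier R \<Longrightarrow>
     e x \<otimes>\<^bsub>embed_alg e R \<phi>\<^esub> e y = e (x \<otimes>\<^bsub>R\<^esub> y)"
  "inj_on e (carrier R) \<Longrightarrow> x \<in> carrier R \<Longrightarrow> y \<in> carrier R \<Longrightarrow>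
     e x \<oplus>\<^bsub>embed_alg e R \<phi>\<^esub> e y = e (x \<oplus>\<^bsub>R\<^esub> y)"
  by (simp_all add: embed_alg_def Let_def)

lemma cring_embed_alg:
  assumes "cring R" "inj_on e (carrier R)"
  shows "cring (embed_alg e R \<phi>)"
proof -
  interpret R: cring R by fact
  show ?thesis
  proof (intro cringI abelian_groupI comm_monoidI)
    show "\<exists>y\<in>carrier (embed_alg e R \<phi>). y \<oplus>\<^bsub>embed_alg e R \<phi>\<^esub> x = \<zero>\<^bsub>embed_alg e R \<phi>\<^esub>"
      if "x \<in> carrier (embed_alg e R \<phi>)" for x
      using that assms(2) R.l_neg by (auto intro!: bexI[OF _ R.a_inv_closed])
  qed (use assms(2) in \<open>auto simp: R.a_ac R.m_ac R.l_distr R.r_distr\<close>)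
qed

lemma infinite_times_lepoll:
  assumes "infinite (UNIV :: 'u set)"
  shows "(UNIV :: ('u \<times> 'u) set) \<lesssim> (UNIV :: 'u set)"
  using card_of_Times_same_infinite[OF assms]
  by (metis UNIV_Times_UNIV eqpoll_iff_card_of_ordIso eqpoll_imp_lepoll)

text \<open>The tensor product is a quotient of a free abelian group on pairs from the universe.
  Over an infinite basis such a group is no larger than its basis, and pairs from an infinite type
  are no more numerous than its elements.\<close>

lemma (in base_ring) carrier_tensor_lepoll:
  fixes M :: "('u, 'u) module"
  assumes "infinite (UNIV :: 'u set)" "tensor_product K M S"
  shows "carrier (tensor K M S) \<lesssim> (UNIV :: 'u set)"
proof -
  interpret tensor_product K M S by fact
  have "carrier T \<lesssim> carrier P"
    unfolding carrier_T by (rule image_lepoll)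
  also have "carrier P \<lesssim> carrier (free_Abelian_group (UNIV :: ('u \<times> 'u) set))"
    by (rule subset_imp_lepoll) auto
  also have "\<dots> \<approx> (UNIV :: ('u \<times> 'u) set)"
    using assms(1) finite_prod by (intro eqpoll_free_Abelian_group_infinite) blast
  also have "\<dots> \<lesssim> (UNIV :: 'u set)"
    by (rule infinite_times_lepoll[OF assms(1)])
  finally show ?thesis .
qed

context base_ring
begin

lemma embed_alg_A:
  assumes "cring R" "inj_on e (carrier R)" "i \<in> ring_hom K R"
  shows "embed_alg e R (\<lambda>k\<in>carrier K. e (i k)) \<in> A"
  using cring_embed_alg[OF assms(1,2)] assms ring_hom_memE[OF assms(3)] unfolding CAlg_def
  by (auto intro!: ring_hom_memI) (auto simp: ring.ring_simprules cring.axioms cring_K)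

lemma embed_alg_hm_in:
  assumes "cring R" "inj_on e (carrier R)" "i \<in> ring_hom K R" "S \<in> A" "g \<in> ring_hom S R"
    "\<And>k. k \<in> carrier K \<Longrightarrow> g (smap S k) = i k"
  shows "(\<lambda>s\<in>carrier S. e (g s)) \<in> hm S (embed_alg e R (\<lambda>k\<in>carrier K. e (i k)))"
proof -
  interpret S: cring S using assms(4) by (rule CAlgD)
  show ?thesis
    using assms(2,6) ring_hom_memE[OF assms(5)] CAlgD(4)[OF assms(4)] unfolding alg_hom_def
    by (auto intro!: ring_hom_memI simp: compose_def fun_eq_iff)
qed

end

section \<open>Tensor products of algebras\<close>

text \<open>\<open>tensor\<close> expects a module on the left, so the first algebra of
  \<open>V \<otimes> U\<close> enters as a module and its multiplication is supplied
  separately.\<close>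

definition alg_module :: "'u calg \<Rightarrow> ('u, 'u) module" where
  "alg_module T = \<lparr>carrier = carrier T, monoid.mult = monoid.mult T, monoid.one = monoid.one T,
     ring.zero = ring.zero T, ring.add = ring.add T, smult = (\<lambda>k t. smap T k \<otimes>\<^bsub>T\<^esub> t)\<rparr>"

lemma alg_module_sel [simp]:
  "carrier (alg_module T) = carrier T" "ring.zero (alg_module T) = ring.zero T"
  "ring.add (alg_module T) = ring.add T" "k \<odot>\<^bsub>alg_module T\<^esub> t = smap T k \<otimes>\<^bsub>T\<^esub> t"
  by (simp_all add: alg_module_def)

lemma (in base_ring) module_alg_module:
  assumes "T \<in> A"
  shows "module K (alg_module T)"
proof -
  interpret T: cring T using assms by (rule CAlgD)
  note s = ring_hom_memE[OF CAlgD(2)[OF assms]]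
  show ?thesis
  proof (intro moduleI abelian_groupI)
    show "\<exists>y\<in>carrier (alg_module T). y \<oplus>\<^bsub>alg_module T\<^esub> x = \<zero>\<^bsub>alg_module T\<^esub>"
      if "x \<in> carrier (alg_module T)" for x
      using that T.l_neg T.a_inv_closed by auto
  qed (auto simp: cring_K s T.a_ac T.m_assoc T.l_distr T.r_distr)
qed

section \<open>The ring structure on a tensor product of algebras\<close>

locale tensor_algebra = base_ring K for K :: "'u ring" +
  fixes V U :: "'u calg"
  assumes V_A: "V \<in> A" and U_A: "U \<in> A"
begin

sublocale tensor_product K "alg_module V" U
  by (rule tensor_productI[OF module_alg_module[OF V_A] U_A])

sublocale V: cring V using V_A by (rule CAlgD)

lemma smap_V [simp]: "k \<in> carrier K \<Longrightarrow> smap V k \<in> carrier V"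
  using CAlgD[OF V_A] by simp

abbreviation tn where "tn v u \<equiv> tens K (alg_module V) U v u"

text \<open>Multiplication by the pure tensor \<open>v \<otimes> u\<close>. Since
  \<open>lift\<close> treats one tensor argument at a time, the full product \<open>mul\<close> is a
  second lift, in the left argument.\<close>

definition lmul where
  "lmul v u = lift T (\<lambda>v' u'. tn (v \<otimes>\<^bsub>V\<^esub> v') (u \<otimes>\<^bsub>U\<^esub> u'))"

definition mul where
  "mul X Y = lift T (\<lambda>v u. lmul v u Y) X"

lemma tn_add_left: "v \<in> carrier V \<Longrightarrow> v' \<in> carrier V \<Longrightarrow> u \<in> carrier U \<Longrightarrow>
   tn (v \<oplus>\<^bsub>V\<^esub> v') u = tn v u \<oplus>\<^bsub>T\<^esub> tn v' u"
  using tens_add_left[of v v' u] by simp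

lemma tn_balanced: "k \<in> carrier K \<Longrightarrow> v \<in> carrier V \<Longrightarrow> u \<in> carrier U \<Longrightarrow>
   tn (smap V k \<otimes>\<^bsub>V\<^esub> v) u = tn v (smap U k \<otimes>\<^bsub>U\<^esub> u)"
  using tens_balanced[of k v u] by simp

lemma lmul:
  assumes vu: "v \<in> carrier V" "u \<in> carrier U"
  shows "\<And>v' u'. v' \<in> carrier V \<Longrightarrow> u' \<in> carrier U \<Longrightarrow> lmul v u (tn v' u') = tn (v \<otimes>\<^bsub>V\<^esub> v') (u \<otimes>\<^bsub>U\<^esub> u')"
    "\<And>Y. Y \<in> carrier T \<Longrightarrow> lmul v u Y \<in> carrier T"
    "\<And>X Y. X \<in> carrier T \<Longrightarrow> Y \<in> carrier T \<Longrightarrow> lmul v u (X \<oplus>\<^bsub>T\<^esub> Y) = lmul v u X \<oplus>\<^bsub>T\<^esub> lmul v u Y"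
proof -
  have "tn (v \<otimes>\<^bsub>V\<^esub> (smap V k \<otimes>\<^bsub>V\<^esub> v')) (u \<otimes>\<^bsub>U\<^esub> u') = tn (v \<otimes>\<^bsub>V\<^esub> v') (u \<otimes>\<^bsub>U\<^esub> (smap U k \<otimes>\<^bsub>U\<^esub> u'))"
    if "k \<in> carrier K" "v' \<in> carrier V" "u' \<in> carrier U" for k v' u'
    using vu that tn_balanced[of k "v \<otimes>\<^bsub>V\<^esub> v'" "u \<otimes>\<^bsub>U\<^esub> u'"] by (simp add: V.m_lcomm S.m_lcomm)
  then have b: "balanced T (\<lambda>v' u'. tn (v \<otimes>\<^bsub>V\<^esub> v') (u \<otimes>\<^bsub>U\<^esub> u'))"
    unfolding balanced_def using vu by (simp add: V.r_distr S.r_distr tn_add_left tens_add_right)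
  show "\<And>v' u'. v' \<in> carrier V \<Longrightarrow> u' \<in> carrier U \<Longrightarrow> lmul v u (tn v' u') = tn (v \<otimes>\<^bsub>V\<^esub> v') (u \<otimes>\<^bsub>U\<^esub> u')"
    "\<And>Y. Y \<in> carrier T \<Longrightarrow> lmul v u Y \<in> carrier T"
    "\<And>X Y. X \<in> carrier T \<Longrightarrow> Y \<in> carrier T \<Longrightarrow> lmul v u (X \<oplus>\<^bsub>T\<^esub> Y) = lmul v u X \<oplus>\<^bsub>T\<^esub> lmul v u Y"
    using lift[OF T.abelian_group_axioms b] unfolding lmul_def by simp_all
qed

lemma mul_aux:
  assumes Y: "Y \<in> carrier T"
  shows "balanced T (\<lambda>v u. lmul v u Y)"
  unfolding balanced_def
proof (intro ballI conjI; simp only: alg_module_sel)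
  fix v u assume vu: "v \<in> carrier V" "u \<in> carrier U"
  show "lmul v u Y \<in> carrier T" using lmul vu Y by simp
  show "lmul (v \<oplus>\<^bsub>V\<^esub> v') u Y = lmul v u Y \<oplus>\<^bsub>T\<^esub> lmul v' u Y" if "v' \<in> carrier V" for v'
    using Y by (induction rule: tensor_induct)
      (use vu that in \<open>simp_all add: lmul V.l_distr tn_add_left T.a_ac\<close>)
  show "lmul v (u \<oplus>\<^bsub>U\<^esub> u') Y = lmul v u Y \<oplus>\<^bsub>T\<^esub> lmul v u' Y" if "u' \<in> carrier U" for u'
    using Y by (induction rule: tensor_induct)
      (use vu that in \<open>simp_all add: lmul S.l_distr tens_add_right T.a_ac\<close>)
  show "lmul (smap V k \<otimes>\<^bsub>V\<^esub> v) u Y = lmul v (smap U k \<otimes>\<^bsub>U\<^esub> u) Y" if "k \<in> carrier K" for k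
    using Y by (induction rule: tensor_induct)
      (use vu that in \<open>simp_all add: lmul V.m_assoc S.m_assoc tn_balanced\<close>)
qed

lemma mul:
  shows mul_closed: "\<And>X Y. X \<in> carrier T \<Longrightarrow> Y \<in> carrier T \<Longrightarrow> mul X Y \<in> carrier T"
    and mul_add_left: "\<And>X X' Y. X \<in> carrier T \<Longrightarrow> X' \<in> carrier T \<Longrightarrow> Y \<in> carrier T \<Longrightarrow>
      mul (X \<oplus>\<^bsub>T\<^esub> X') Y = mul X Y \<oplus>\<^bsub>T\<^esub> mul X' Y"
    and mul_lmul: "\<And>v u Y. v \<in> carrier V \<Longrightarrow> u \<in> carrier U \<Longrightarrow> Y \<in> carrier T \<Longrightarrow> mul (tn v u) Y = lmul v u Y"
  unfolding mul_def using lift[OF T.abelian_group_axioms mul_aux] by simp_all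

lemma mul_add_right:
  assumes "X \<in> carrier T" "Y \<in> carrier T" "Y' \<in> carrier T"
  shows "mul X (Y \<oplus>\<^bsub>T\<^esub> Y') = mul X Y \<oplus>\<^bsub>T\<^esub> mul X Y'"
  using assms(1) by (induction rule: tensor_induct)
    (use assms(2,3) in \<open>simp_all add: mul lmul T.a_ac\<close>)

lemma mul_tn: "v \<in> carrier V \<Longrightarrow> u \<in> carrier U \<Longrightarrow> v' \<in> carrier V \<Longrightarrow> u' \<in> carrier U \<Longrightarrow>
   mul (tn v u) (tn v' u') = tn (v \<otimes>\<^bsub>V\<^esub> v') (u \<otimes>\<^bsub>U\<^esub> u')"
  by (simp add: mul_lmul lmul)

lemma mul_comm:
  assumes X: "X \<in> carrier T" and Y: "Y \<in> carrier T"
  shows "mul X Y = mul Y X"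
  using X
proof (induction rule: tensor_induct)
  case (tens v u)
  show ?case
    using Y by (induction rule: tensor_induct)
      (use tens in \<open>simp_all add: mul_tn mul_add_left mul_add_right V.m_comm S.m_comm\<close>)
qed (use Y in \<open>simp add: mul_add_left mul_add_right\<close>)

lemma mul_assoc:
  assumes X: "X \<in> carrier T" and Y: "Y \<in> carrier T" and Z: "Z \<in> carrier T"
  shows "mul (mul X Y) Z = mul X (mul Y Z)"
  using X
proof (induction rule: tensor_induct)
  case (tens v u)
  show ?case
    using Y
  proof (induction rule: tensor_induct)
    case (tens v' u')
    show ?case
      using Z by (induction rule: tensor_induct)
        (use \<open>v \<in> _\<close> \<open>u \<in> _\<close> tens in \<open>simp_all add: mul_tn mul_add_right mul_closed V.m_assoc S.m_assoc\<close>)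
  qed (use tens Z in \<open>simp add: mul_add_left mul_add_right mul_closed\<close>)
qed (use Y Z in \<open>simp add: mul_add_left mul_closed\<close>)

lemma mul_lcomm:
  "X \<in> carrier T \<Longrightarrow> Y \<in> carrier T \<Longrightarrow> Z \<in> carrier T \<Longrightarrow> mul X (mul Y Z) = mul Y (mul X Z)"
  using mul_assoc[of X Y Z] mul_assoc[of Y X Z] mul_comm[of X Y] by simp

definition tring :: "('u, 'u) tensor_elt ring" where
  "tring = \<lparr>carrier = carrier T, monoid.mult = mul, monoid.one = tn \<one>\<^bsub>V\<^esub> \<one>\<^bsub>U\<^esub>,
     ring.zero = \<zero>\<^bsub>T\<^esub>, ring.add = ring.add T\<rparr>"

lemma tring_sel [simp]: "carrier tring = carrier T" "monoid.mult tring = mul"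
  "\<one>\<^bsub>tring\<^esub> = tn \<one>\<^bsub>V\<^esub> \<one>\<^bsub>U\<^esub>" "\<zero>\<^bsub>tring\<^esub> = \<zero>\<^bsub>T\<^esub>" "ring.add tring = ring.add T"
  by (simp_all add: tring_def)

lemma cring_tring: "cring tring"
proof (intro cringI abelian_groupI comm_monoidI)
  show "\<exists>y\<in>carrier tring. y \<oplus>\<^bsub>tring\<^esub> x = \<zero>\<^bsub>tring\<^esub>" if "x \<in> carrier tring" for x
    using that T.l_neg T.a_inv_closed by auto
  show "\<one>\<^bsub>tring\<^esub> \<otimes>\<^bsub>tring\<^esub> X = X" if X: "X \<in> carrier tring" for X
    using X[unfolded tring_sel] by (induction rule: tensor_induct) (simp_all add: mul_tn mul_add_right)
qed (simp_all add: T.a_ac mul_closed mul_assoc mul_comm mul_lcomm mul_add_right)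

lemma tring_homs:
  shows "(\<lambda>v. tn v \<one>\<^bsub>U\<^esub>) \<in> ring_hom V tring" "(\<lambda>u. tn \<one>\<^bsub>V\<^esub> u) \<in> ring_hom U tring"
  by (auto intro!: ring_hom_memI simp: mul_tn tn_add_left tens_add_right)

end

section \<open>Coproducts of commutative K-algebras\<close>

context base_ring
begin

text \<open>Phrased through the identification \<open>e\<close> with the tensor product; the universal property is
  \<open>coproduct_universal\<close>.\<close>

definition coproduct where
  "coproduct V U C i j e \<longleftrightarrow> C \<in> A \<and> i \<in> hm V C \<and> j \<in> hm U C \<and>
     bij_betw e (carrier (tensor K (alg_module V) U)) (carrier C) \<and>
     (\<forall>X\<in>carrier (tensor K (alg_module V) U). \<forall>Y\<in>carrier (tensor K (alg_module V) U).
        e (X \<oplus>\<^bsub>tensor K (alg_module V) U\<^esub> Y) = e X \<oplus>\<^bsub>C\<^esub> e Y) \<and>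
     (\<forall>v\<in>carrier V. \<forall>u\<in>carrier U. e (tens K (alg_module V) U v u) = i v \<otimes>\<^bsub>C\<^esub> j u)"

lemma coproduct_exists:
  assumes "infinite (UNIV :: 'u set)" "V \<in> A" "U \<in> A"
  shows "\<exists>C i j e. coproduct V U C i j e"
proof -
  interpret tensor_algebra K V U by unfold_locales fact+
  obtain e :: "('u, 'u) tensor_elt \<Rightarrow> 'u" where e: "inj_on e (carrier tring)"
    using carrier_tensor_lepoll[OF assms(1) tensor_product_axioms] by (auto simp: lepoll_def)
  define i where "i k = tn (smap V k) \<one>\<^bsub>U\<^esub>" for k
  have i2: "tn \<one>\<^bsub>V\<^esub> (smap U k) = i k" if "k \<in> carrier K" for k
    using tn_balanced[OF that, of "\<one>\<^bsub>V\<^esub>" "\<one>\<^bsub>U\<^esub>"] that by (simp add: i_def)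
  have i: "i \<in> ring_hom K tring"
    using ring_hom_trans[OF CAlgD(2)[OF V_A] tring_homs(1)] by (simp add: i_def[abs_def] comp_def)
  let ?C = "embed_alg e tring (\<lambda>k\<in>carrier K. e (i k))"
  have "coproduct V U ?C (\<lambda>v\<in>carrier V. e (tn v \<one>\<^bsub>U\<^esub>)) (\<lambda>u\<in>carrier U. e (tn \<one>\<^bsub>V\<^esub> u)) e"
    unfolding coproduct_def
  proof (intro conjI ballI)
    show "?C \<in> A" by (rule embed_alg_A[OF cring_tring e i])
    show "(\<lambda>v\<in>carrier V. e (tn v \<one>\<^bsub>U\<^esub>)) \<in> hm V ?C"
      by (rule embed_alg_hm_in[OF cring_tring e i V_A tring_homs(1)]) (simp add: i_def)
    show "(\<lambda>u\<in>carrier U. e (tn \<one>\<^bsub>V\<^esub> u)) \<in> hm U ?C"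
      by (rule embed_alg_hm_in[OF cring_tring e i U_A tring_homs(2)]) (simp add: i2)
    show "bij_betw e (carrier T) (carrier ?C)"
      using e by (simp add: bij_betw_def)
  qed (use e in \<open>simp_all add: mul_tn\<close>)
  then show ?thesis by blast
qed

lemma coproductD:
  assumes "coproduct V U C i j e"
  shows "C \<in> A" "i \<in> hm V C" "j \<in> hm U C"
    "bij_betw e (carrier (tensor K (alg_module V) U)) (carrier C)"
    "\<And>X Y. X \<in> carrier (tensor K (alg_module V) U) \<Longrightarrow> Y \<in> carrier (tensor K (alg_module V) U) \<Longrightarrow>
        e (X \<oplus>\<^bsub>tensor K (alg_module V) U\<^esub> Y) = e X \<oplus>\<^bsub>C\<^esub> e Y"
    "\<And>v u. v \<in> carrier V \<Longrightarrow> u \<in> carrier U \<Longrightarrow> e (tens K (alg_module V) U v u) = i v \<otimes>\<^bsub>C\<^esub> j u"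
    "\<And>X. X \<in> carrier (tensor K (alg_module V) U) \<Longrightarrow> e X \<in> carrier C"
    "\<And>c. c \<in> carrier C \<Longrightarrow> \<exists>X\<in>carrier (tensor K (alg_module V) U). c = e X"
  using assms unfolding coproduct_def by (auto simp: bij_betw_def)

lemma coproduct_induct:
  assumes C: "coproduct V U C i j e" "V \<in> A" "U \<in> A" and c: "c \<in> carrier C"
    and "\<And>v u. v \<in> carrier V \<Longrightarrow> u \<in> carrier U \<Longrightarrow> Q (i v \<otimes>\<^bsub>C\<^esub> j u)"
    "\<And>c d. c \<in> carrier C \<Longrightarrow> d \<in> carrier C \<Longrightarrow> Q c \<Longrightarrow> Q d \<Longrightarrow> Q (c \<oplus>\<^bsub>C\<^esub> d)"
  shows "Q c"
proof -
  interpret tensor_algebra K V U using C by unfold_locales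
  note D = coproductD[OF C(1)]
  have "Q (e X)" if "X \<in> carrier T" for X
    using that by (induction rule: tensor_induct) (auto simp: D intro!: assms(5,6))
  then show ?thesis
    using D(8)[OF c] by blast
qed

text \<open>The map is \<open>v \<otimes> u \<mapsto> a v \<otimes> b u\<close>, with the product of
  \<open>W\<close> on the right, read through the inverse of \<open>e\<close>. Multiplicativity is
  checked on the generators \<open>i v \<otimes> j u\<close> in both arguments.\<close>

lemma coproduct_universal:
  assumes C: "coproduct V U C i j e" "V \<in> A" "U \<in> A" and W: "W \<in> A" "a \<in> hm V W" "b \<in> hm U W"
  shows "\<exists>c\<in>hm C W. cmp V c i = a \<and> cmp U c j = b"
proof -
  interpret t: tensor_algebra K V U using C by unfold_locales
  interpret W: cring W using W(1) by (rule CAlgD)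
  note D = coproductD[OF C(1)]
  note ha = alg_homD[OF W(2)] and hb = alg_homD[OF W(3)]
  note hi = alg_homD[OF D(2)] and hj = alg_homD[OF D(3)]
  interpret C: cring C using D(1) by (rule CAlgD)
  have bal: "t.balanced W (\<lambda>v u. a v \<otimes>\<^bsub>W\<^esub> b u)"
    unfolding t.balanced_def using CAlgD(4)[OF W(1)]
    by (simp add: ha hb W.l_distr W.r_distr W.m_ac)
  define l where "l = t.lift W (\<lambda>v u. a v \<otimes>\<^bsub>W\<^esub> b u)"
  note l = t.lift[OF W.abelian_group_axioms bal, folded l_def, simplified]
  define c where "c = (\<lambda>x\<in>carrier C. l (inv_into (carrier t.T) e x))"
  have ce: "c (e X) = l X" if "X \<in> carrier t.T" for X
    using that D(4,7) by (simp add: c_def bij_betw_inv_into_left)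
  have ct: "c (i v \<otimes>\<^bsub>C\<^esub> j u) = a v \<otimes>\<^bsub>W\<^esub> b u" if "v \<in> carrier V" "u \<in> carrier U" for v u
    using ce[of "t.tn v u"] that l(2) by (simp add: D(6))
  have cl: "c x \<in> carrier W" if "x \<in> carrier C" for x
    using D(8)[OF that] ce l(3) by auto
  have ca: "c (x \<oplus>\<^bsub>C\<^esub> y) = c x \<oplus>\<^bsub>W\<^esub> c y" if xy: "x \<in> carrier C" "y \<in> carrier C" for x y
  proof -
    obtain X Y where XY: "X \<in> carrier t.T" "x = e X" "Y \<in> carrier t.T" "y = e Y"
      using D(8)[OF xy(1)] D(8)[OF xy(2)] by blast
    have "c (e X \<oplus>\<^bsub>C\<^esub> e Y) = l (X \<oplus>\<^bsub>t.T\<^esub> Y)"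
      using D(5)[OF XY(1,3)] ce[OF t.T.a_closed[OF XY(1,3)]] by simp
    then show ?thesis using XY by (simp add: ce l(4))
  qed
  have ci: "c (i v) = a v" if "v \<in> carrier V" for v
    using ct[OF that t.S.one_closed] that by (simp add: hb hj ha hi)
  have cj: "c (j u) = b u" if "u \<in> carrier U" for u
    using ct[OF t.V.one_closed that] that by (simp add: hb hj ha hi)
  have cm: "c (x \<otimes>\<^bsub>C\<^esub> y) = c x \<otimes>\<^bsub>W\<^esub> c y" if x: "x \<in> carrier C" and y: "y \<in> carrier C" for x y
    using x
  proof (induction rule: coproduct_induct[OF C, consumes 1])
    case (1 v u)
    show ?case
      using y
    proof (induction rule: coproduct_induct[OF C, consumes 1])
      case (1 v' u')
      have "i v \<otimes>\<^bsub>C\<^esub> j u \<otimes>\<^bsub>C\<^esub> (i v' \<otimes>\<^bsub>C\<^esub> j u') = i (v \<otimes>\<^bsub>V\<^esub> v') \<otimes>\<^bsub>C\<^esub> j (u \<otimes>\<^bsub>U\<^esub> u')"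
        using 1 \<open>v \<in> _\<close> \<open>u \<in> _\<close> by (simp add: hi hj C.m_ac)
      then show ?case
        using 1 \<open>v \<in> _\<close> \<open>u \<in> _\<close> by (simp add: ct ha hb W.m_ac)
    qed (use 1 in \<open>simp add: hi hj C.r_distr W.r_distr ca cl\<close>)
  qed (use y in \<open>simp add: C.l_distr W.l_distr ca cl\<close>)
  have "c \<one>\<^bsub>C\<^esub> = \<one>\<^bsub>W\<^esub>"
    using ci[OF t.V.one_closed] by (simp add: hi ha)
  then have "c \<in> ring_hom C W"
    by (intro ring_hom_memI cl ca cm)
  moreover have "compose (carrier K) c (smap C) = smap W"
  proof -
    have "c (smap C k) = smap W k" if "k \<in> carrier K" for k
      using that ci[of "smap V k"] by (simp add: hi ha)
    then show ?thesis
      using CAlgD(3)[OF W(1)] by (auto simp: compose_def fun_eq_iff extensional_def)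
  qed
  ultimately have "c \<in> hm C W" by (simp add: alg_hom_def c_def)
  moreover have "cmp V c i = a" "cmp U c j = b"
    using ha(2) hb(2) by (auto simp: compose_def fun_eq_iff extensional_def ci cj)
  ultimately show ?thesis by blast
qed

end

section \<open>Duals are separated by base points\<close>

context base_field
begin

lemma coproduct_contract:
  assumes C: "coproduct V U C i j e" "V \<in> A" "U \<in> A" and w: "linear_map (alg_module V) (self K) \<omega>"
  defines "d \<equiv> \<lambda>c. tensor_product.contract K (alg_module V) U (\<lambda>m. smap U (\<omega> m))
     (inv_into (carrier (tensor K (alg_module V) U)) e c)"
  shows "\<And>c. c \<in> carrier C \<Longrightarrow> d c \<in> carrier U"
    "\<And>c c'. c \<in> carrier C \<Longrightarrow> c' \<in> carrier C \<Longrightarrow> d (c \<oplus>\<^bsub>C\<^esub> c') = d c \<oplus>\<^bsub>U\<^esub> d c'"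
    "\<And>c u. c \<in> carrier C \<Longrightarrow> u \<in> carrier U \<Longrightarrow> d (j u \<otimes>\<^bsub>C\<^esub> c) = u \<otimes>\<^bsub>U\<^esub> d c"
    "\<And>v u. v \<in> carrier V \<Longrightarrow> u \<in> carrier U \<Longrightarrow> d (i v \<otimes>\<^bsub>C\<^esub> j u) = smap U (\<omega> v) \<otimes>\<^bsub>U\<^esub> u"
proof -
  interpret t: tensor_algebra K V U using C by unfold_locales
  note D = coproductD[OF C(1)]
  interpret C: cring C using D(1) by (rule CAlgD)
  note k = t.contract[OF linear_map_self[OF w C(3)]]
  note hi = alg_homD[OF D(2)] and hj = alg_homD[OF D(3)]
  have de: "d (e X) = t.contract (\<lambda>m. smap U (\<omega> m)) X" if "X \<in> carrier t.T" for X
    using that D(4) by (simp add: d_def bij_betw_inv_into_left)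
  show cl: "d c \<in> carrier U" if "c \<in> carrier C" for c
    using D(8)[OF that] de k(2) by auto
  show add: "d (c \<oplus>\<^bsub>C\<^esub> c') = d c \<oplus>\<^bsub>U\<^esub> d c'" if cc: "c \<in> carrier C" "c' \<in> carrier C" for c c'
  proof -
    obtain X Y where XY: "X \<in> carrier t.T" "c = e X" "Y \<in> carrier t.T" "c' = e Y"
      using D(8)[OF cc(1)] D(8)[OF cc(2)] by blast
    then show ?thesis using D(5)[of X Y] de[of "X \<oplus>\<^bsub>t.T\<^esub> Y"] by (simp add: de k)
  qed
  show gen: "d (i v \<otimes>\<^bsub>C\<^esub> j u) = smap U (\<omega> v) \<otimes>\<^bsub>U\<^esub> u" if "v \<in> carrier V" "u \<in> carrier U" for v u
    using de[of "t.tn v u"] that by (simp add: D(6) k)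
  show "d (j u \<otimes>\<^bsub>C\<^esub> c) = u \<otimes>\<^bsub>U\<^esub> d c" if c: "c \<in> carrier C" and u: "u \<in> carrier U" for c u
    using c
  proof (induction rule: coproduct_induct[OF C, consumes 1])
    case (1 v u')
    have "j u \<otimes>\<^bsub>C\<^esub> (i v \<otimes>\<^bsub>C\<^esub> j u') = i v \<otimes>\<^bsub>C\<^esub> j (u \<otimes>\<^bsub>U\<^esub> u')"
      using 1 u by (simp add: hi hj C.m_ac)
    moreover have "smap U (\<omega> v) \<in> carrier U"
      using linear_mapD(1)[OF linear_map_self[OF w C(3)], of v] 1 by simp
    ultimately show ?case using 1 u by (simp add: gen t.S.m_lcomm)
  qed (use u in \<open>simp add: hj C.r_distr t.S.r_distr add cl\<close>)
qed

text \<open>\<open>contract_separates\<close> for the vector space \<open>V\<close>, transported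
  along the identification of its tensor product with \<open>C\<close>.\<close>

lemma coproduct_contract_separates:
  assumes C: "coproduct V U C i j e" "V \<in> A" "U \<in> A" and c: "c \<in> carrier C" "c' \<in> carrier C"
    and eq: "\<And>\<omega>. linear_map (alg_module V) (self K) \<omega> \<Longrightarrow>
      tensor_product.contract K (alg_module V) U (\<lambda>m. smap U (\<omega> m))
        (inv_into (carrier (tensor K (alg_module V) U)) e c) =
      tensor_product.contract K (alg_module V) U (\<lambda>m. smap U (\<omega> m))
        (inv_into (carrier (tensor K (alg_module V) U)) e c')"
  shows "c = c'"
proof -
  interpret t: tensor_algebra K V U using C by unfold_locales
  interpret v: vector_tensor K "alg_module V" U
    by (simp add: vector_tensor_def base_field_axioms t.tensor_product_axioms)
  note b = coproductD(4)[OF C(1)]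
  have "inv_into (carrier t.T) e c = inv_into (carrier t.T) e c'"
    by (rule v.contract_separates) (use b c eq in \<open>auto simp: bij_betw_def inv_into_into\<close>)
  then show ?thesis
    using b c by (metis bij_betw_inv_into_right)
qed

text \<open>Given \<open>\<mu> \<in> N\<^sup>*(V)\<close>, each functional \<open>\<omega>\<close> on \<open>V\<close> gives a base point of \<open>N\<^sup>*\<close>: apply \<open>\<mu>\<close> over
  \<open>V \<otimes> U\<close> and contract with \<open>\<omega>\<close> to end up in \<open>U\<close>.\<close>

lemma dual_base_points_separate:
  assumes inf: "infinite (UNIV :: 'u set)" and N: "linear_functor K N" and S: "S \<in> A"
    and n: "n \<in> carrier (Obj N S)" "n' \<in> carrier (Obj N S)"
    and eq: "\<And>m. m \<in> carrier (Obj (dual K N) (self K)) \<Longrightarrow>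
      m S n = m S n'"
    and V: "V \<in> A" "f \<in> hm S V" and \<mu>: "\<mu> \<in> carrier (Obj (dual K N) V)"
  shows "\<mu> (self V) (Mor N S V f n) = \<mu> (self V) (Mor N S V f n')"
proof -
  \<comment> \<open>A coproduct with \<open>V\<close> is fixed for every \<open>U\<close> at once,
    so that the constructions below are functions of \<open>U\<close>.\<close>
  obtain C i j e where C: "\<And>U. U \<in> A \<Longrightarrow> coproduct V U (C U) (i U) (j U) (e U)"
    using coproduct_exists[OF inf V(1)] by metis
  have CA: "C U \<in> A" "i U \<in> hm V (C U)" "j U \<in> hm U (C U)" if "U \<in> A" for U
    using coproductD(1-3)[OF C[OF that]] by auto
  note N = linear_functorD[OF N] and Nlin = N
  \<comment> \<open>The value of \<open>\<mu>\<close> over \<open>V \<otimes> U\<close> at the image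
    of \<open>y\<close>; the factor \<open>V\<close> still has to be contracted away.\<close>
  define x where "x U y = \<mu> (along (C U) (i U)) (Mor N U (C U) (j U) y)" for U y
  have xC: "x U y \<in> carrier (C U)" if "U \<in> A" "y \<in> carrier (Obj N U)" for U y
    unfolding x_def using dual_D(1)[OF \<mu> V(1) CA(1,2)[OF that(1)]] N(5)[OF that(1) CA(1,3)[OF that(1)] that(2)] .
  have "x S n = x S n'"
  proof (rule coproduct_contract_separates[OF C[OF S] V(1) S])
    fix \<omega> assume w: "linear_map (alg_module V) (self K) \<omega>"
    define d where "d U c = tensor_product.contract K (alg_module V) U (\<lambda>m. smap U (\<omega> m))
       (inv_into (carrier (tensor K (alg_module V) U)) (e U) c)" for U c
    note d = coproduct_contract[OF C V(1) _ w, folded d_def]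
    have "fam (self K) N (\<lambda>U _ y. d U (x U y)) \<in> carrier (Obj (dual K N) (self K))"
    proof (rule fam_dual[OF self_A Nlin])
      fix U assume U: "U \<in> A"
      note CU = CA[OF U]
      note hj = alg_homD[OF CU(3)]
      show "d U (x U y) \<in> carrier U" if "y \<in> carrier (Obj N U)" for y
        using d(1)[OF U U xC[OF U that]] .
      show "d U (x U (y \<oplus>\<^bsub>Obj N U\<^esub> z)) = d U (x U y) \<oplus>\<^bsub>U\<^esub> d U (x U z)"
        if "y \<in> carrier (Obj N U)" "z \<in> carrier (Obj N U)" for y z
      proof -
        have "x U (y \<oplus>\<^bsub>Obj N U\<^esub> z) = x U y \<oplus>\<^bsub>C U\<^esub> x U z"
          unfolding x_def using dual_D(3)[OF \<mu> V(1) CU(1,2)] N(3,5)[OF U CU(1,3)] that by simp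
        then show ?thesis using d(2)[OF U U] xC[OF U] that by simp
      qed
      show "d U (x U (s \<odot>\<^bsub>Obj N U\<^esub> y)) = s \<otimes>\<^bsub>U\<^esub> d U (x U y)"
        if "s \<in> carrier U" "y \<in> carrier (Obj N U)" for s y
      proof -
        have "x U (s \<odot>\<^bsub>Obj N U\<^esub> y) = j U s \<otimes>\<^bsub>C U\<^esub> x U y"
          unfolding x_def using dual_D(4)[OF \<mu> V(1) CU(1,2)] N(4,5)[OF U CU(1,3)] that hj by simp
        then show ?thesis using d(3)[OF U U] xC[OF U] that by simp
      qed
      fix Q h y assume Q: "Q \<in> A" and h: "h \<in> hm U Q" and y: "y \<in> carrier (Obj N U)"
      note CQ = CA[OF Q]
      \<comment> \<open>The map \<open>id \<otimes> h\<close> between the chosen coproducts.\<close>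
      obtain c where c: "c \<in> hm (C U) (C Q)" "cmp V c (i U) = i Q" "cmp U c (j U) = cmp U (j Q) h"
        using coproduct_universal[OF C[OF U] V(1) U CQ(1,2), of "cmp U (j Q) h"] h U CQ by auto
      have ci: "c (i U v) = i Q v" if "v \<in> carrier V" for v
        using fun_cong[OF c(2), of v] that by simp
      have cj: "c (j U u) = j Q (h u)" if "u \<in> carrier U" for u
        using fun_cong[OF c(3), of u] that by simp
      have "x Q (Mor N U Q h y) = \<mu> (along (C Q) (cmp V c (i U))) (Mor N (C U) (C Q) c (Mor N U (C U) (j U) y))"
        unfolding x_def c(2) using N(7)[OF U Q CQ(1) h CQ(3) y] N(7)[OF U CU(1) CQ(1) CU(3) c(1) y] c(3)
        by simp
      also have "\<dots> = c (x U y)"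
        unfolding x_def using dual_D(2)[OF \<mu> V(1) CU(1,2) CQ(1) c(1)] N(5)[OF U CU(1,3) y] by simp
      finally have xQ: "x Q (Mor N U Q h y) = c (x U y)" .
      \<comment> \<open>Contraction of \<open>V\<close> commutes with changing \<open>U\<close>,
        because the values of \<open>\<omega>\<close> lie in \<open>K\<close>.\<close>
      have "d Q (c b) = h (d U b)" if "b \<in> carrier (C U)" for b
        using that
      proof (induction rule: coproduct_induct[OF C[OF U] V(1) U, consumes 1])
        case (1 v u)
        have "\<omega> v \<in> carrier K" using linear_mapD(1)[OF w, of v] 1 by simp
        then have "h (smap U (\<omega> v)) = smap Q (\<omega> v)" "smap U (\<omega> v) \<in> carrier U"
          using alg_homD(9)[OF h] CAlgD(4)[OF U] by auto
        then show ?case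
          using 1 alg_homD[OF h] alg_homD[OF CU(2)] alg_homD[OF CU(3)] alg_homD(6)[OF c(1)]
          by (simp add: d(4)[OF U U] d(4)[OF Q Q] ci cj)
      next
        case (2 a b)
        then show ?case
          using alg_homD[OF h] alg_homD[OF c(1)] by (simp add: d(1,2)[OF U U] d(2)[OF Q Q])
      qed
      then show "d Q (x Q (Mor N U Q h y)) = h (d U (x U y))"
        using xQ xC[OF U y] by simp
    qed
    \<comment> \<open>The functional just built is a base point of the dual, so the hypothesis
      applies to it.\<close>
    from eq[OF this] show "d S (x S n) = d S (x S n')"
      using fam_app[OF S smap_hm[OF S] n(1), of "\<lambda>U _ y. d U (x U y)"]
        fam_app[OF S smap_hm[OF S] n(2), of "\<lambda>U _ y. d U (x U y)"] by simp
  qed (use xC S n in auto)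
  \<comment> \<open>The map \<open>V \<otimes> S \<rightarrow> V\<close> that is the identity on
    \<open>V\<close> and \<open>f\<close> on \<open>S\<close>. It sends \<open>x S y\<close> back to
    the value of \<open>\<mu>\<close> over \<open>V\<close>.\<close>
  moreover obtain g where g: "g \<in> hm (C S) V" "cmp V g (i S) = ids V" "cmp S g (j S) = f"
    using coproduct_universal[OF C[OF S] V(1) S V(1) ids_hm[OF V(1)] V(2)] by blast
  have "g (x S y) = \<mu> (self V) (Mor N S V f y)" if y: "y \<in> carrier (Obj N S)" for y
  proof -
    note CS = CA[OF S]
    have "g (x S y) = \<mu> (along V (cmp V g (i S))) (Mor N (C S) V g (Mor N S (C S) (j S) y))"
      unfolding x_def using dual_D(2)[OF \<mu> V(1) CS(1,2) V(1) g(1)] N(5)[OF S CS(1,3) y] by simp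
    then show ?thesis
      using N(7)[OF S CS(1) V(1) CS(3) g(1) y] g by (simp add: self_eq_along)
  qed
  ultimately show ?thesis
    using n by metis
qed

end

section \<open>Reflexive functors\<close>

context base_ring
begin

lemma self_along [simp]: "self (along R f) = self R"
  by (simp add: self_def)

lemma lin_trans_closed: "\<eta> \<in> lin_trans K M N \<Longrightarrow> S \<in> A \<Longrightarrow> x \<in> carrier (Obj M S) \<Longrightarrow> \<eta> S x \<in> carrier (Obj N S)"
  unfolding lin_trans_def nat_trans_def by (auto dest!: PiE_mem)

lemma reflexiveD:
  assumes "reflexive K M"
  obtains \<theta> where "bidual_map K M \<in> lin_trans K M (dual K (dual K M))" "\<theta> \<in> lin_trans K (dual K (dual K M)) M"
    "\<forall>S\<in>A. (\<forall>m\<in>carrier (Obj M S). \<theta> S (bidual_map K M S m) = m) \<and>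
       (\<forall>\<Phi>\<in>carrier (Obj (dual K (dual K M)) S). bidual_map K M S (\<theta> S \<Phi>) = \<Phi>)"
  using assms unfolding reflexive_def is_iso_def by blast

lemma bidual_map_app:
  assumes "S \<in> A" "m \<in> carrier (Obj M S)" "R \<in> A" "f \<in> hm S R" "\<mu> \<in> carrier (Obj (dual K M) R)"
  shows "bidual_map K M S m (along R f) \<mu> = \<mu> (self R) (Mor M S R f m)"
  using assms by (simp add: bidual_map_def)

text \<open>The injectivity half of reflexivity. Functionals over all algebras under
  \<open>S\<close> are needed, not only those over \<open>S\<close> itself.\<close>

lemma reflexive_ext:
  assumes "reflexive K M" "S \<in> A" "m \<in> carrier (Obj M S)" "m' \<in> carrier (Obj M S)"
    and eq: "\<And>R f \<mu>. R \<in> A \<Longrightarrow> f \<in> hm S R \<Longrightarrow> \<mu> \<in> carrier (Obj (dual K M) R) \<Longrightarrow>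
      \<mu> (self R) (Mor M S R f m) = \<mu> (self R) (Mor M S R f m')"
  shows "m = m'"
proof -
  obtain \<theta> where b: "bidual_map K M \<in> lin_trans K M (dual K (dual K M))" and
    \<theta>: "\<forall>S\<in>A. (\<forall>m\<in>carrier (Obj M S). \<theta> S (bidual_map K M S m) = m) \<and>
       (\<forall>\<Phi>\<in>carrier (Obj (dual K (dual K M)) S). bidual_map K M S (\<theta> S \<Phi>) = \<Phi>)"
    by (rule reflexiveD[OF assms(1)])
  have "bidual_map K M S m = bidual_map K M S m'"
    by (rule dual_ext[OF lin_trans_closed[OF b assms(2,3)] lin_trans_closed[OF b assms(2,4)] assms(2)])
      (use assms in \<open>simp add: bidual_map_app\<close>)
  then show ?thesis using \<theta> assms(2-4) by metis
qed

text \<open>The surjectivity half of reflexivity, used to produce vectors from points of the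
  bidual.\<close>

lemma reflexive_represent:
  assumes "reflexive K M" "S \<in> A" "\<Phi> \<in> carrier (Obj (dual K (dual K M)) S)"
  shows "\<exists>m\<in>carrier (Obj M S). \<forall>R\<in>A. \<forall>f\<in>hm S R. \<forall>\<mu>\<in>carrier (Obj (dual K M) R).
     \<mu> (self R) (Mor M S R f m) = \<Phi> (along R f) \<mu>"
proof -
  obtain \<theta> where t: "\<theta> \<in> lin_trans K (dual K (dual K M)) M" and
    \<theta>: "\<forall>S\<in>A. (\<forall>m\<in>carrier (Obj M S). \<theta> S (bidual_map K M S m) = m) \<and>
       (\<forall>\<Phi>\<in>carrier (Obj (dual K (dual K M)) S). bidual_map K M S (\<theta> S \<Phi>) = \<Phi>)"
    by (rule reflexiveD[OF assms(1)])
  have cl: "\<theta> S \<Phi> \<in> carrier (Obj M S)"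
    by (rule lin_trans_closed[OF t assms(2,3)])
  have eq: "bidual_map K M S (\<theta> S \<Phi>) = \<Phi>"
    using \<theta> assms(2,3) by blast
  have "\<mu> (self R) (Mor M S R f (\<theta> S \<Phi>)) = \<Phi> (along R f) \<mu>"
    if "R \<in> A" "f \<in> hm S R" "\<mu> \<in> carrier (Obj (dual K M) R)" for R f \<mu>
    using bidual_map_app[OF assms(2) cl that] unfolding eq by simp
  then show ?thesis using cl by blast
qed

end

section \<open>Convolution of distributions\<close>

text \<open>Algebras over a ring depend on its ring structure alone, so altering its own structure
  map leaves them unchanged. This reconciles the nested restrictions in
  \<open>convolution\<close>.\<close>

lemma CAlg_along [simp]: "CAlg (along R f) = CAlg R"
  by (simp add: CAlg_def)

lemma along_res_any [simp]: "along (res K S T) g = along T g"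
  by (simp add: along_def res_def via_def)

lemma CAlg_res [simp]: "CAlg (res K S T) = CAlg T"
proof -
  have "res K S T = along T (smap (res K S T))"
    by (simp add: along_def res_def via_def)
  then show ?thesis by (metis CAlg_along)
qed

lemma res_eq_along: "res S T U = along U (compose (carrier S) (smap U) (smap T))"
  by (simp add: along_def res_def via_def)

section \<open>Dirac distributions, translates and averages\<close>

locale G_functor = base_ring K for K :: "'u ring" +
  fixes G :: "('u, 'g) mon_functor"
  assumes G: "monoid_functor K G"
begin

abbreviation "AG \<equiv> fun_functor K G"
abbreviation "Dist \<equiv> dual K (fun_functor K G)"

lemma set_functor_G: "set_functor K G"
  using G by (simp add: monoid_functor_def)

lemmas G_D = monoid_functorD(3-7)[OF G]
lemmas AG_linear = linear_functor_FUN[OF set_functor_G]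
lemmas AG_D = linear_functorD[OF AG_linear]
lemmas Dist_linear = linear_functor_dual[OF AG_linear]
lemmas Dist_D = linear_functorD[OF Dist_linear]

lemma G_mult_closed: "S \<in> A \<Longrightarrow> g \<in> carrier (Obj G S) \<Longrightarrow> h \<in> carrier (Obj G S) \<Longrightarrow>
   g \<otimes>\<^bsub>Obj G S\<^esub> h \<in> carrier (Obj G S)"
  using monoid_functorD(2)[OF G] by (blast intro: monoid.m_closed)

lemma G_one_closed: "S \<in> A \<Longrightarrow> \<one>\<^bsub>Obj G S\<^esub> \<in> carrier (Obj G S)"
  using monoid_functorD(2)[OF G] by (blast intro: monoid.one_closed)

lemma dirac_app [simp]:
  assumes "S \<in> A" "g \<in> carrier (Obj G S)" "R \<in> A" "f \<in> hm S R" "F \<in> carrier (Obj AG R)"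
  shows "dirac K G S g (along R f) F = F (self R) (Mor G S R f g)"
  using assms by (simp add: dirac_def)

lemma dirac_closed:
  assumes "S \<in> A" "g \<in> carrier (Obj G S)"
  shows "dirac K G S g \<in> carrier (Obj Dist S)"
proof -
  have "dirac K G S g = fam S AG (\<lambda>R f F. F (self R) (Mor G S R f g))"
    using assms by (auto simp: dirac_def fam_def res_eq_along intro!: restrict_ext)
  also have "\<dots> \<in> carrier (Obj Dist S)"
    using assms by (intro fam_dual AG_linear)
      (simp_all add: FUN_self_D G_D Mor_FUN_self FUN_self_D(2)[symmetric] self_eq_along
        FUN_self_D(1)[unfolded self_eq_along])
  finally show ?thesis .
qed

lemma dirac_nat:
  assumes "S \<in> A" "R \<in> A" "f \<in> hm S R" "g \<in> carrier (Obj G S)"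
  shows "Mor Dist S R f (dirac K G S g) = dirac K G R (Mor G S R f g)"
  using assms by (intro dual_ext[of _ AG R]) (auto simp: Mor_dual_closed dirac_closed G_D)

text \<open>The function \<open>h \<mapsto> F (g h)\<close>, the innermost one in
  \<open>convolution\<close>.\<close>

definition translate where
  "translate U F g = fam U G (\<lambda>V f h. F (along V f) (Mor G U V f g \<otimes>\<^bsub>Obj G V\<^esub> h))"

lemma translate_app [simp]: "V \<in> A \<Longrightarrow> f \<in> hm U V \<Longrightarrow> h \<in> carrier (Obj G V) \<Longrightarrow>
   translate U F g (along V f) h = F (along V f) (Mor G U V f g \<otimes>\<^bsub>Obj G V\<^esub> h)"
  by (simp add: translate_def)

lemma translate_closed:
  assumes "U \<in> A" "F \<in> carrier (Obj AG U)" "g \<in> carrier (Obj G U)"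
  shows "translate U F g \<in> carrier (Obj AG U)"
  unfolding translate_def
proof (rule fam_FUN[OF assms(1) set_functor_G])
  fix V f h assume V: "V \<in> A" "f \<in> hm U V" "h \<in> carrier (Obj G V)"
  show "F (along V f) (Mor G U V f g \<otimes>\<^bsub>Obj G V\<^esub> h) \<in> carrier V"
    using assms V by (intro FUN_D(1)[OF assms(2)] G_mult_closed G_D)
  fix Q q assume Q: "Q \<in> A" "q \<in> hm V Q"
  show "F (along Q (cmp U q f)) (Mor G U Q (cmp U q f) g \<otimes>\<^bsub>Obj G Q\<^esub> Mor G V Q q h) =
      q (F (along V f) (Mor G U V f g \<otimes>\<^bsub>Obj G V\<^esub> h))"
    using assms V Q FUN_D(2)[OF assms(2,1) V(1,2) Q, of "Mor G U V f g \<otimes>\<^bsub>Obj G V\<^esub> h"]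
    by (simp add: G_D G_mult_closed)
qed

lemma translate_nat:
  assumes "U \<in> A" "F \<in> carrier (Obj AG U)" "g \<in> carrier (Obj G U)" "V \<in> A" "f \<in> hm U V"
  shows "Mor AG U V f (translate U F g) = translate V (Mor AG U V f F) (Mor G U V f g)"
  using assms by (intro FUN_ext[of _ G V]) (auto simp: Mor_FUN_closed translate_closed G_D)

lemma translate_linear:
  assumes "U \<in> A" "F \<in> carrier (Obj AG U)" "g \<in> carrier (Obj G U)"
  shows "\<And>F'. F' \<in> carrier (Obj AG U) \<Longrightarrow>
      translate U (F \<oplus>\<^bsub>Obj AG U\<^esub> F') g = translate U F g \<oplus>\<^bsub>Obj AG U\<^esub> translate U F' g"
    "\<And>s. s \<in> carrier U \<Longrightarrow> translate U (s \<odot>\<^bsub>Obj AG U\<^esub> F) g = s \<odot>\<^bsub>Obj AG U\<^esub> translate U F g"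
proof -
  show "translate U (F \<oplus>\<^bsub>Obj AG U\<^esub> F') g = translate U F g \<oplus>\<^bsub>Obj AG U\<^esub> translate U F' g"
    if "F' \<in> carrier (Obj AG U)" for F'
    using assms that by (intro FUN_ext[of _ G U]) (auto simp: AG_D(1) translate_closed G_D G_mult_closed)
  show "translate U (s \<odot>\<^bsub>Obj AG U\<^esub> F) g = s \<odot>\<^bsub>Obj AG U\<^esub> translate U F g" if "s \<in> carrier U" for s
    using assms that by (intro FUN_ext[of _ G U]) (auto simp: AG_D(2) translate_closed G_D G_mult_closed)
qed

text \<open>The function \<open>g \<mapsto> w (h \<mapsto> F (g h))\<close>, so that the product of \<open>w'\<close> and \<open>w\<close> is \<open>F \<mapsto> w' (average w F)\<close>.\<close>

definition average where
  "average R w F = fam R G (\<lambda>U f g. w (along U f) (translate U (Mor AG R U f F) g))"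

lemma average_app [simp]: "U \<in> A \<Longrightarrow> f \<in> hm R U \<Longrightarrow> g \<in> carrier (Obj G U) \<Longrightarrow>
   average R w F (along U f) g = w (along U f) (translate U (Mor AG R U f F) g)"
  by (simp add: average_def)

lemma average_closed:
  assumes "R \<in> A" "w \<in> carrier (Obj Dist R)" "F \<in> carrier (Obj AG R)"
  shows "average R w F \<in> carrier (Obj AG R)"
  unfolding average_def
proof (rule fam_FUN[OF assms(1) set_functor_G])
  fix U f g assume U: "U \<in> A" "f \<in> hm R U" "g \<in> carrier (Obj G U)"
  have t: "translate U (Mor AG R U f F) g \<in> carrier (Obj AG U)"
    using assms U by (intro translate_closed Mor_FUN_closed)
  then show "w (along U f) (translate U (Mor AG R U f F) g) \<in> carrier U"
    using assms U by (intro dual_D(1)[OF assms(2)])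
  fix Q q assume Q: "Q \<in> A" "q \<in> hm U Q"
  show "w (along Q (cmp R q f)) (translate Q (Mor AG R Q (cmp R q f) F) (Mor G U Q q g)) =
      q (w (along U f) (translate U (Mor AG R U f F) g))"
    using assms U Q dual_D(2)[OF assms(2,1) U(1,2) Q t]
    by (simp add: translate_nat Mor_FUN_closed AG_D(7))
qed

lemma average_nat:
  assumes "R \<in> A" "w \<in> carrier (Obj Dist R)" "F \<in> carrier (Obj AG R)" "U \<in> A" "f \<in> hm R U"
  shows "Mor AG R U f (average R w F) = average U (Mor Dist R U f w) (Mor AG R U f F)"
  using assms
  by (intro FUN_ext[of _ G U]) (auto simp: Mor_FUN_closed Mor_dual_closed average_closed AG_D(7))

lemma average_linear:
  assumes "R \<in> A" "w \<in> carrier (Obj Dist R)" "F \<in> carrier (Obj AG R)"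
  shows "\<And>F'. F' \<in> carrier (Obj AG R) \<Longrightarrow>
      average R w (F \<oplus>\<^bsub>Obj AG R\<^esub> F') = average R w F \<oplus>\<^bsub>Obj AG R\<^esub> average R w F'"
    "\<And>s. s \<in> carrier R \<Longrightarrow> average R w (s \<odot>\<^bsub>Obj AG R\<^esub> F) = s \<odot>\<^bsub>Obj AG R\<^esub> average R w F"
proof -
  show "average R w (F \<oplus>\<^bsub>Obj AG R\<^esub> F') = average R w F \<oplus>\<^bsub>Obj AG R\<^esub> average R w F'"
    if "F' \<in> carrier (Obj AG R)" for F'
    using assms that by (intro FUN_ext[of _ G R])
      (auto simp: AG_D(1,3) average_closed translate_linear translate_closed Mor_FUN_closed dual_D(3)[OF assms(2)])
  show "average R w (s \<odot>\<^bsub>Obj AG R\<^esub> F) = s \<odot>\<^bsub>Obj AG R\<^esub> average R w F" if "s \<in> carrier R" for s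
    using assms that by (intro FUN_ext[of _ G R])
      (auto simp: AG_D(2,4) average_closed translate_linear translate_closed Mor_FUN_closed alg_homD
        dual_D(4)[OF assms(2)])
qed

text \<open>The definition stacks a \<open>T\<close>-algebra on an \<open>S\<close>-algebra and a
  further algebra on that. Read as arrows, the iterated restrictions are composites, and the inner
  lambdas become \<open>translate\<close> and \<open>average\<close>.\<close>

lemma convolution_fam:
  assumes "S \<in> A" "w' \<in> carrier (Obj Dist S)"
  shows "convolution K G S w w' = fam S AG (\<lambda>R f F. w (along R f) (average R (Mor Dist S R f w') F))"
proof -
  have eq: "(\<lambda>U\<in>CAlg T. \<lambda>g\<in>carrier (Obj G (res K (res K S T) U)).
          let U\<^sub>K = res K (res K S T) U in
          w' (res S T U) (\<lambda>V\<in>CAlg U. \<lambda>h\<in>carrier (Obj G (res K U\<^sub>K V)).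
            F (res T U V) (Mor G U\<^sub>K (res K U\<^sub>K V) (smap V) g \<otimes>\<^bsub>Obj G (res K U\<^sub>K V)\<^esub> h))) =
     average (res K S T) (Mor Dist S (res K S T) (smap T) w') F"
    if T: "T \<in> CAlg S" for T F
  proof -
    define R where "R = res K S T"
    have R: "R \<in> A" "smap T \<in> hm S R" "CAlg T = CAlg R" "carrier T = carrier R"
      using res_A[OF assms(1) T] by (simp_all add: R_def)
    show ?thesis
      unfolding average_def fam_def R_def[symmetric] R(3) Let_def
    proof (intro restrict_ext)
      fix U g assume U: "U \<in> CAlg R" and g: "g \<in> carrier (Obj G (res K R U))"
      define Q where "Q = res K R U"
      have Q: "Q \<in> A" "smap U \<in> hm R Q" "CAlg U = CAlg Q" "carrier U = carrier Q" "\<And>q. along Q q = along U q"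
        using res_A[OF R(1) U] by (simp_all add: Q_def)
      have "(\<lambda>V\<in>CAlg Q. \<lambda>h\<in>carrier (Obj G (res K Q V)).
            F (res T U V) (Mor G Q (res K Q V) (smap V) g \<otimes>\<^bsub>Obj G (res K Q V)\<^esub> h)) =
          translate Q (Mor AG R Q (smap U) F) g"
        unfolding translate_def fam_def
      proof (intro restrict_ext)
        fix V h assume V: "V \<in> CAlg Q"
        have "Mor AG R Q (smap U) F (along (res K Q V) (smap V)) = F (along (res K Q V) (cmp R (smap V) (smap U)))"
          using res_A[OF Q(1) V] by (simp del: along_res_any along_res)
        then show "F (res T U V) (Mor G Q (res K Q V) (smap V) g \<otimes>\<^bsub>Obj G (res K Q V)\<^esub> h) =
           Mor AG R Q (smap U) F (along (res K Q V) (smap V)) (Mor G Q (res K Q V) (smap V) g \<otimes>\<^bsub>Obj G (res K Q V)\<^esub> h)"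
          by (simp add: res_eq_along[of T] R(4))
      qed
      moreover have "Mor Dist S R (smap T) w' (along Q (smap U)) = w' (res S T U)"
        using Mor_dual[OF Q(1,2)] by (simp add: Q(5) res_eq_along)
      ultimately show "w' (res S T U) (\<lambda>V\<in>CAlg U. \<lambda>h\<in>carrier (Obj G (res K (res K R U) V)).
            F (res T U V) (Mor G (res K R U) (res K (res K R U) V) (smap V) g \<otimes>\<^bsub>Obj G (res K (res K R U) V)\<^esub> h)) =
         Mor Dist S R (smap T) w' (along (res K R U) (smap U))
           (translate (res K R U) (Mor AG R (res K R U) (smap U) F) g)"
        unfolding Q_def[symmetric] Q(3) by simp
    qed
  qed
  show ?thesis
    unfolding convolution_def fam_def by (intro restrict_ext) (simp add: eq)
qed

lemma convolution_app [simp]: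
  assumes "S \<in> A" "w' \<in> carrier (Obj Dist S)" "R \<in> A" "f \<in> hm S R" "F \<in> carrier (Obj AG R)"
  shows "convolution K G S w w' (along R f) F = w (along R f) (average R (Mor Dist S R f w') F)"
  using assms by (simp add: convolution_fam)

lemma convolution_closed:
  assumes "S \<in> A" "w \<in> carrier (Obj Dist S)" "w' \<in> carrier (Obj Dist S)"
  shows "convolution K G S w w' \<in> carrier (Obj Dist S)"
  unfolding convolution_fam[OF assms(1,3)]
proof (rule fam_dual[OF assms(1) AG_linear])
  fix R f assume R: "R \<in> A" "f \<in> hm S R"
  define v where "v = Mor Dist S R f w'"
  have v: "v \<in> carrier (Obj Dist R)" unfolding v_def using assms R by (simp add: Mor_dual_closed)
  note W = dual_D[OF assms(2,1) R]
  fix F assume F: "F \<in> carrier (Obj AG R)"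
  show "w (along R f) (average R (Mor Dist S R f w') F) \<in> carrier R"
    unfolding v_def[symmetric] using F v R by (simp add: W average_closed)
  show "w (along R f) (average R (Mor Dist S R f w') (F \<oplus>\<^bsub>Obj AG R\<^esub> F')) =
      w (along R f) (average R (Mor Dist S R f w') F) \<oplus>\<^bsub>R\<^esub> w (along R f) (average R (Mor Dist S R f w') F')"
    if "F' \<in> carrier (Obj AG R)" for F'
    unfolding v_def[symmetric] using F v R that by (simp add: W average_closed average_linear)
  show "w (along R f) (average R (Mor Dist S R f w') (s \<odot>\<^bsub>Obj AG R\<^esub> F)) =
      s \<otimes>\<^bsub>R\<^esub> w (along R f) (average R (Mor Dist S R f w') F)"
    if "s \<in> carrier R" for s
    unfolding v_def[symmetric] using F v R that by (simp add: W average_closed average_linear)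
  fix Q h assume Q: "Q \<in> A" "h \<in> hm R Q"
  show "w (along Q (cmp S h f)) (average Q (Mor Dist S Q (cmp S h f) w') (Mor AG R Q h F)) =
      h (w (along R f) (average R (Mor Dist S R f w') F))"
    using F v R Q W(2)[OF Q average_closed[OF R(1) v F]] assms
    by (simp add: average_nat v_def[symmetric] Dist_D(7))
qed

lemma convolution_nat:
  assumes "S \<in> A" "w \<in> carrier (Obj Dist S)" "w' \<in> carrier (Obj Dist S)" "R \<in> A" "f \<in> hm S R"
  shows "Mor Dist S R f (convolution K G S w w') = convolution K G R (Mor Dist S R f w) (Mor Dist S R f w')"
  using assms
  by (intro dual_ext[of _ AG R]) (auto simp: Mor_dual_closed convolution_closed Dist_D(7))

lemma dist_algebra_sel [simp]:
  "carrier (Obj (dist_algebra K G) S) = carrier (Obj Dist S)"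
  "ring.add (Obj (dist_algebra K G) S) = ring.add (Obj Dist S)"
  "smult (Obj (dist_algebra K G) S) = smult (Obj Dist S)"
  "monoid.mult (Obj (dist_algebra K G) S) = convolution K G S"
  "\<one>\<^bsub>Obj (dist_algebra K G) S\<^esub> = dirac K G S \<one>\<^bsub>Obj G S\<^esub>"
  "Mor (dist_algebra K G) = Mor Dist"
  by (simp_all add: dist_algebra_def)

text \<open>After base change, pairing with the Dirac distribution at \<open>g\<close> is evaluation
  at \<open>g\<close>.\<close>

lemma FUN_eq_dirac:
  assumes "S \<in> A" "F \<in> carrier (Obj AG S)" "F' \<in> carrier (Obj AG S)"
    "\<And>R f g. R \<in> A \<Longrightarrow> f \<in> hm S R \<Longrightarrow> g \<in> carrier (Obj G R) \<Longrightarrow>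
       dirac K G R g (self R) (Mor AG S R f F) = dirac K G R g (self R) (Mor AG S R f F')"
  shows "F = F'"
proof (rule FUN_ext[OF assms(2,3,1)])
  fix R f g assume R: "R \<in> A" "f \<in> hm S R" "g \<in> carrier (Obj G R)"
  have "dirac K G R g (self R) (Mor AG S R f H) = H (along R f) g" if "H \<in> carrier (Obj AG S)" for H
    using R that assms(1) by (simp add: self_eq_along Mor_FUN_closed G_D)
  then show "F (along R f) g = F' (along R f) g"
    using assms R by metis
qed

end

section \<open>Extending an action to distributions\<close>

locale G_module = G_functor K G for K :: "'u ring" and G :: "('u, 'g) mon_functor" +
  fixes M :: "('u, 'm) mod_functor"
    and \<rho> :: "'u calg \<Rightarrow> 'g \<Rightarrow> 'u calg \<Rightarrow> 'm \<Rightarrow> 'm"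
  assumes M: "linear_functor K M"
    and \<rho>: "\<rho> \<in> monoid_trans K G (END K M)"
begin

lemma END_sel [simp]:
  "carrier (Obj (END K M) S) = carrier (Obj (HOM K M M) S)"
  "ring.add (Obj (END K M) S) = ring.add (Obj (HOM K M M) S)"
  "smult (Obj (END K M) S) = smult (Obj (HOM K M M) S)"
  "Mor (END K M) = Mor (HOM K M M)"
  by (simp_all add: END_def)

lemma END_mult [simp]:
  assumes "R \<in> A" "f \<in> hm S R" "m \<in> carrier (Obj M R)"
  shows "(\<eta> \<otimes>\<^bsub>Obj (END K M) S\<^esub> \<theta>) (along R f) m = \<eta> (along R f) (\<theta> (along R f) m)"
    "\<one>\<^bsub>Obj (END K M) S\<^esub> (along R f) m = m"
  using assms by (simp_all add: END_def compose_def)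

lemma END_mult_fam:
  assumes "S \<in> A"
  shows "\<eta> \<otimes>\<^bsub>Obj (END K M) S\<^esub> \<theta> = fam S M (\<lambda>R f m. \<eta> (along R f) (\<theta> (along R f) m))"
    "\<one>\<^bsub>Obj (END K M) S\<^esub> = fam S M (\<lambda>R f m. m)"
  using assms res_A by (auto simp: END_def fam_def compose_def intro!: restrict_ext)

lemma rho_closed: "S \<in> A \<Longrightarrow> g \<in> carrier (Obj G S) \<Longrightarrow> \<rho> S g \<in> carrier (Obj (HOM K M M) S)"
  using \<rho> unfolding monoid_trans_def nat_trans_def by (auto dest!: PiE_mem)

lemma rho_nat: "S \<in> A \<Longrightarrow> R \<in> A \<Longrightarrow> f \<in> hm S R \<Longrightarrow> g \<in> carrier (Obj G S) \<Longrightarrow>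
   \<rho> R (Mor G S R f g) = Mor (HOM K M M) S R f (\<rho> S g)"
  using \<rho> unfolding monoid_trans_def nat_trans_def by auto

text \<open>The components of \<open>\<rho> S g\<close> at other algebras are the actions of the
  images of \<open>g\<close>, so everything can be expressed through \<open>act\<close>.\<close>

lemma rho_along: "S \<in> A \<Longrightarrow> R \<in> A \<Longrightarrow> f \<in> hm S R \<Longrightarrow> g \<in> carrier (Obj G S) \<Longrightarrow>
   \<rho> S g (along R f) = act \<rho> R (Mor G S R f g)"
  by (rule ext) (simp add: act_def rho_nat Mor_HOM_self)

lemma act_closed: "S \<in> A \<Longrightarrow> g \<in> carrier (Obj G S) \<Longrightarrow> m \<in> carrier (Obj M S) \<Longrightarrow>
   act \<rho> S g m \<in> carrier (Obj M S)"
  using HOM_D(1)[OF rho_closed, of S g S "ids S" m] by (simp add: act_def self_eq_along)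

lemma act_add: "S \<in> A \<Longrightarrow> g \<in> carrier (Obj G S) \<Longrightarrow> m \<in> carrier (Obj M S) \<Longrightarrow> m' \<in> carrier (Obj M S) \<Longrightarrow>
   act \<rho> S g (m \<oplus>\<^bsub>Obj M S\<^esub> m') = act \<rho> S g m \<oplus>\<^bsub>Obj M S\<^esub> act \<rho> S g m'"
  using HOM_D(3)[OF rho_closed, of S g S "ids S" m m'] by (simp add: act_def self_eq_along)

lemma act_smult: "S \<in> A \<Longrightarrow> g \<in> carrier (Obj G S) \<Longrightarrow> s \<in> carrier S \<Longrightarrow> m \<in> carrier (Obj M S) \<Longrightarrow>
   act \<rho> S g (s \<odot>\<^bsub>Obj M S\<^esub> m) = s \<odot>\<^bsub>Obj M S\<^esub> act \<rho> S g m"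
  using HOM_D(4)[OF rho_closed, of S g S "ids S" s m] by (simp add: act_def self_eq_along)

lemma act_nat:
  assumes "S \<in> A" "R \<in> A" "f \<in> hm S R" "g \<in> carrier (Obj G S)" "m \<in> carrier (Obj M S)"
  shows "Mor M S R f (act \<rho> S g m) = act \<rho> R (Mor G S R f g) (Mor M S R f m)"
proof -
  have "\<rho> S g (along R (cmp S f (ids S))) (Mor M S R f m) = Mor M S R f (\<rho> S g (along S (ids S)) m)"
    by (rule HOM_D(2)[OF rho_closed]) (use assms in auto)
  then show ?thesis
    using assms by (simp add: act_def[of \<rho> S] self_eq_along[of S] rho_along)
qed

lemma act_mult:
  assumes "S \<in> A" "g \<in> carrier (Obj G S)" "h \<in> carrier (Obj G S)" "m \<in> carrier (Obj M S)"
  shows "act \<rho> S (g \<otimes>\<^bsub>Obj G S\<^esub> h) m = act \<rho> S g (act \<rho> S h m)"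
proof -
  have "\<rho> S \<in> hom (Obj G S) (Obj (END K M) S)"
    using \<rho> assms(1) unfolding monoid_trans_def by blast
  from hom_mult[OF this assms(2,3)] show ?thesis
    using assms(1,4) by (simp add: act_def self_eq_along)
qed

lemma act_one: "S \<in> A \<Longrightarrow> m \<in> carrier (Obj M S) \<Longrightarrow> act \<rho> S \<one>\<^bsub>Obj G S\<^esub> m = m"
  using \<rho> unfolding monoid_trans_def by (simp add: act_def self_eq_along)

text \<open>The matrix coefficient \<open>g \<mapsto> \<mu> (g m)\<close>, the function to which
  distributions are applied.\<close>

definition coef where
  "coef S \<mu> m = fam S G (\<lambda>R f g. \<mu> (along R f) (act \<rho> R g (Mor M S R f m)))"

lemma coef_app [simp]: "R \<in> A \<Longrightarrow> f \<in> hm S R \<Longrightarrow> g \<in> carrier (Obj G R) \<Longrightarrow>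
   coef S \<mu> m (along R f) g = \<mu> (along R f) (act \<rho> R g (Mor M S R f m))"
  by (simp add: coef_def)

lemmas M_D = linear_functorD[OF M]
lemmas dual_linear = linear_functor_dual[OF M]

lemma coef_closed:
  assumes "S \<in> A" "\<mu> \<in> carrier (Obj (dual K M) S)" "m \<in> carrier (Obj M S)"
  shows "coef S \<mu> m \<in> carrier (Obj AG S)"
  unfolding coef_def
proof (rule fam_FUN[OF assms(1) set_functor_G])
  fix R f g assume R: "R \<in> A" "f \<in> hm S R" "g \<in> carrier (Obj G R)"
  show "\<mu> (along R f) (act \<rho> R g (Mor M S R f m)) \<in> carrier R"
    using R assms by (intro dual_D[OF assms(2)] act_closed M_D)
  fix Q h assume Q: "Q \<in> A" "h \<in> hm R Q"
  show "\<mu> (along Q (cmp S h f)) (act \<rho> Q (Mor G R Q h g) (Mor M S Q (cmp S h f) m)) =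
      h (\<mu> (along R f) (act \<rho> R g (Mor M S R f m)))"
    using R Q assms
    by (simp add: M_D(7) act_nat[symmetric] M_D(5) act_closed dual_D(2)[OF assms(2)])
qed

lemma coef_nat:
  assumes "S \<in> A" "R \<in> A" "f \<in> hm S R" "\<mu> \<in> carrier (Obj (dual K M) S)" "m \<in> carrier (Obj M S)"
  shows "Mor AG S R f (coef S \<mu> m) = coef R (Mor (dual K M) S R f \<mu>) (Mor M S R f m)"
  using assms
  by (intro FUN_ext[of _ G R]) (auto simp: Mor_FUN_closed coef_closed Mor_dual_closed M_D(5) M_D(7)[symmetric])

lemma coef_linear:
  assumes "S \<in> A" "\<mu> \<in> carrier (Obj (dual K M) S)" "m \<in> carrier (Obj M S)"
  shows "\<And>\<nu>. \<nu> \<in> carrier (Obj (dual K M) S) \<Longrightarrow>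
      coef S (\<mu> \<oplus>\<^bsub>Obj (dual K M) S\<^esub> \<nu>) m = coef S \<mu> m \<oplus>\<^bsub>Obj AG S\<^esub> coef S \<nu> m"
    "\<And>s. s \<in> carrier S \<Longrightarrow> coef S (s \<odot>\<^bsub>Obj (dual K M) S\<^esub> \<mu>) m = s \<odot>\<^bsub>Obj AG S\<^esub> coef S \<mu> m"
    "\<And>m'. m' \<in> carrier (Obj M S) \<Longrightarrow>
      coef S \<mu> (m \<oplus>\<^bsub>Obj M S\<^esub> m') = coef S \<mu> m \<oplus>\<^bsub>Obj AG S\<^esub> coef S \<mu> m'"
    "\<And>s. s \<in> carrier S \<Longrightarrow> coef S \<mu> (s \<odot>\<^bsub>Obj M S\<^esub> m) = s \<odot>\<^bsub>Obj AG S\<^esub> coef S \<mu> m"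
proof -
  note L = linear_functorD(1,2)[OF AG_linear assms(1)] linear_functorD(1,2)[OF dual_linear assms(1)]
  show "coef S (\<mu> \<oplus>\<^bsub>Obj (dual K M) S\<^esub> \<nu>) m = coef S \<mu> m \<oplus>\<^bsub>Obj AG S\<^esub> coef S \<nu> m"
    if "\<nu> \<in> carrier (Obj (dual K M) S)" for \<nu>
    using assms that by (intro FUN_ext[of _ G S]) (auto simp: L coef_closed act_closed M_D(5))
  show "coef S (s \<odot>\<^bsub>Obj (dual K M) S\<^esub> \<mu>) m = s \<odot>\<^bsub>Obj AG S\<^esub> coef S \<mu> m" if "s \<in> carrier S" for s
    using assms that by (intro FUN_ext[of _ G S]) (auto simp: L coef_closed act_closed M_D(5))
  show "coef S \<mu> (m \<oplus>\<^bsub>Obj M S\<^esub> m') = coef S \<mu> m \<oplus>\<^bsub>Obj AG S\<^esub> coef S \<mu> m'"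
    if "m' \<in> carrier (Obj M S)" for m'
    using assms that by (intro FUN_ext[of _ G S])
      (auto simp: L coef_closed act_closed act_add M_D(1,3,5) dual_D(3)[OF assms(2)])
  show "coef S \<mu> (s \<odot>\<^bsub>Obj M S\<^esub> m) = s \<odot>\<^bsub>Obj AG S\<^esub> coef S \<mu> m" if "s \<in> carrier S" for s
    using assms that by (intro FUN_ext[of _ G S])
      (auto simp: L coef_closed act_closed act_smult M_D(2,4,5) alg_homD dual_D(4)[OF assms(2)])
qed

end

section \<open>Distributions acting on a reflexive module\<close>

locale reflexive_G_module = G_module +
  assumes refl_M: "reflexive K M"
begin

text \<open>The product \<open>w m\<close>: by reflexivity of \<open>M\<close> there is exactly one \<open>x\<close> with \<open>\<mu> x = w (g \<mapsto> \<mu> (g m))\<close> for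
  all functionals \<open>\<mu>\<close>.\<close>

definition alpha where
  "alpha S w m = (SOME x. x \<in> carrier (Obj M S) \<and> (\<forall>R\<in>A. \<forall>f\<in>hm S R. \<forall>\<mu>\<in>carrier (Obj (dual K M) R).
     \<mu> (self R) (Mor M S R f x) = w (along R f) (coef R \<mu> (Mor M S R f m))))"

lemma alpha:
  assumes "S \<in> A" "w \<in> carrier (Obj Dist S)" "m \<in> carrier (Obj M S)"
  shows alpha_closed: "alpha S w m \<in> carrier (Obj M S)"
    and alpha_along: "\<And>R f \<mu>. R \<in> A \<Longrightarrow> f \<in> hm S R \<Longrightarrow> \<mu> \<in> carrier (Obj (dual K M) R) \<Longrightarrow>
     \<mu> (self R) (Mor M S R f (alpha S w m)) = w (along R f) (coef R \<mu> (Mor M S R f m))"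
proof -
  \<comment> \<open>A point of the bidual of \<open>M\<close>, because matrix coefficients are
    natural and linear in the functional.\<close>
  let ?\<Phi> = "fam S (dual K M) (\<lambda>R f \<mu>. w (along R f) (coef R \<mu> (Mor M S R f m)))"
  have "?\<Phi> \<in> carrier (Obj (dual K (dual K M)) S)"
  proof (rule fam_dual[OF assms(1) dual_linear])
    fix R f assume R: "R \<in> A" "f \<in> hm S R"
    have m: "Mor M S R f m \<in> carrier (Obj M R)" using assms R by (intro M_D)
    note W = dual_D[OF assms(2,1) R]
    fix \<mu> assume \<mu>: "\<mu> \<in> carrier (Obj (dual K M) R)"
    note c = coef_closed[OF R(1) \<mu> m]
    show "w (along R f) (coef R \<mu> (Mor M S R f m)) \<in> carrier R"
      using c by (rule W)
    show "w (along R f) (coef R (\<mu> \<oplus>\<^bsub>Obj (dual K M) R\<^esub> \<nu>) (Mor M S R f m)) =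
       w (along R f) (coef R \<mu> (Mor M S R f m)) \<oplus>\<^bsub>R\<^esub> w (along R f) (coef R \<nu> (Mor M S R f m))"
      if "\<nu> \<in> carrier (Obj (dual K M) R)" for \<nu>
      using that \<mu> R m by (simp add: coef_linear(1) W(3) coef_closed)
    show "w (along R f) (coef R (s \<odot>\<^bsub>Obj (dual K M) R\<^esub> \<mu>) (Mor M S R f m)) =
       s \<otimes>\<^bsub>R\<^esub> w (along R f) (coef R \<mu> (Mor M S R f m))" if "s \<in> carrier R" for s
      using that \<mu> R m by (simp add: coef_linear(2) W(4) coef_closed)
    fix Q h assume Q: "Q \<in> A" "h \<in> hm R Q"
    show "w (along Q (cmp S h f)) (coef Q (Mor (dual K M) R Q h \<mu>) (Mor M S Q (cmp S h f) m)) =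
       h (w (along R f) (coef R \<mu> (Mor M S R f m)))"
      using W(2)[OF Q c] assms R Q \<mu> m by (simp add: coef_nat M_D(7))
  qed
  from reflexive_represent[OF refl_M assms(1) this] obtain x where x: "x \<in> carrier (Obj M S)"
    "\<And>R f \<mu>. R \<in> A \<Longrightarrow> f \<in> hm S R \<Longrightarrow> \<mu> \<in> carrier (Obj (dual K M) R) \<Longrightarrow>
      \<mu> (self R) (Mor M S R f x) = ?\<Phi> (along R f) \<mu>" by blast
  have "\<exists>x. x \<in> carrier (Obj M S) \<and> (\<forall>R\<in>A. \<forall>f\<in>hm S R. \<forall>\<mu>\<in>carrier (Obj (dual K M) R).
     \<mu> (self R) (Mor M S R f x) = w (along R f) (coef R \<mu> (Mor M S R f m)))"
    using x by (intro exI[of _ x]) simp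
  from someI_ex[OF this, folded alpha_def] show "alpha S w m \<in> carrier (Obj M S)"
    "\<And>R f \<mu>. R \<in> A \<Longrightarrow> f \<in> hm S R \<Longrightarrow> \<mu> \<in> carrier (Obj (dual K M) R) \<Longrightarrow>
     \<mu> (self R) (Mor M S R f (alpha S w m)) = w (along R f) (coef R \<mu> (Mor M S R f m))" by blast+
qed

lemma alpha_self:
  assumes "S \<in> A" "w \<in> carrier (Obj Dist S)" "m \<in> carrier (Obj M S)" "\<mu> \<in> carrier (Obj (dual K M) S)"
  shows "\<mu> (self S) (alpha S w m) = w (self S) (coef S \<mu> m)"
  using alpha_along[OF assms(1-3,1) ids_hm[OF assms(1)] assms(4)] alpha_closed[OF assms(1-3)] assms
  by (simp add: M_D(6) self_eq_along)

text \<open>Turns each algebraic law for \<open>alpha\<close> into an identity between matrix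
  coefficients.\<close>

lemma alpha_eqI:
  assumes "S \<in> A" "w \<in> carrier (Obj Dist S)" "m \<in> carrier (Obj M S)" "x \<in> carrier (Obj M S)"
    and "\<And>R f \<mu>. R \<in> A \<Longrightarrow> f \<in> hm S R \<Longrightarrow> \<mu> \<in> carrier (Obj (dual K M) R) \<Longrightarrow>
     \<mu> (self R) (Mor M S R f x) = w (along R f) (coef R \<mu> (Mor M S R f m))"
  shows "alpha S w m = x"
  using assms by (intro reflexive_ext[OF refl_M assms(1)]) (simp_all add: alpha_closed alpha_along)

lemma alpha_nat:
  assumes "S \<in> A" "w \<in> carrier (Obj Dist S)" "m \<in> carrier (Obj M S)" "R \<in> A" "f \<in> hm S R"
  shows "alpha R (Mor Dist S R f w) (Mor M S R f m) = Mor M S R f (alpha S w m)"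
proof (rule alpha_eqI)
  fix Q g \<mu> assume Q: "Q \<in> A" "g \<in> hm R Q" "\<mu> \<in> carrier (Obj (dual K M) Q)"
  show "\<mu> (self Q) (Mor M R Q g (Mor M S R f (alpha S w m))) =
     Mor Dist S R f w (along Q g) (coef Q \<mu> (Mor M R Q g (Mor M S R f m)))"
    using assms Q alpha_along[OF assms(1-3) Q(1) cmp_hm[OF assms(5) Q(2) assms(1)] Q(3)]
    by (simp add: M_D(7) alpha_closed)
qed (use assms in \<open>simp_all add: Mor_dual_closed M_D alpha_closed\<close>)

lemma alpha_linear:
  assumes "S \<in> A" "w \<in> carrier (Obj Dist S)" "m \<in> carrier (Obj M S)"
  shows "\<And>m'. m' \<in> carrier (Obj M S) \<Longrightarrow> alpha S w (m \<oplus>\<^bsub>Obj M S\<^esub> m') = alpha S w m \<oplus>\<^bsub>Obj M S\<^esub> alpha S w m'"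
    "\<And>s. s \<in> carrier S \<Longrightarrow> alpha S w (s \<odot>\<^bsub>Obj M S\<^esub> m) = s \<odot>\<^bsub>Obj M S\<^esub> alpha S w m"
    "\<And>w'. w' \<in> carrier (Obj Dist S) \<Longrightarrow> alpha S (w \<oplus>\<^bsub>Obj Dist S\<^esub> w') m = alpha S w m \<oplus>\<^bsub>Obj M S\<^esub> alpha S w' m"
    "\<And>s. s \<in> carrier S \<Longrightarrow> alpha S (s \<odot>\<^bsub>Obj Dist S\<^esub> w) m = s \<odot>\<^bsub>Obj M S\<^esub> alpha S w m"
proof -
  show "alpha S w (m \<oplus>\<^bsub>Obj M S\<^esub> m') = alpha S w m \<oplus>\<^bsub>Obj M S\<^esub> alpha S w m'" if "m' \<in> carrier (Obj M S)" for m'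
    using assms that by (intro alpha_eqI)
      (simp_all add: M_D(1,3,5) alpha_closed dual_self_D(2) alpha_along coef_linear(3) coef_closed dual_D(3)[OF assms(2)])
  show "alpha S w (s \<odot>\<^bsub>Obj M S\<^esub> m) = s \<odot>\<^bsub>Obj M S\<^esub> alpha S w m" if "s \<in> carrier S" for s
    using assms that by (intro alpha_eqI)
      (simp_all add: M_D(2,4,5) alpha_closed dual_self_D(3) alpha_along coef_linear(4) coef_closed
        dual_D(4)[OF assms(2)] alg_homD)
  show "alpha S (w \<oplus>\<^bsub>Obj Dist S\<^esub> w') m = alpha S w m \<oplus>\<^bsub>Obj M S\<^esub> alpha S w' m" if "w' \<in> carrier (Obj Dist S)" for w'
    using assms that by (intro alpha_eqI)
      (simp_all add: M_D(1,3,5) Dist_D(1) alpha_closed dual_self_D(2) alpha_along coef_closed)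
  show "alpha S (s \<odot>\<^bsub>Obj Dist S\<^esub> w) m = s \<odot>\<^bsub>Obj M S\<^esub> alpha S w m" if "s \<in> carrier S" for s
    using assms that by (intro alpha_eqI)
      (simp_all add: M_D(2,4,5) Dist_D(2) alpha_closed dual_self_D(3) alpha_along coef_closed alg_homD)
qed

lemma alpha_dirac:
  assumes "S \<in> A" "g \<in> carrier (Obj G S)" "m \<in> carrier (Obj M S)"
  shows "alpha S (dirac K G S g) m = act \<rho> S g m"
proof (rule alpha_eqI)
  fix R f \<mu> assume R: "R \<in> A" "f \<in> hm S R" "\<mu> \<in> carrier (Obj (dual K M) R)"
  have m: "Mor M S R f m \<in> carrier (Obj M R)" using assms R by (intro M_D)
  show "\<mu> (self R) (Mor M S R f (act \<rho> S g m)) = dirac K G S g (along R f) (coef R \<mu> (Mor M S R f m))"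
    using assms R m by (simp add: coef_closed act_nat self_eq_along G_D M_D(6))
qed (use assms in \<open>simp_all add: dirac_closed act_closed\<close>)

text \<open>For a functional \<open>\<mu>\<close>, both sides give
  \<open>w (g \<mapsto> w' (h \<mapsto> \<mu> (g h m)))\<close>: on the right, the characterisation
  of \<open>alpha\<close> is used for \<open>w\<close> with \<open>\<mu>\<close> and for
  \<open>w'\<close> with the functional \<open>y \<mapsto> \<mu> (g y)\<close>.\<close>

lemma alpha_convolution:
  assumes "S \<in> A" "w \<in> carrier (Obj Dist S)" "w' \<in> carrier (Obj Dist S)" "m \<in> carrier (Obj M S)"
  shows "alpha S (convolution K G S w w') m = alpha S w (alpha S w' m)"
proof (rule alpha_eqI)
  fix R f \<mu> assume R: "R \<in> A" "f \<in> hm S R" and \<mu>: "\<mu> \<in> carrier (Obj (dual K M) R)"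
  define n where "n = Mor M S R f m"
  define v where "v = Mor Dist S R f w'"
  have n: "n \<in> carrier (Obj M R)" unfolding n_def using assms R by (intro M_D)
  have v: "v \<in> carrier (Obj Dist R)" unfolding v_def using assms R by (intro Mor_dual_closed)
  have vn: "Mor M S R f (alpha S w' m) = alpha R v n"
    unfolding v_def n_def using assms R by (simp add: alpha_nat)
  have "average R v (coef R \<mu> n) = coef R \<mu> (alpha R v n)"
  proof (rule FUN_ext)
    fix U a g assume U: "U \<in> A" "a \<in> hm R U" and g: "g \<in> carrier (Obj G U)"
    \<comment> \<open>The functional \<open>y \<mapsto> \<mu> (g y)\<close> over \<open>U\<close>,
      where \<open>g\<close> is defined. Testing against it makes \<open>alpha_self\<close>
      applicable.\<close>
    define \<nu> where "\<nu> = fam U M (\<lambda>V b y. \<mu> (along V (cmp R b a)) (act \<rho> V (Mor G U V b g) y))"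
    have \<nu>: "\<nu> \<in> carrier (Obj (dual K M) U)"
      unfolding \<nu>_def
    proof (rule fam_dual[OF U(1) M])
      fix V b assume V: "V \<in> A" "b \<in> hm U V"
      note D = dual_D[OF \<mu> R(1) V(1) cmp_hm[OF U(2) V(2) R(1)]]
      have gV: "Mor G U V b g \<in> carrier (Obj G V)" using U V g by (intro G_D)
      fix y assume y: "y \<in> carrier (Obj M V)"
      show "\<mu> (along V (cmp R b a)) (act \<rho> V (Mor G U V b g) y) \<in> carrier V"
        using V gV y by (intro D act_closed)
      show "\<mu> (along V (cmp R b a)) (act \<rho> V (Mor G U V b g) (y \<oplus>\<^bsub>Obj M V\<^esub> z)) =
          \<mu> (along V (cmp R b a)) (act \<rho> V (Mor G U V b g) y) \<oplus>\<^bsub>V\<^esub>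
          \<mu> (along V (cmp R b a)) (act \<rho> V (Mor G U V b g) z)" if "z \<in> carrier (Obj M V)" for z
        using V gV y that by (simp add: act_add D act_closed)
      show "\<mu> (along V (cmp R b a)) (act \<rho> V (Mor G U V b g) (s \<odot>\<^bsub>Obj M V\<^esub> y)) =
          s \<otimes>\<^bsub>V\<^esub> \<mu> (along V (cmp R b a)) (act \<rho> V (Mor G U V b g) y)" if "s \<in> carrier V" for s
        using V gV y that by (simp add: act_smult D act_closed)
      fix Q h assume Q: "Q \<in> A" "h \<in> hm V Q"
      show "\<mu> (along Q (cmp R (cmp U h b) a)) (act \<rho> Q (Mor G U Q (cmp U h b) g) (Mor M V Q h y)) =
         h (\<mu> (along V (cmp R b a)) (act \<rho> V (Mor G U V b g) y))"
        using D(2)[OF Q act_closed[OF V(1) gV y]] U V Q g gV y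
        by (simp add: act_nat G_D(3) cmp_assoc[OF U(2)])
    qed
    define n' where "n' = Mor M R U a n"
    define v' where "v' = Mor Dist R U a v"
    have n': "n' \<in> carrier (Obj M U)" unfolding n'_def using n R U by (intro M_D)
    have v': "v' \<in> carrier (Obj Dist U)" unfolding v'_def using v R U by (intro Mor_dual_closed)
    have "coef R \<mu> (alpha R v n) (along U a) g = \<mu> (along U a) (act \<rho> U g (alpha U v' n'))"
      using U g R v n by (simp add: alpha_nat n'_def v'_def)
    also have "\<dots> = \<nu> (self U) (alpha U v' n')"
      using U g R alpha_closed[OF U(1) v' n'] by (simp add: \<nu>_def self_eq_along G_D(2))
    also have "\<dots> = v' (self U) (coef U \<nu> n')"
      using alpha_self[OF U(1) v' n' \<nu>] .
    \<comment> \<open>Associativity of the action enters here: \<open>g (h n')\<close> is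
      \<open>(g h) n'\<close>.\<close>
    also have "coef U \<nu> n' = translate U (Mor AG R U a (coef R \<mu> n)) g"
    proof (rule FUN_ext)
      fix V b h assume V: "V \<in> A" "b \<in> hm U V" and h: "h \<in> carrier (Obj G V)"
      have gV: "Mor G U V b g \<in> carrier (Obj G V)" using U V g by (intro G_D)
      have nV: "Mor M U V b n' \<in> carrier (Obj M V)" using n' U V by (intro M_D)
      have nV': "Mor M R V (cmp R b a) n = Mor M U V b n'"
        unfolding n'_def using n R U V by (simp add: M_D(7))
      show "coef U \<nu> n' (along V b) h = translate U (Mor AG R U a (coef R \<mu> n)) g (along V b) h"
        using U V h gV nV R act_closed[OF V(1) h nV]
        by (simp add: \<nu>_def G_mult_closed nV' act_mult)
    qed (use U n' \<nu> g R n \<mu> in \<open>simp_all add: coef_closed translate_closed Mor_FUN_closed\<close>)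
    also have "v' (self U) (translate U (Mor AG R U a (coef R \<mu> n)) g) = average R v (coef R \<mu> n) (along U a) g"
      using U g by (simp add: v'_def self_eq_along)
    finally show "average R v (coef R \<mu> n) (along U a) g = coef R \<mu> (alpha R v n) (along U a) g" by simp
  qed (use R v n \<mu> in \<open>simp_all add: average_closed coef_closed alpha_closed\<close>)
  then show "\<mu> (self R) (Mor M S R f (alpha S w (alpha S w' m))) =
     convolution K G S w w' (along R f) (coef R \<mu> (Mor M S R f m))"
    using assms R \<mu> n by (simp add: alpha_along alpha_closed vn n_def[symmetric] v_def[symmetric] coef_closed)
qed (use assms in \<open>simp_all add: convolution_closed alpha_closed\<close>)

end

section \<open>Existence and uniqueness of the extended action\<close>

context reflexive_G_module
begin

text \<open>An element of \<open>END\<close> consists of operators over all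
  \<open>S\<close>-algebras, so \<open>w\<close> is base changed before it acts through
  \<open>alpha\<close>.\<close>

definition sigma where
  "sigma = (\<lambda>S\<in>A. \<lambda>w\<in>carrier (Obj Dist S). fam S M (\<lambda>R f m. alpha R (Mor Dist S R f w) m))"

lemma sigma_app [simp]:
  assumes "S \<in> A" "w \<in> carrier (Obj Dist S)" "R \<in> A" "f \<in> hm S R" "m \<in> carrier (Obj M R)"
  shows "sigma S w (along R f) m = alpha R (Mor Dist S R f w) m"
  using assms by (simp add: sigma_def)

lemma sigma_closed:
  assumes "S \<in> A" "w \<in> carrier (Obj Dist S)"
  shows "sigma S w \<in> carrier (Obj (HOM K M M) S)"
proof -
  have "fam S M (\<lambda>R f m. alpha R (Mor Dist S R f w) m) \<in> carrier (Obj (HOM K M M) S)"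
  proof (rule fam_HOM[OF assms(1) M])
    fix R Q f h m assume *: "R \<in> A" "Q \<in> A" "f \<in> hm S R" "h \<in> hm R Q" "m \<in> carrier (Obj M R)"
    then show "alpha Q (Mor Dist S Q (cmp S h f) w) (Mor M R Q h m) = Mor M R Q h (alpha R (Mor Dist S R f w) m)"
      using assms by (simp add: Dist_D(7) alpha_nat Mor_dual_closed)
  qed (use assms in \<open>simp_all add: alpha_closed alpha_linear Mor_dual_closed\<close>)
  then show ?thesis using assms by (simp add: sigma_def)
qed

lemma sigma_alg_trans: "sigma \<in> alg_trans K (dist_algebra K G) (END K M)"
proof -
  have 1: "sigma \<in> (\<Pi>\<^sub>E S\<in>A. carrier (Obj (dist_algebra K G) S) \<rightarrow>\<^sub>E carrier (Obj (END K M) S))"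
  proof (rule PiE_I)
    show "sigma S \<in> carrier (Obj (dist_algebra K G) S) \<rightarrow>\<^sub>E carrier (Obj (END K M) S)" if "S \<in> A" for S
      using that by (intro PiE_I) (simp_all add: sigma_closed, simp add: sigma_def)
  qed (simp add: sigma_def)
  have 2: "sigma R (Mor Dist S R f w) = Mor (HOM K M M) S R f (sigma S w)"
    if *: "S \<in> A" "R \<in> A" "f \<in> hm S R" "w \<in> carrier (Obj Dist S)" for S R f w
    using * by (intro HOM_ext[of _ M M R]) (auto simp: Mor_HOM_closed sigma_closed Mor_dual_closed Dist_D(7))
  have 3: "sigma S (w \<oplus>\<^bsub>Obj Dist S\<^esub> w') = sigma S w \<oplus>\<^bsub>Obj (HOM K M M) S\<^esub> sigma S w'"
    if *: "S \<in> A" "w \<in> carrier (Obj Dist S)" "w' \<in> carrier (Obj Dist S)" for S w w'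
    unfolding HOM_add_fam[OF *(1)] unfolding sigma_def using *
    by (simp add: Dist_D(1)) (intro fam_cong, auto simp: Dist_D(3) alpha_linear Mor_dual_closed)
  have 4: "sigma S (s \<odot>\<^bsub>Obj Dist S\<^esub> w) = s \<odot>\<^bsub>Obj (HOM K M M) S\<^esub> sigma S w"
    if *: "S \<in> A" "w \<in> carrier (Obj Dist S)" "s \<in> carrier S" for S w s
    unfolding HOM_smult_fam[OF *(1)] unfolding sigma_def using *
    by (simp add: Dist_D(2)) (intro fam_cong, auto simp: Dist_D(4) alpha_linear Mor_dual_closed alg_homD)
  have 5: "sigma S (convolution K G S w w') = sigma S w \<otimes>\<^bsub>Obj (END K M) S\<^esub> sigma S w'"
    if *: "S \<in> A" "w \<in> carrier (Obj Dist S)" "w' \<in> carrier (Obj Dist S)" for S w w'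
    unfolding END_mult_fam[OF *(1)] unfolding sigma_def using *
    by (simp add: convolution_closed)
      (intro fam_cong, auto simp: convolution_nat alpha_convolution alpha_closed Mor_dual_closed)
  have 6: "sigma S (dirac K G S \<one>\<^bsub>Obj G S\<^esub>) = \<one>\<^bsub>Obj (END K M) S\<^esub>" if *: "S \<in> A" for S
    unfolding END_mult_fam[OF *(1)] unfolding sigma_def using *
    by (simp add: dirac_closed G_one_closed)
      (intro fam_cong, auto simp: dirac_nat alpha_dirac act_one G_one_closed G_D(5))
  have hom: "sigma S \<in> hom (Obj (dist_algebra K G) S) (Obj (END K M) S)" if "S \<in> A" for S
    using that by (intro homI) (simp_all add: sigma_closed 5)
  show ?thesis
    unfolding alg_trans_def lin_trans_def monoid_trans_def nat_trans_def
    using 1 hom by (simp add: 2 3 4 6)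
qed

lemma sigma_dirac:
  assumes "S \<in> A" "g \<in> carrier (Obj G S)"
  shows "sigma S (dirac K G S g) = \<rho> S g"
  using assms
  by (intro HOM_ext[of _ M M S]) (auto simp: dirac_closed sigma_closed rho_closed dirac_nat alpha_dirac rho_along G_D)

text \<open>For fixed \<open>\<mu>\<close> and \<open>n\<close>, the assignment
  \<open>v \<mapsto> \<mu> (\<tau> v n)\<close> is a functional on distributions. Reflexivity of
  \<open>A_G\<close> makes it evaluation at a function, which Dirac distributions identify as a
  matrix coefficient. Thus \<open>\<tau>\<close> satisfies the characterisation of
  \<open>alpha\<close>.\<close>

lemma extension_unique:
  assumes refl: "reflexive K AG" and \<tau>: "\<tau> \<in> alg_trans K (dist_algebra K G) (END K M)"
    and \<tau>\<rho>: "\<And>S g. S \<in> A \<Longrightarrow> g \<in> carrier (Obj G S) \<Longrightarrow> \<tau> S (dirac K G S g) = \<rho> S g"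
  shows "\<tau> = sigma"
proof -
  have PiE: "\<tau> \<in> (\<Pi>\<^sub>E S\<in>A. carrier (Obj Dist S) \<rightarrow>\<^sub>E carrier (Obj (HOM K M M) S))"
    using \<tau> unfolding alg_trans_def lin_trans_def nat_trans_def by simp
  have cl: "\<tau> S w \<in> carrier (Obj (HOM K M M) S)" if "S \<in> A" "w \<in> carrier (Obj Dist S)" for S w
    using PiE that by (auto dest!: PiE_mem)
  have nat: "\<tau> R (Mor Dist S R f w) = Mor (HOM K M M) S R f (\<tau> S w)"
    if "S \<in> A" "R \<in> A" "f \<in> hm S R" "w \<in> carrier (Obj Dist S)" for S R f w
    using \<tau> that unfolding alg_trans_def lin_trans_def nat_trans_def by simp
  have lin: "\<tau> S (w \<oplus>\<^bsub>Obj Dist S\<^esub> w') = \<tau> S w \<oplus>\<^bsub>Obj (HOM K M M) S\<^esub> \<tau> S w'"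
    "s \<in> carrier S \<Longrightarrow> \<tau> S (s \<odot>\<^bsub>Obj Dist S\<^esub> w) = s \<odot>\<^bsub>Obj (HOM K M M) S\<^esub> \<tau> S w"
    if "S \<in> A" "w \<in> carrier (Obj Dist S)" "w' \<in> carrier (Obj Dist S)" for S w w' s
    using \<tau> that unfolding alg_trans_def lin_trans_def by simp_all
  have along: "\<tau> S w (along R f) = act \<tau> R (Mor Dist S R f w)"
    if "S \<in> A" "R \<in> A" "f \<in> hm S R" "w \<in> carrier (Obj Dist S)" for S R f w
    using that by (intro ext) (simp add: act_def nat Mor_HOM_self)
  have acl: "act \<tau> S w m \<in> carrier (Obj M S)"
    if "S \<in> A" "w \<in> carrier (Obj Dist S)" "m \<in> carrier (Obj M S)" for S w m
    using HOM_D(1)[OF cl, of S w S "ids S" m] that by (simp add: act_def self_eq_along)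
  have act_nat': "Mor M S R f (act \<tau> S w m) = act \<tau> R (Mor Dist S R f w) (Mor M S R f m)"
    if *: "S \<in> A" "w \<in> carrier (Obj Dist S)" "m \<in> carrier (Obj M S)" "R \<in> A" "f \<in> hm S R" for S w m R f
  proof -
    have "\<tau> S w (along R (cmp S f (ids S))) (Mor M S R f m) = Mor M S R f (\<tau> S w (along S (ids S)) m)"
      by (rule HOM_D(2)[OF cl]) (use * in auto)
    then show ?thesis
      using * by (simp add: act_def[of \<tau> S] self_eq_along[of S] along)
  qed
  have key: "\<mu> (self R) (act \<tau> R v n) = v (self R) (coef R \<mu> n)"
    if R: "R \<in> A" and v: "v \<in> carrier (Obj Dist R)" and n: "n \<in> carrier (Obj M R)"
      and \<mu>: "\<mu> \<in> carrier (Obj (dual K M) R)" for R v n \<mu>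
  proof -
    let ?\<Psi> = "fam R Dist (\<lambda>Q q v. \<mu> (along Q q) (act \<tau> Q v (Mor M R Q q n)))"
    have "?\<Psi> \<in> carrier (Obj (dual K Dist) R)"
    proof (rule fam_dual[OF R Dist_linear])
      fix Q q u assume Q: "Q \<in> A" "q \<in> hm R Q" and u: "u \<in> carrier (Obj Dist Q)"
      note D = dual_D[OF \<mu> R Q]
      have nQ: "Mor M R Q q n \<in> carrier (Obj M Q)" using n R Q by (intro M_D)
      show "\<mu> (along Q q) (act \<tau> Q u (Mor M R Q q n)) \<in> carrier Q"
        using Q u nQ by (intro D acl)
      show "\<mu> (along Q q) (act \<tau> Q (u \<oplus>\<^bsub>Obj Dist Q\<^esub> u') (Mor M R Q q n)) =
         \<mu> (along Q q) (act \<tau> Q u (Mor M R Q q n)) \<oplus>\<^bsub>Q\<^esub> \<mu> (along Q q) (act \<tau> Q u' (Mor M R Q q n))"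
        if "u' \<in> carrier (Obj Dist Q)" for u'
      proof -
        have "act \<tau> Q (u \<oplus>\<^bsub>Obj Dist Q\<^esub> u') (Mor M R Q q n) =
           act \<tau> Q u (Mor M R Q q n) \<oplus>\<^bsub>Obj M Q\<^esub> act \<tau> Q u' (Mor M R Q q n)"
          using Q u nQ that by (simp add: act_def lin self_eq_along)
        then show ?thesis using Q u nQ that by (simp add: D acl)
      qed
      show "\<mu> (along Q q) (act \<tau> Q (s \<odot>\<^bsub>Obj Dist Q\<^esub> u) (Mor M R Q q n)) =
         s \<otimes>\<^bsub>Q\<^esub> \<mu> (along Q q) (act \<tau> Q u (Mor M R Q q n))" if "s \<in> carrier Q" for s
      proof -
        have "act \<tau> Q (s \<odot>\<^bsub>Obj Dist Q\<^esub> u) (Mor M R Q q n) = s \<odot>\<^bsub>Obj M Q\<^esub> act \<tau> Q u (Mor M R Q q n)"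
          using Q u nQ that by (simp add: act_def lin self_eq_along)
        then show ?thesis using Q u nQ that by (simp add: D acl)
      qed
      fix P p assume P: "P \<in> A" "p \<in> hm Q P"
      show "\<mu> (along P (cmp R p q)) (act \<tau> P (Mor Dist Q P p u) (Mor M R P (cmp R p q) n)) =
         p (\<mu> (along Q q) (act \<tau> Q u (Mor M R Q q n)))"
        using D(2)[OF P acl[OF Q(1) u nQ]] R Q P n u nQ by (simp add: act_nat' M_D(7))
    qed
    from reflexive_represent[OF refl R this] obtain F where F: "F \<in> carrier (Obj AG R)"
      "\<And>Q q v. Q \<in> A \<Longrightarrow> q \<in> hm R Q \<Longrightarrow> v \<in> carrier (Obj Dist Q) \<Longrightarrow>
         v (self Q) (Mor AG R Q q F) = ?\<Psi> (along Q q) v" by blast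
    \<comment> \<open>On Dirac distributions \<open>\<tau>\<close> is given by
      \<open>\<rho>\<close>, so \<open>F\<close> has the values of the matrix coefficient.\<close>
    have "F = coef R \<mu> n"
    proof (rule FUN_eq_dirac[OF R F(1) coef_closed[OF R \<mu> n]])
      fix Q q g assume Q: "Q \<in> A" "q \<in> hm R Q" "g \<in> carrier (Obj G Q)"
      have nQ: "Mor M R Q q n \<in> carrier (Obj M Q)" using n R Q by (intro M_D)
      have "dirac K G Q g (self Q) (Mor AG R Q q F) = \<mu> (along Q q) (act \<tau> Q (dirac K G Q g) (Mor M R Q q n))"
        using F(2)[OF Q(1,2) dirac_closed[OF Q(1,3)]] Q by (simp add: dirac_closed)
      also have "act \<tau> Q (dirac K G Q g) (Mor M R Q q n) = act \<rho> Q g (Mor M R Q q n)"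
        using Q by (simp add: act_def \<tau>\<rho>)
      finally show "dirac K G Q g (self Q) (Mor AG R Q q F) = dirac K G Q g (self Q) (Mor AG R Q q (coef R \<mu> n))"
        using Q R n \<mu> by (simp add: self_eq_along Mor_FUN_closed coef_closed G_D(2))
    qed
    then show ?thesis
      using F(2)[OF R ids_hm[OF R] v] R F(1) v n by (simp add: AG_D(6) M_D(6) self_eq_along)
  qed
  have eq: "act \<tau> S w m = alpha S w m"
    if *: "S \<in> A" "w \<in> carrier (Obj Dist S)" "m \<in> carrier (Obj M S)" for S w m
  proof (rule alpha_eqI[symmetric, OF * acl[OF *]])
    fix R f \<mu> assume R: "R \<in> A" "f \<in> hm S R" "\<mu> \<in> carrier (Obj (dual K M) R)"
    then show "\<mu> (self R) (Mor M S R f (act \<tau> S w m)) = w (along R f) (coef R \<mu> (Mor M S R f m))"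
      using * by (simp add: act_nat' key Mor_dual_closed M_D(5) Mor_dual_self)
  qed
  have tw: "\<tau> S w = sigma S w" if "S \<in> A" "w \<in> carrier (Obj Dist S)" for S w
    using that by (intro HOM_ext[of _ M M S]) (auto simp: cl sigma_closed along eq Mor_dual_closed)
  show ?thesis
  proof (rule extensionalityI)
    show "\<tau> \<in> extensional A" "sigma \<in> extensional A"
      using PiE by (auto simp: PiE_def sigma_def)
    fix S assume S: "S \<in> A"
    then have "\<tau> S \<in> extensional (carrier (Obj Dist S))" "sigma S \<in> extensional (carrier (Obj Dist S))"
      using PiE_mem[OF PiE S] by (simp_all add: PiE_def sigma_def)
    then show "\<tau> S = sigma S"
      by (rule extensionalityI) (rule tw[OF S])
  qed
qed

lemma extension_eq:
  assumes "reflexive K AG"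
  shows "extension K G M \<rho> = sigma"
  unfolding extension_def
proof (rule the_equality)
  show "sigma \<in> alg_trans K (dist_algebra K G) (END K M) \<and>
      (\<forall>S\<in>A. \<forall>g\<in>carrier (Obj G S). sigma S (dirac K G S g) = \<rho> S g)"
    by (simp add: sigma_alg_trans sigma_dirac)
  show "\<tau> = sigma" if "\<tau> \<in> alg_trans K (dist_algebra K G) (END K M) \<and>
      (\<forall>S\<in>A. \<forall>g\<in>carrier (Obj G S). \<tau> S (dirac K G S g) = \<rho> S g)" for \<tau>
    by (rule extension_unique[OF assms]) (use that in auto)
qed

lemma act_extension:
  assumes "reflexive K AG" "S \<in> A" "w \<in> carrier (Obj Dist S)" "m \<in> carrier (Obj M S)"
  shows "act (extension K G M \<rho>) S w m = alpha S w m"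
  unfolding extension_eq[OF assms(1)] act_def using assms by (simp add: self_eq_along Dist_D(6))

end

section \<open>Morphisms of modules\<close>

locale G_module_pair = base_field K + p: reflexive_G_module K G M \<rho> + q: reflexive_G_module K G M' \<rho>'
  for K :: "'u ring" and G :: "('u, 'g) mon_functor"
    and M :: "('u, 'm) mod_functor" and \<rho> and M' :: "('u, 'n) mod_functor" and \<rho>' +
  fixes \<phi> :: "'u calg \<Rightarrow> 'm \<Rightarrow> 'n"
  assumes \<phi>: "\<phi> \<in> lin_trans K M M'"
begin

lemma phi_closed: "S \<in> A \<Longrightarrow> m \<in> carrier (Obj M S) \<Longrightarrow> \<phi> S m \<in> carrier (Obj M' S)"
  using lin_trans_closed[OF \<phi>] .

lemma phi_nat: "S \<in> A \<Longrightarrow> R \<in> A \<Longrightarrow> f \<in> hm S R \<Longrightarrow> m \<in> carrier (Obj M S) \<Longrightarrow>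
  \<phi> R (Mor M S R f m) = Mor M' S R f (\<phi> S m)"
  using \<phi> unfolding lin_trans_def nat_trans_def by simp

lemma phi_add: "S \<in> A \<Longrightarrow> m \<in> carrier (Obj M S) \<Longrightarrow> m' \<in> carrier (Obj M S) \<Longrightarrow>
  \<phi> S (m \<oplus>\<^bsub>Obj M S\<^esub> m') = \<phi> S m \<oplus>\<^bsub>Obj M' S\<^esub> \<phi> S m'"
  using \<phi> unfolding lin_trans_def by simp

lemma phi_smult: "S \<in> A \<Longrightarrow> m \<in> carrier (Obj M S) \<Longrightarrow> s \<in> carrier S \<Longrightarrow>
  \<phi> S (s \<odot>\<^bsub>Obj M S\<^esub> m) = s \<odot>\<^bsub>Obj M' S\<^esub> \<phi> S m"
  using \<phi> unfolding lin_trans_def by simp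

text \<open>The transpose of \<open>\<phi>\<close> on functionals.\<close>

definition pull where
  "pull S \<mu> = fam S M (\<lambda>R f m. \<mu> (along R f) (\<phi> R m))"

lemma pull_closed:
  assumes "S \<in> A" "\<mu> \<in> carrier (Obj (dual K M') S)"
  shows "pull S \<mu> \<in> carrier (Obj (dual K M) S)"
  unfolding pull_def using assms
  by (intro fam_dual p.M)
    (simp_all add: phi_closed phi_nat phi_add phi_smult dual_D[OF assms(2,1)])

lemma pull_self: "S \<in> A \<Longrightarrow> m \<in> carrier (Obj M S) \<Longrightarrow> pull S \<mu> (self S) m = \<mu> (self S) (\<phi> S m)"
  by (simp add: pull_def self_eq_along)

text \<open>Pulling \<open>\<mu>\<close> back along an equivariant \<open>\<phi>\<close> turns the
  coefficients of \<open>m\<close> into those of \<open>\<phi> m\<close>, since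
  \<open>\<mu> (\<phi> (g m))\<close> is \<open>\<mu> (g (\<phi> m))\<close>.\<close>

lemma G_morphism_imp:
  assumes "G_morphism K G M \<rho> M' \<rho>' \<phi>" "S \<in> A" "w \<in> carrier (Obj p.Dist S)" "m \<in> carrier (Obj M S)"
  shows "\<phi> S (p.alpha S w m) = q.alpha S w (\<phi> S m)"
proof (rule q.alpha_eqI[symmetric])
  have eqv: "\<phi> R (act \<rho> R g n) = act \<rho>' R g (\<phi> R n)"
    if "R \<in> A" "g \<in> carrier (Obj G R)" "n \<in> carrier (Obj M R)" for R g n
    using assms(1) that unfolding G_morphism_def by blast
  fix R f \<mu> assume R: "R \<in> A" "f \<in> hm S R" and \<mu>: "\<mu> \<in> carrier (Obj (dual K M') R)"
  define n where "n = Mor M S R f m"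
  have n: "n \<in> carrier (Obj M R)" unfolding n_def using assms R by (intro p.M_D)
  have \<alpha>: "p.alpha S w m \<in> carrier (Obj M S)" using assms by (intro p.alpha_closed)
  have "\<mu> (self R) (Mor M' S R f (\<phi> S (p.alpha S w m))) = pull R \<mu> (self R) (Mor M S R f (p.alpha S w m))"
    using assms R \<alpha> by (simp add: pull_self phi_nat p.M_D(5))
  also have "\<dots> = w (along R f) (p.coef R (pull R \<mu>) n)"
    using p.alpha_along[OF assms(2-4) R pull_closed[OF R(1) \<mu>]] by (simp add: n_def)
  also have "p.coef R (pull R \<mu>) n = q.coef R \<mu> (\<phi> R n)"
  proof (rule FUN_ext)
    fix U a g assume U: "U \<in> A" "a \<in> hm R U" "g \<in> carrier (Obj G U)"
    have "Mor M R U a n \<in> carrier (Obj M U)" using n R U by (intro p.M_D)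
    then show "p.coef R (pull R \<mu>) n (along U a) g = q.coef R \<mu> (\<phi> R n) (along U a) g"
      using U R n by (simp add: pull_def p.act_closed eqv phi_nat)
  qed (use R \<mu> n in \<open>simp_all add: p.coef_closed q.coef_closed pull_closed phi_closed\<close>)
  also have "\<phi> R n = Mor M' S R f (\<phi> S m)"
    unfolding n_def using assms R by (simp add: phi_nat)
  finally show "\<mu> (self R) (Mor M' S R f (\<phi> S (p.alpha S w m))) = w (along R f) (q.coef R \<mu> (Mor M' S R f (\<phi> S m)))" .
qed (use assms in \<open>simp_all add: phi_closed p.alpha_closed\<close>)

text \<open>In \<open>step1\<close> the vector comes from \<open>M(K)\<close> and \<open>g\<close>
  is arbitrary; in \<open>step2\<close> the vector is arbitrary as well. Each step is one use of
  \<open>dual_base_points_separate\<close>, and reflexivity of \<open>M'\<close> finally removes the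
  functional \<open>\<mu>\<close>.\<close>

lemma base_linear_imp:
  assumes inf: "infinite (UNIV :: 'u set)"
    and lin: "\<And>w m. w \<in> carrier (Obj p.Dist (self K)) \<Longrightarrow> m \<in> carrier (Obj M (self K)) \<Longrightarrow>
      \<phi> (self K) (p.alpha (self K) w m) = q.alpha (self K) w (\<phi> (self K) m)"
  shows "G_morphism K G M \<rho> M' \<rho>' \<phi>"
proof -
  have step1: "\<mu> (self S) (\<phi> S (act \<rho> S g (Mor M (self K) S (smap S) m))) =
      \<mu> (self S) (act \<rho>' S g (\<phi> S (Mor M (self K) S (smap S) m)))"
    if S: "S \<in> A" and m: "m \<in> carrier (Obj M (self K))" and g: "g \<in> carrier (Obj G S)"
      and \<mu>: "\<mu> \<in> carrier (Obj (dual K M') S)" for S m g \<mu>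
  proof -
    define n where "n = Mor M (self K) S (smap S) m"
    have n: "n \<in> carrier (Obj M S)" unfolding n_def using S m by (intro p.M_D) auto
    have sm: "smap S \<in> hm (self K) S" using S by simp
    have pn: "\<phi> S n = Mor M' (self K) S (smap S) (\<phi> (self K) m)"
      unfolding n_def using S m by (simp add: phi_nat)
    let ?F = "p.coef S (pull S \<mu>) n" and ?F' = "q.coef S \<mu> (\<phi> S n)"
    have F: "?F \<in> carrier (Obj p.AG S)" "?F' \<in> carrier (Obj p.AG S)"
      using S n \<mu> by (simp_all add: p.coef_closed q.coef_closed pull_closed phi_closed)
    \<comment> \<open>\<open>lin\<close> says that every distribution over \<open>K\<close> pairs
      equally with the coefficients \<open>?F\<close> and \<open>?F'\<close>. Separation extends
      this to the Dirac distribution at \<open>g\<close>, which lives over \<open>S\<close>.\<close>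
    have "dirac K G S g (self S) (Mor p.AG S S (ids S) ?F) = dirac K G S g (self S) (Mor p.AG S S (ids S) ?F')"
    proof (rule dual_base_points_separate[OF inf p.AG_linear S F _ S ids_hm[OF S] p.dirac_closed[OF S g]])
      fix w assume w: "w \<in> carrier (Obj p.Dist (self K))"
      have \<alpha>: "p.alpha (self K) w m \<in> carrier (Obj M (self K))" using w m by (intro p.alpha_closed) auto
      have "w (along S (smap S)) ?F = pull S \<mu> (self S) (Mor M (self K) S (smap S) (p.alpha (self K) w m))"
        unfolding n_def using p.alpha_along[OF self_A w m S sm pull_closed[OF S \<mu>]] by simp
      also have "\<dots> = \<mu> (self S) (Mor M' (self K) S (smap S) (q.alpha (self K) w (\<phi> (self K) m)))"
        using S m w \<alpha> by (simp add: pull_self p.M_D(5) phi_nat lin)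
      also have "\<dots> = w (along S (smap S)) ?F'"
        unfolding pn using S m w by (intro q.alpha_along \<mu>) (simp_all add: phi_closed)
      finally show "w S ?F = w S ?F'" by simp
    qed
    then have "?F (self S) g = ?F' (self S) g"
      using S g F by (simp add: p.AG_D(6) self_eq_along p.G_D(2))
    then show ?thesis
      using S g n unfolding n_def[symmetric]
      by (simp add: self_eq_along p.M_D(6) q.M_D(6) phi_closed p.act_closed pull_def)
  qed
  have step2: "\<mu> (self R) (\<phi> R (act \<rho> R g m)) = \<mu> (self R) (act \<rho>' R g (\<phi> R m))"
    if R: "R \<in> A" and m: "m \<in> carrier (Obj M R)" and g: "g \<in> carrier (Obj G R)"
      and \<mu>: "\<mu> \<in> carrier (Obj (dual K M') R)" for R m g \<mu>
  proof -
    \<comment> \<open>With \<open>g\<close> and \<open>\<mu>\<close> fixed, the two sides of the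
      claim are functionals in the vector.\<close>
    let ?n = "fam R M (\<lambda>Q f y. \<mu> (along Q f) (\<phi> Q (act \<rho> Q (Mor G R Q f g) y)))"
    let ?n' = "fam R M (\<lambda>Q f y. \<mu> (along Q f) (act \<rho>' Q (Mor G R Q f g) (\<phi> Q y)))"
    have n: "?n \<in> carrier (Obj (dual K M) R)"
    proof (rule fam_dual[OF R p.M])
      fix P Q f h y assume *: "P \<in> A" "Q \<in> A" "f \<in> hm R P" "h \<in> hm P Q" "y \<in> carrier (Obj M P)"
      have gP: "Mor G R P f g \<in> carrier (Obj G P)" using * g R by (intro p.G_D)
      show "\<mu> (along Q (cmp R h f)) (\<phi> Q (act \<rho> Q (Mor G R Q (cmp R h f) g) (Mor M P Q h y))) =
         h (\<mu> (along P f) (\<phi> P (act \<rho> P (Mor G R P f g) y)))"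
        using * g R gP dual_D(2)[OF \<mu> R *(1,3,2,4), of "\<phi> P (act \<rho> P (Mor G R P f g) y)"]
        by (simp add: p.G_D(3) p.act_nat[symmetric] phi_nat p.act_closed phi_closed)
    qed (use R g in \<open>simp_all add: p.G_D(1) p.act_closed phi_closed p.act_add p.act_smult phi_add phi_smult
        dual_D[OF \<mu> R]\<close>)
    have n': "?n' \<in> carrier (Obj (dual K M) R)"
    proof (rule fam_dual[OF R p.M])
      fix P Q f h y assume *: "P \<in> A" "Q \<in> A" "f \<in> hm R P" "h \<in> hm P Q" "y \<in> carrier (Obj M P)"
      have gP: "Mor G R P f g \<in> carrier (Obj G P)" using * g R by (intro p.G_D)
      show "\<mu> (along Q (cmp R h f)) (act \<rho>' Q (Mor G R Q (cmp R h f) g) (\<phi> Q (Mor M P Q h y))) =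
         h (\<mu> (along P f) (act \<rho>' P (Mor G R P f g) (\<phi> P y)))"
        using * g R gP dual_D(2)[OF \<mu> R *(1,3,2,4), of "act \<rho>' P (Mor G R P f g) (\<phi> P y)"]
        by (simp add: p.G_D(3) q.act_nat[symmetric] phi_nat q.act_closed phi_closed)
    qed (use R g in \<open>simp_all add: p.G_D(1) q.act_closed phi_closed q.act_add q.act_smult phi_add phi_smult
        dual_D[OF \<mu> R]\<close>)
    obtain \<theta> where b: "bidual_map K M \<in> lin_trans K M (dual K (dual K M))"
      by (rule reflexiveD[OF p.refl_M])
    have bm: "bidual_map K M R m \<in> carrier (Obj (dual K (dual K M)) R)"
      by (rule lin_trans_closed[OF b R m])
    have ev: "bidual_map K M R m (self R) \<nu> = \<nu> (self R) m" if "\<nu> \<in> carrier (Obj (dual K M) R)" for \<nu>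
      using bidual_map_app[OF R m R ids_hm[OF R] that] R m by (simp add: self_eq_along p.M_D(6))
    have "bidual_map K M R m (self R) (Mor (dual K M) R R (ids R) ?n) =
        bidual_map K M R m (self R) (Mor (dual K M) R R (ids R) ?n')"
    proof (rule dual_base_points_separate[OF inf p.dual_linear R n n' _ R ids_hm[OF R] bm])
      fix \<Xi> assume \<Xi>: "\<Xi> \<in> carrier (Obj (dual K (dual K M)) (self K))"
      \<comment> \<open>By reflexivity the base points of the dual of \<open>M*\<close> are vectors
        of \<open>M(K)\<close>, and for those \<open>step1\<close> applies.\<close>
      obtain m0 where m0: "m0 \<in> carrier (Obj M (self K))"
        "\<And>R f \<nu>. R \<in> A \<Longrightarrow> f \<in> hm (self K) R \<Longrightarrow> \<nu> \<in> carrier (Obj (dual K M) R) \<Longrightarrow>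
          \<nu> (self R) (Mor M (self K) R f m0) = \<Xi> (along R f) \<nu>"
        using reflexive_represent[OF p.refl_M self_A \<Xi>] by blast
      have e: "\<Xi> R \<nu> = \<nu> (self R) (Mor M (self K) R (smap R) m0)" if "\<nu> \<in> carrier (Obj (dual K M) R)" for \<nu>
        using m0(2)[OF R smap_hm[OF R] that] by simp
      have "Mor M (self K) R (smap R) m0 \<in> carrier (Obj M R)"
        using R m0(1) by (intro p.M_D) auto
      then show "\<Xi> R ?n = \<Xi> R ?n'"
        unfolding e[OF n] e[OF n'] using step1[OF R m0(1) g \<mu>] R g
        by (simp add: self_eq_along p.G_D(2))
    qed
    then have "?n (self R) m = ?n' (self R) m"
      using linear_functorD(6)[OF p.dual_linear R] n n' ev by simp
    then show ?thesis using R m g by (simp add: self_eq_along p.G_D(2))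
  qed
  show ?thesis
    unfolding G_morphism_def
  proof (intro conjI \<phi> ballI)
    fix S g m assume *: "S \<in> A" "g \<in> carrier (Obj G S)" "m \<in> carrier (Obj M S)"
    show "\<phi> S (act \<rho> S g m) = act \<rho>' S g (\<phi> S m)"
    proof (rule reflexive_ext[OF q.refl_M *(1)])
      fix R f \<mu> assume R: "R \<in> A" "f \<in> hm S R" "\<mu> \<in> carrier (Obj (dual K M') R)"
      have "Mor M S R f m \<in> carrier (Obj M R)" "Mor G S R f g \<in> carrier (Obj G R)"
        using * R by (auto intro: p.M_D p.G_D)
      from step2[OF R(1) this R(3)]
      show "\<mu> (self R) (Mor M' S R f (\<phi> S (act \<rho> S g m))) = \<mu> (self R) (Mor M' S R f (act \<rho>' S g (\<phi> S m)))"
        using * R by (simp add: phi_nat[symmetric] p.act_closed p.act_nat q.act_nat phi_closed)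
    qed (use * in \<open>simp_all add: phi_closed p.act_closed q.act_closed\<close>)
  qed
qed

end

section \<open>Square-zero extensions\<close>

text \<open>The trivial extension \<open>S \<oplus> N\<close>, in which products of two elements of
  \<open>N\<close> vanish. For \<open>N = Obj scal S\<close> these are the dual numbers.\<close>

definition square_zero_ring :: "'u calg \<Rightarrow> ('u, 'n) module \<Rightarrow> ('u \<times> 'n) ring" where
  "square_zero_ring S N = \<lparr>carrier = carrier S \<times> carrier N,
     monoid.mult = (\<lambda>a b. (fst a \<otimes>\<^bsub>S\<^esub> fst b, fst a \<odot>\<^bsub>N\<^esub> snd b \<oplus>\<^bsub>N\<^esub> fst b \<odot>\<^bsub>N\<^esub> snd a)),
     monoid.one = (\<one>\<^bsub>S\<^esub>, \<zero>\<^bsub>N\<^esub>), ring.zero = (\<zero>\<^bsub>S\<^esub>, \<zero>\<^bsub>N\<^esub>),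
     ring.add = (\<lambda>a b. (fst a \<oplus>\<^bsub>S\<^esub> fst b, snd a \<oplus>\<^bsub>N\<^esub> snd b))\<rparr>"

lemma square_zero_sel [simp]:
  "carrier (square_zero_ring S N) = carrier S \<times> carrier N"
  "(s, x) \<otimes>\<^bsub>square_zero_ring S N\<^esub> (t, y) = (s \<otimes>\<^bsub>S\<^esub> t, s \<odot>\<^bsub>N\<^esub> y \<oplus>\<^bsub>N\<^esub> t \<odot>\<^bsub>N\<^esub> x)"
  "\<one>\<^bsub>square_zero_ring S N\<^esub> = (\<one>\<^bsub>S\<^esub>, \<zero>\<^bsub>N\<^esub>)" "\<zero>\<^bsub>square_zero_ring S N\<^esub> = (\<zero>\<^bsub>S\<^esub>, \<zero>\<^bsub>N\<^esub>)"
  "(s, x) \<oplus>\<^bsub>square_zero_ring S N\<^esub> (t, y) = (s \<oplus>\<^bsub>S\<^esub> t, x \<oplus>\<^bsub>N\<^esub> y)"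
  by (simp_all add: square_zero_ring_def)

lemma cring_square_zero:
  assumes "module S N"
  shows "cring (square_zero_ring S N)"
proof -
  interpret N: module S N by fact
  show ?thesis
  proof (intro cringI abelian_groupI comm_monoidI)
    show "\<exists>b\<in>carrier (square_zero_ring S N). b \<oplus>\<^bsub>square_zero_ring S N\<^esub> a = \<zero>\<^bsub>square_zero_ring S N\<^esub>"
      if "a \<in> carrier (square_zero_ring S N)" for a
      using that by (intro bexI[of _ "(\<ominus>\<^bsub>S\<^esub> fst a, \<ominus>\<^bsub>N\<^esub> snd a)"]) (auto simp: N.R.l_neg N.M.l_neg)
    fix a b c assume "a \<in> carrier (square_zero_ring S N)" "b \<in> carrier (square_zero_ring S N)"
      "c \<in> carrier (square_zero_ring S N)"
    then obtain s x t y u z where [simp]: "a = (s, x)" "b = (t, y)" "c = (u, z)"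
      and *: "s \<in> carrier S" "t \<in> carrier S" "u \<in> carrier S" "x \<in> carrier N" "y \<in> carrier N" "z \<in> carrier N"
      by (cases a; cases b; cases c) auto
    show "(a \<otimes>\<^bsub>square_zero_ring S N\<^esub> b) \<otimes>\<^bsub>square_zero_ring S N\<^esub> c =
        a \<otimes>\<^bsub>square_zero_ring S N\<^esub> (b \<otimes>\<^bsub>square_zero_ring S N\<^esub> c)"
      using * by (simp add: N.R.m_ac N.M.a_ac N.smult_r_distr N.smult_assoc1[symmetric])
    show "(a \<oplus>\<^bsub>square_zero_ring S N\<^esub> b) \<otimes>\<^bsub>square_zero_ring S N\<^esub> c =
        a \<otimes>\<^bsub>square_zero_ring S N\<^esub> c \<oplus>\<^bsub>square_zero_ring S N\<^esub> b \<otimes>\<^bsub>square_zero_ring S N\<^esub> c"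
      using * by (simp add: N.R.l_distr N.M.a_ac N.smult_r_distr N.smult_l_distr)
  qed (auto simp: N.R.a_ac N.M.a_ac N.R.m_ac)
qed

lemma module_scal: "cring S \<Longrightarrow> module S (Obj scal S)"
proof -
  assume "cring S"
  then interpret S: cring S .
  show ?thesis
  proof (intro moduleI abelian_groupI)
    show "\<exists>y\<in>carrier (Obj scal S). y \<oplus>\<^bsub>Obj scal S\<^esub> x = \<zero>\<^bsub>Obj scal S\<^esub>" if "x \<in> carrier (Obj scal S)" for x
      using that S.l_neg S.a_inv_closed by auto
  qed (auto simp: S.is_cring S.a_ac S.m_assoc S.l_distr S.r_distr)
qed

section \<open>Square-zero extensions inside the universe\<close>

context base_ring
begin

text \<open>The pairs lie outside the universe type; \<open>C\<close> is a copy of the extension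
  inside it, and \<open>e\<close> names its elements by pairs.\<close>

definition square_zero :: "'u calg \<Rightarrow> ('u, 'n) module \<Rightarrow> 'u calg \<Rightarrow> ('u \<times> 'n \<Rightarrow> 'u) \<Rightarrow> bool" where
  "square_zero S N C e \<longleftrightarrow> C \<in> A \<and> bij_betw e (carrier S \<times> carrier N) (carrier C) \<and>
     \<one>\<^bsub>C\<^esub> = e (\<one>\<^bsub>S\<^esub>, \<zero>\<^bsub>N\<^esub>) \<and> (\<forall>k\<in>carrier K. smap C k = e (smap S k, \<zero>\<^bsub>N\<^esub>)) \<and>
     (\<forall>s\<in>carrier S. \<forall>x\<in>carrier N. \<forall>t\<in>carrier S. \<forall>y\<in>carrier N.
        e (s, x) \<oplus>\<^bsub>C\<^esub> e (t, y) = e (s \<oplus>\<^bsub>S\<^esub> t, x \<oplus>\<^bsub>N\<^esub> y) \<and>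
        e (s, x) \<otimes>\<^bsub>C\<^esub> e (t, y) = e (s \<otimes>\<^bsub>S\<^esub> t, s \<odot>\<^bsub>N\<^esub> y \<oplus>\<^bsub>N\<^esub> t \<odot>\<^bsub>N\<^esub> x))"

lemma square_zeroD:
  assumes "square_zero S N C e"
  shows "C \<in> A" "\<And>s x. s \<in> carrier S \<Longrightarrow> x \<in> carrier N \<Longrightarrow> e (s, x) \<in> carrier C"
    "\<And>c. c \<in> carrier C \<Longrightarrow> \<exists>s\<in>carrier S. \<exists>x\<in>carrier N. c = e (s, x)"
    "\<And>s x t y. s \<in> carrier S \<Longrightarrow> x \<in> carrier N \<Longrightarrow> t \<in> carrier S \<Longrightarrow> y \<in> carrier N \<Longrightarrow>
       e (s, x) = e (t, y) \<longleftrightarrow> s = t \<and> x = y"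
    "\<one>\<^bsub>C\<^esub> = e (\<one>\<^bsub>S\<^esub>, \<zero>\<^bsub>N\<^esub>)" "\<And>k. k \<in> carrier K \<Longrightarrow> smap C k = e (smap S k, \<zero>\<^bsub>N\<^esub>)"
    "\<And>s x t y. s \<in> carrier S \<Longrightarrow> x \<in> carrier N \<Longrightarrow> t \<in> carrier S \<Longrightarrow> y \<in> carrier N \<Longrightarrow>
       e (s, x) \<oplus>\<^bsub>C\<^esub> e (t, y) = e (s \<oplus>\<^bsub>S\<^esub> t, x \<oplus>\<^bsub>N\<^esub> y)"
    "\<And>s x t y. s \<in> carrier S \<Longrightarrow> x \<in> carrier N \<Longrightarrow> t \<in> carrier S \<Longrightarrow> y \<in> carrier N \<Longrightarrow>
       e (s, x) \<otimes>\<^bsub>C\<^esub> e (t, y) = e (s \<otimes>\<^bsub>S\<^esub> t, s \<odot>\<^bsub>N\<^esub> y \<oplus>\<^bsub>N\<^esub> t \<odot>\<^bsub>N\<^esub> x)"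
proof -
  have im: "e ` (carrier S \<times> carrier N) = carrier C"
    using assms unfolding square_zero_def bij_betw_def by blast
  show "\<exists>s\<in>carrier S. \<exists>x\<in>carrier N. c = e (s, x)" if "c \<in> carrier C" for c
    using that unfolding im[symmetric] by auto
qed (use assms in \<open>auto simp: square_zero_def bij_betw_def dest: inj_onD\<close>)

lemma square_zero_exists:
  assumes inf: "infinite (UNIV :: 'u set)" and S: "S \<in> A" and N: "module S N"
    and size: "carrier N \<lesssim> (UNIV :: 'u set)"
  shows "\<exists>C e. square_zero S N C e"
proof -
  interpret N: module S N by fact
  have "carrier S \<times> carrier N \<lesssim> (UNIV :: 'u set) \<times> (UNIV :: 'u set)"
    by (intro times_lepoll_mono size subset_imp_lepoll) simp
  also have "\<dots> \<lesssim> (UNIV :: 'u set)"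
    using infinite_times_lepoll[OF inf] by simp
  finally obtain e :: "'u \<times> _ \<Rightarrow> 'u" where e: "inj_on e (carrier (square_zero_ring S N))"
    by (auto simp: lepoll_def)
  have i: "(\<lambda>k. (smap S k, \<zero>\<^bsub>N\<^esub>)) \<in> ring_hom K (square_zero_ring S N)"
    using ring_hom_memE[OF CAlgD(2)[OF S]] by (intro ring_hom_memI) auto
  let ?C = "embed_alg e (square_zero_ring S N) (\<lambda>k\<in>carrier K. e (smap S k, \<zero>\<^bsub>N\<^esub>))"
  have "square_zero S N ?C e"
    unfolding square_zero_def
    using embed_alg_A[OF cring_square_zero[OF N] e i] e by (auto simp: bij_betw_def)
  then show ?thesis by blast
qed

lemma square_zero_incl:
  assumes C: "square_zero S N C e" and S: "S \<in> A" and N: "module S N"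
  shows "(\<lambda>s\<in>carrier S. e (s, \<zero>\<^bsub>N\<^esub>)) \<in> hm S C"
proof -
  interpret N: module S N by fact
  note D = square_zeroD[OF C]
  have "(\<lambda>s\<in>carrier S. e (s, \<zero>\<^bsub>N\<^esub>)) \<in> ring_hom S C"
    by (intro ring_hom_memI) (simp_all add: D)
  moreover have "compose (carrier K) (\<lambda>s\<in>carrier S. e (s, \<zero>\<^bsub>N\<^esub>)) (smap S) = smap C"
    using CAlgD(3)[OF D(1)] CAlgD(4)[OF S] by (auto simp: compose_def fun_eq_iff extensional_def D(6))
  ultimately show ?thesis by (simp add: alg_hom_def)
qed

text \<open>Functoriality for semilinear maps. It will carry the universal functional of a
  quasi-coherent module to an infinitesimal multiple of a given one.\<close>

lemma square_zero_map:
  assumes C: "square_zero S N C e" and S: "S \<in> A" and N: "module S N"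
    and D: "square_zero R N' D d" and R: "R \<in> A" and N': "module R N'"
    and f: "f \<in> hm S R" and \<beta>: "\<And>x. x \<in> carrier N \<Longrightarrow> \<beta> x \<in> carrier N'"
      "\<And>x y. x \<in> carrier N \<Longrightarrow> y \<in> carrier N \<Longrightarrow> \<beta> (x \<oplus>\<^bsub>N\<^esub> y) = \<beta> x \<oplus>\<^bsub>N'\<^esub> \<beta> y"
      "\<And>s x. s \<in> carrier S \<Longrightarrow> x \<in> carrier N \<Longrightarrow> \<beta> (s \<odot>\<^bsub>N\<^esub> x) = f s \<odot>\<^bsub>N'\<^esub> \<beta> x"
  shows "\<exists>h\<in>hm C D. \<forall>s\<in>carrier S. \<forall>x\<in>carrier N. h (e (s, x)) = d (f s, \<beta> x)"
proof -
  interpret N: module S N by fact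
  interpret N': module R N' by fact
  note c = square_zeroD[OF C] and D = square_zeroD[OF D] and hf = alg_homD[OF f]
  have b0: "\<beta> \<zero>\<^bsub>N\<^esub> = \<zero>\<^bsub>N'\<^esub>"
    using \<beta>(1,2)[of "\<zero>\<^bsub>N\<^esub>"] \<beta>(2)[of "\<zero>\<^bsub>N\<^esub>" "\<zero>\<^bsub>N\<^esub>"] N'.M.add.r_cancel_one'[of "\<beta> \<zero>\<^bsub>N\<^esub>" "\<beta> \<zero>\<^bsub>N\<^esub>"] by simp
  define h where "h = (\<lambda>z\<in>carrier C. let (s, x) = inv_into (carrier S \<times> carrier N) e z in d (f s, \<beta> x))"
  have bij: "bij_betw e (carrier S \<times> carrier N) (carrier C)"
    using C unfolding square_zero_def by blast
  have h: "h (e (s, x)) = d (f s, \<beta> x)" if "s \<in> carrier S" "x \<in> carrier N" for s x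
    using that bij_betw_inv_into_left[OF bij, of "(s, x)"] by (simp add: h_def c)
  have "h \<in> ring_hom C D"
  proof (rule ring_hom_memI)
    show "h z \<in> carrier D" if "z \<in> carrier C" for z
      using c(3)[OF that] by (auto simp: h D hf \<beta>)
    fix y z assume "y \<in> carrier C" "z \<in> carrier C"
    then obtain s x t u where yz: "s \<in> carrier S" "x \<in> carrier N" "y = e (s, x)"
      "t \<in> carrier S" "u \<in> carrier N" "z = e (t, u)" using c(3) by metis
    then show "h (y \<otimes>\<^bsub>C\<^esub> z) = h y \<otimes>\<^bsub>D\<^esub> h z" "h (y \<oplus>\<^bsub>C\<^esub> z) = h y \<oplus>\<^bsub>D\<^esub> h z"
      by (simp_all add: c h D hf \<beta>)
  qed (simp add: c(5) h hf b0 D(5))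
  moreover have "compose (carrier K) h (smap C) = smap D"
  proof -
    have "h (smap C k) = smap D k" if "k \<in> carrier K" for k
      using that CAlgD(4)[OF S that] by (simp add: c(6) h hf b0 D(6))
    then show ?thesis
      using CAlgD(3)[OF D(1)] by (auto simp: compose_def fun_eq_iff extensional_def)
  qed
  ultimately have "h \<in> hm C D" by (simp add: alg_hom_def h_def)
  with h show ?thesis by blast
qed

section \<open>Quasi-coherent modules are reflexive\<close>

text \<open>Componentwise inverses of a natural linear family are automatically natural and
  linear.\<close>

lemma is_isoI:
  assumes M: "linear_functor K M" and \<eta>: "\<eta> \<in> lin_trans K M N"
    and bij: "\<And>S. S \<in> A \<Longrightarrow> bij_betw (\<eta> S) (carrier (Obj M S)) (carrier (Obj N S))"
  shows "is_iso K M N \<eta>"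
proof -
  define \<theta> where "\<theta> = (\<lambda>S\<in>A. \<lambda>y\<in>carrier (Obj N S). inv_into (carrier (Obj M S)) (\<eta> S) y)"
  note M_D = linear_functorD[OF M]
  have nat: "\<eta> T (Mor M S T f x) = Mor N S T f (\<eta> S x)"
    if "S \<in> A" "T \<in> A" "f \<in> hm S T" "x \<in> carrier (Obj M S)" for S T f x
    using \<eta> that unfolding lin_trans_def nat_trans_def by simp
  have lin: "\<eta> S (x \<oplus>\<^bsub>Obj M S\<^esub> y) = \<eta> S x \<oplus>\<^bsub>Obj N S\<^esub> \<eta> S y"
    "s \<in> carrier S \<Longrightarrow> \<eta> S (s \<odot>\<^bsub>Obj M S\<^esub> x) = s \<odot>\<^bsub>Obj N S\<^esub> \<eta> S x"
    if "S \<in> A" "x \<in> carrier (Obj M S)" "y \<in> carrier (Obj M S)" for S x y s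
    using \<eta> that unfolding lin_trans_def by simp_all
  have cl: "\<eta> S x \<in> carrier (Obj N S)" if "S \<in> A" "x \<in> carrier (Obj M S)" for S x
    using lin_trans_closed[OF \<eta> that] .
  have \<theta>\<eta>: "\<theta> S (\<eta> S x) = x" if "S \<in> A" "x \<in> carrier (Obj M S)" for S x
    using that bij_betw_inv_into_left[OF bij] cl by (simp add: \<theta>_def)
  have ex: "\<exists>x\<in>carrier (Obj M S). y = \<eta> S x" if "S \<in> A" "y \<in> carrier (Obj N S)" for S y
    using bij[OF that(1)] that(2) unfolding bij_betw_def by blast
  have \<theta>_cl: "\<theta> S y \<in> carrier (Obj M S)" if "S \<in> A" "y \<in> carrier (Obj N S)" for S y
    using ex[OF that] \<theta>\<eta> that(1) by auto
  have "\<theta> \<in> lin_trans K N M"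
    unfolding lin_trans_def nat_trans_def
  proof (intro CollectI conjI ballI)
    show "\<theta> \<in> (\<Pi>\<^sub>E S\<in>A. carrier (Obj N S) \<rightarrow>\<^sub>E carrier (Obj M S))"
      by (intro PiE_I) (simp_all add: \<theta>_cl, simp_all add: \<theta>_def)
    show "\<theta> T (Mor N S T f y) = Mor M S T f (\<theta> S y)"
      if *: "S \<in> A" "T \<in> A" "f \<in> hm S T" and y: "y \<in> carrier (Obj N S)" for S T f y
      using ex[OF *(1) y] * by (auto simp: \<theta>\<eta> nat[symmetric] M_D)
    show "\<theta> S (y \<oplus>\<^bsub>Obj N S\<^esub> z) = \<theta> S y \<oplus>\<^bsub>Obj M S\<^esub> \<theta> S z"
      if S: "S \<in> A" and yz: "y \<in> carrier (Obj N S)" "z \<in> carrier (Obj N S)" for S y z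
      using ex[OF S yz(1)] ex[OF S yz(2)] S by (auto simp: \<theta>\<eta> lin(1)[symmetric] M_D)
    show "\<theta> S (s \<odot>\<^bsub>Obj N S\<^esub> y) = s \<odot>\<^bsub>Obj M S\<^esub> \<theta> S y"
      if S: "S \<in> A" and y: "y \<in> carrier (Obj N S)" and s: "s \<in> carrier S" for S y s
      using ex[OF S y] S s by (auto simp: \<theta>\<eta> lin(2)[symmetric] M_D)
  qed
  moreover have "\<eta> S (\<theta> S y) = y" if "S \<in> A" "y \<in> carrier (Obj N S)" for S y
    using ex[OF that] \<theta>\<eta> that by auto
  ultimately show ?thesis
    unfolding is_iso_def using \<eta> \<theta>\<eta> by blast
qed

lemma bidual_lin_trans:
  assumes M: "linear_functor K M"
  shows "bidual_map K M \<in> lin_trans K M (dual K (dual K M))"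
proof -
  note M_D = linear_functorD[OF M] and D_lin = linear_functor_dual[OF M]
  note DD = linear_functorD[OF linear_functor_dual[OF D_lin]] and Dl = linear_functorD[OF D_lin]
  have fam: "bidual_map K M S m = fam S (dual K M) (\<lambda>R f \<mu>. \<mu> (self R) (Mor M S R f m))"
    if "S \<in> A" "m \<in> carrier (Obj M S)" for S m
    using that by (auto simp: bidual_map_def fam_def res_eq_along intro!: restrict_ext)
  have cl: "bidual_map K M S m \<in> carrier (Obj (dual K (dual K M)) S)"
    if *: "S \<in> A" "m \<in> carrier (Obj M S)" for S m
    unfolding fam[OF *] using *
    by (intro fam_dual D_lin)
      (simp_all add: dual_self_D(1) M_D(5,7) dual_self_D(4) Mor_dual_self self_eq_along
        dual_self_D(1)[unfolded self_eq_along] dual_self_D(4)[unfolded self_eq_along])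
  show ?thesis
    unfolding lin_trans_def nat_trans_def
  proof (intro CollectI conjI ballI)
    show "bidual_map K M \<in> (\<Pi>\<^sub>E S\<in>A. carrier (Obj M S) \<rightarrow>\<^sub>E carrier (Obj (dual K (dual K M)) S))"
      by (intro PiE_I) (simp_all add: cl, simp_all add: bidual_map_def)
    show "bidual_map K M T (Mor M S T f m) = Mor (dual K (dual K M)) S T f (bidual_map K M S m)"
      if *: "S \<in> A" "T \<in> A" "f \<in> hm S T" "m \<in> carrier (Obj M S)" for S T f m
      using * by (intro dual_ext[of _ "dual K M" T])
        (auto simp: cl Mor_dual_closed bidual_map_app M_D(5,7))
    show "bidual_map K M S (m \<oplus>\<^bsub>Obj M S\<^esub> m') =
        bidual_map K M S m \<oplus>\<^bsub>Obj (dual K (dual K M)) S\<^esub> bidual_map K M S m'"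
      if *: "S \<in> A" "m \<in> carrier (Obj M S)" "m' \<in> carrier (Obj M S)" for S m m'
      using * by (intro dual_ext[of _ "dual K M" S])
        (auto simp: cl DD(1) bidual_map_app M_D(1,3,5) dual_self_D(2))
    show "bidual_map K M S (s \<odot>\<^bsub>Obj M S\<^esub> m) = s \<odot>\<^bsub>Obj (dual K (dual K M)) S\<^esub> bidual_map K M S m"
      if *: "S \<in> A" "m \<in> carrier (Obj M S)" "s \<in> carrier S" for S m s
      using * by (intro dual_ext[of _ "dual K M" S])
        (auto simp: cl DD(2) bidual_map_app M_D(2,4,5) dual_self_D(3) alg_homD)
  qed
qed

definition functional :: "('u, 'm) module \<Rightarrow> 'u calg \<Rightarrow> ('m \<Rightarrow> 'u) \<Rightarrow> 'u calg \<Rightarrow> ('m, 'u) tensor_elt \<Rightarrow> 'u" where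
  "functional M S p = fam S (qcoh K M) (\<lambda>R f. tensor_product.contract K M R (\<lambda>m. f (p m)))"

lemma functional:
  assumes M: "module K M" and S: "S \<in> A" and p: "linear_map M S p"
  shows functional_closed: "functional M S p \<in> carrier (Obj (dual K (qcoh K M)) S)"
    and functional_tens: "\<And>R f m r. R \<in> A \<Longrightarrow> f \<in> hm S R \<Longrightarrow> m \<in> carrier M \<Longrightarrow> r \<in> carrier R \<Longrightarrow>
      functional M S p (along R f) (tens K M R m r) = f (p m) \<otimes>\<^bsub>R\<^esub> r"
    and functional_self: "\<And>X. X \<in> carrier (tensor K M S) \<Longrightarrow>
      functional M S p (self S) X = tensor_product.contract K M S p X"
proof -
  interpret s: tensor_product K M S using M S by (rule tensor_productI)
  show "functional M S p \<in> carrier (Obj (dual K (qcoh K M)) S)"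
    unfolding functional_def
  proof (rule fam_dual[OF S linear_functor_qcoh[OF M]])
    fix R f X assume R: "R \<in> A" and f: "f \<in> hm S R" and X: "X \<in> carrier (Obj (qcoh K M) R)"
    interpret r: tensor_product K M R using M R by (rule tensor_productI)
    note lf = linear_map_hm[OF p f S]
    note c = r.contract[OF lf]
    show "r.contract (\<lambda>m. f (p m)) X \<in> carrier R"
      using X by (simp add: c)
    show "r.contract (\<lambda>m. f (p m)) (X \<oplus>\<^bsub>Obj (qcoh K M) R\<^esub> Y) =
        r.contract (\<lambda>m. f (p m)) X \<oplus>\<^bsub>R\<^esub> r.contract (\<lambda>m. f (p m)) Y" if "Y \<in> carrier (Obj (qcoh K M) R)" for Y
      using X that by (simp add: c)
    show "r.contract (\<lambda>m. f (p m)) (t \<odot>\<^bsub>Obj (qcoh K M) R\<^esub> X) = t \<otimes>\<^bsub>R\<^esub> r.contract (\<lambda>m. f (p m)) X"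
      if "t \<in> carrier R" for t
      using X that by (simp add: c)
    fix Q h assume Q: "Q \<in> A" and h: "h \<in> hm R Q"
    interpret q: tensor_product K M Q using M Q by (rule tensor_productI)
    have X': "tensor_map K M Q h X \<in> carrier q.T"
      using X by (simp add: tensor_hm_closed[OF M R Q h])
    have "q.contract (\<lambda>m. cmp S h f (p m)) (tensor_map K M Q h X) = q.contract (\<lambda>m. h (f (p m))) (tensor_map K M Q h X)"
      by (rule q.contract_cong[OF linear_map_hm[OF lf h R] _ X']) (use linear_mapD[OF p] in simp)
    then show "q.contract (\<lambda>m. cmp S h f (p m)) (Mor (qcoh K M) R Q h X) = h (r.contract (\<lambda>m. f (p m)) X)"
      using r.contract_hm[OF lf Q h] X by simp
  qed
  show "functional M S p (along R f) (tens K M R m r) = f (p m) \<otimes>\<^bsub>R\<^esub> r"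
    if R: "R \<in> A" and f: "f \<in> hm S R" and mr: "m \<in> carrier M" "r \<in> carrier R" for R f m r
  proof -
    interpret r: tensor_product K M R using M R by (rule tensor_productI)
    show ?thesis
      using R f mr r.contract_tens[OF linear_map_hm[OF p f S] mr] by (simp add: functional_def)
  qed
  show "functional M S p (self S) X = s.contract p X" if X: "X \<in> carrier s.T" for X
  proof -
    have "s.contract (\<lambda>m. ids S (p m)) X = s.contract p X"
      by (rule s.contract_cong[OF p _ X]) (use linear_mapD[OF p] in simp)
    then show ?thesis using S X by (simp add: functional_def self_eq_along)
  qed
qed

text \<open>Over any \<open>R\<close> the tensors are \<open>R\<close>-combinations of images of
  \<open>m \<otimes> 1\<close>, so naturality and linearity leave no further freedom.\<close>

lemma qcoh_dual_ext:
  assumes M: "module K M" and S: "S \<in> A" and \<mu>: "\<mu> \<in> carrier (Obj (dual K (qcoh K M)) S)"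
    and \<nu>: "\<nu> \<in> carrier (Obj (dual K (qcoh K M)) S)"
    and eq: "\<And>m. m \<in> carrier M \<Longrightarrow> \<mu> (self S) (tens K M S m \<one>\<^bsub>S\<^esub>) = \<nu> (self S) (tens K M S m \<one>\<^bsub>S\<^esub>)"
  shows "\<mu> = \<nu>"
proof (rule dual_ext[OF \<mu> \<nu> S])
  fix R f X assume R: "R \<in> A" and f: "f \<in> hm S R" and X: "X \<in> carrier (Obj (qcoh K M) R)"
  interpret s: tensor_product K M S using M S by (rule tensor_productI)
  interpret r: tensor_product K M R using M R by (rule tensor_productI)
  note d = dual_D[OF \<mu> S R f] dual_D[OF \<nu> S R f]
  have t: "\<kappa> (along R f) (tens K M R m r) = r \<otimes>\<^bsub>R\<^esub> f (\<kappa> (self S) (tens K M S m \<one>\<^bsub>S\<^esub>))"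
    if k: "\<kappa> \<in> carrier (Obj (dual K (qcoh K M)) S)" and mr: "m \<in> carrier M" "r \<in> carrier R" for \<kappa> m r
  proof -
    have "tens K M R m r = r \<odot>\<^bsub>r.T\<^esub> tensor_map K M R f (tens K M S m \<one>\<^bsub>S\<^esub>)"
      using mr by (simp add: tensor_hm_tens[OF M S R f] alg_homD(8)[OF f])
    then have "\<kappa> (along R f) (tens K M R m r) = r \<otimes>\<^bsub>R\<^esub> \<kappa> (along R f) (tensor_map K M R f (tens K M S m \<one>\<^bsub>S\<^esub>))"
      using dual_D(4)[OF k S R f mr(2), of "tensor_map K M R f (tens K M S m \<one>\<^bsub>S\<^esub>)"] mr
      by (simp add: tensor_hm_closed[OF M S R f])
    then show ?thesis
      using dual_self_D(4)[OF k S R f, of "tens K M S m \<one>\<^bsub>S\<^esub>"] mr by simp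
  qed
  from X[unfolded qcoh_sel] show "\<mu> (along R f) X = \<nu> (along R f) X"
    by (induction rule: r.tensor_induct) (use eq in \<open>simp_all add: t[OF \<mu>] t[OF \<nu>] d(3,7)[unfolded qcoh_sel]\<close>)
qed

text \<open>Evaluating \<open>\<Phi>\<close> at the universal functional \<open>m \<mapsto> (0, m \<otimes> 1)\<close> over the square-zero extension
  of \<open>S\<close> by \<open>M \<otimes> S\<close> yields the tensor that represents \<open>\<Phi>\<close>. Any other functional \<open>q\<close> over \<open>R\<close> is
  compared with it over the dual numbers of \<open>R\<close>, where \<open>\<epsilon> q\<close> is an image of the universal one.\<close>

lemma reflexive_qcoh:
  fixes M :: "('u, 'u) module"
  assumes inf: "infinite (UNIV :: 'u set)" and M: "module K M"
  shows "reflexive K (qcoh K M)"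
  unfolding reflexive_def
proof (rule is_isoI[OF linear_functor_qcoh[OF M] bidual_lin_trans[OF linear_functor_qcoh[OF M]]])
  fix S assume S: "S \<in> A"
  interpret s: tensor_product K M S using M S by (rule tensor_productI)
  note bid = bidual_lin_trans[OF linear_functor_qcoh[OF M]]
  obtain C e where C: "square_zero S s.T C e"
    using square_zero_exists[OF inf S s.module_T carrier_tensor_lepoll[OF inf s.tensor_product_axioms]] by blast
  note CD = square_zeroD[OF C]
  note CA = CD(1)
  interpret c: tensor_product K M C using M CA by (rule tensor_productI)
  define \<iota> where "\<iota> = (\<lambda>s\<in>carrier S. e (s, \<zero>\<^bsub>s.T\<^esub>))"
  have \<iota>: "\<iota> \<in> hm S C" unfolding \<iota>_def by (rule square_zero_incl[OF C S s.module_T])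
  define p where "p m = e (\<zero>\<^bsub>S\<^esub>, tens K M S m \<one>\<^bsub>S\<^esub>)" for m
  have p: "linear_map M C p"
    unfolding linear_map_def p_def
    by (simp add: CD s.tens_add_left s.tens_balanced)
  \<comment> \<open>Evaluating the universal functional returns the tensor itself in the second
    coordinate; this already gives injectivity of the bidual map.\<close>
  have univ: "functional M C p (self C) (tensor_map K M C \<iota> X) = e (\<zero>\<^bsub>S\<^esub>, X)" if X: "X \<in> carrier s.T" for X
  proof -
    note tm = tensor_map_hm[OF M S CA \<iota>]
    have "c.contract p (tensor_map K M C \<iota> X) = e (\<zero>\<^bsub>S\<^esub>, X)"
      using X
    proof (induction rule: s.tensor_induct)
      case (tens m t)
      then have "\<iota> t = e (t, \<zero>\<^bsub>s.T\<^esub>)" "\<iota> t \<in> carrier C" by (simp_all add: \<iota>_def CD)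
      then show ?case
        using tens by (simp add: tm c.contract_tens[OF p]) (simp add: p_def CD)
    next
      case (add X Y)
      then show ?case by (simp add: tm c.contract_add[OF p] CD)
    qed
    then show ?thesis
      using X by (simp add: functional_self[OF M CA p] tm)
  qed
  have \<mu>: "functional M C p \<in> carrier (Obj (dual K (qcoh K M)) C)"
    by (rule functional_closed[OF M CA p])
  show "bij_betw (bidual_map K (qcoh K M) S) (carrier (Obj (qcoh K M) S)) (carrier (Obj (dual K (dual K (qcoh K M))) S))"
    unfolding bij_betw_def
  proof (intro conjI)
    show "inj_on (bidual_map K (qcoh K M) S) (carrier (Obj (qcoh K M) S))"
    proof (rule inj_onI)
      fix X Y assume XY: "X \<in> carrier (Obj (qcoh K M) S)" "Y \<in> carrier (Obj (qcoh K M) S)"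
        and eq: "bidual_map K (qcoh K M) S X = bidual_map K (qcoh K M) S Y"
      have "functional M C p (self C) (tensor_map K M C \<iota> X) = functional M C p (self C) (tensor_map K M C \<iota> Y)"
        using fun_cong[OF fun_cong[OF eq, of "along C \<iota>"], of "functional M C p"]
          bidual_map_app[OF S XY(1) CA \<iota> \<mu>] bidual_map_app[OF S XY(2) CA \<iota> \<mu>] by simp
      then show "X = Y"
        using XY univ by (simp add: CD(4))
    qed
    show "bidual_map K (qcoh K M) S ` carrier (Obj (qcoh K M) S) = carrier (Obj (dual K (dual K (qcoh K M))) S)"
    proof (intro equalityI subsetI)
      fix \<Phi> assume "\<Phi> \<in> bidual_map K (qcoh K M) S ` carrier (Obj (qcoh K M) S)"
      then show "\<Phi> \<in> carrier (Obj (dual K (dual K (qcoh K M))) S)"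
        using lin_trans_closed[OF bid S] by blast
    next
      fix \<Phi> assume \<Phi>: "\<Phi> \<in> carrier (Obj (dual K (dual K (qcoh K M))) S)"
      \<comment> \<open>The coordinate \<open>a\<close> is left uncontrolled here; the representing
        tensor is \<open>X\<close>, and the comparison below is read in the second
        coordinate.\<close>
      obtain a X where aX: "a \<in> carrier S" "X \<in> carrier s.T" "\<Phi> (along C \<iota>) (functional M C p) = e (a, X)"
        using CD(3)[OF dual_D(1)[OF \<Phi> S CA \<iota> \<mu>]] by blast
      have "bidual_map K (qcoh K M) S X = \<Phi>"
      proof (rule dual_ext[OF lin_trans_closed[OF bid S] \<Phi> S])
        show "X \<in> carrier (Obj (qcoh K M) S)" using aX by simp
        fix R f \<nu> assume R: "R \<in> A" and f: "f \<in> hm S R" and \<nu>: "\<nu> \<in> carrier (Obj (dual K (qcoh K M)) R)"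
        interpret r: tensor_product K M R using M R by (rule tensor_productI)
        note mR = module_scal[OF CAlgD(1)[OF R]]
        have "carrier (Obj scal R) \<lesssim> (UNIV :: 'u set)" by (rule subset_imp_lepoll) simp
        \<comment> \<open>The dual numbers over \<open>R\<close>, with \<open>\<epsilon>\<close>
          below as the infinitesimal.\<close>
        then obtain D d where D: "square_zero R (Obj scal R) D d"
          using square_zero_exists[OF inf R mR] by blast
        note DD = square_zeroD[OF D, simplified]
        note DA = DD(1)
        define j where "j = (\<lambda>r\<in>carrier R. d (r, \<zero>\<^bsub>R\<^esub>))"
        have j: "j \<in> hm R D" unfolding j_def using square_zero_incl[OF D R mR] by simp
        define \<epsilon> where "\<epsilon> = d (\<zero>\<^bsub>R\<^esub>, \<one>\<^bsub>R\<^esub>)"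
        have \<epsilon>: "\<epsilon> \<in> carrier D" by (simp add: \<epsilon>_def DD)
        have \<epsilon>j: "\<epsilon> \<otimes>\<^bsub>D\<^esub> j r = d (\<zero>\<^bsub>R\<^esub>, r)" if "r \<in> carrier R" for r
          using that by (simp add: \<epsilon>_def j_def DD)
        note tm = tensor_map_hm[OF M S R f]
        note \<nu>self = dual_self_D(2,3,1)[OF \<nu> R, unfolded qcoh_sel]
        have sm: "tensor_map K M R f (t \<odot>\<^bsub>s.T\<^esub> x) = f t \<odot>\<^bsub>r.T\<^esub> tensor_map K M R f x"
          if "t \<in> carrier S" "x \<in> carrier s.T" for t x
          using linear_functorD(4)[OF linear_functor_qcoh[OF M] S R f] that by simp
        \<comment> \<open>The functional \<open>\<nu>\<close> on tensors is semilinear along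
          \<open>f\<close>, hence it induces a map from the universal extension to the dual
          numbers.\<close>
        have "\<exists>h\<in>hm C D. \<forall>t\<in>carrier S. \<forall>x\<in>carrier s.T. h (e (t, x)) = d (f t, \<nu> (self R) (tensor_map K M R f x))"
          by (rule square_zero_map[OF C S s.module_T D R mR f])
            (simp_all add: tm \<nu>self sm alg_homD[OF f])
        then obtain h where h: "h \<in> hm C D"
          "\<And>t x. t \<in> carrier S \<Longrightarrow> x \<in> carrier s.T \<Longrightarrow> h (e (t, x)) = d (f t, \<nu> (self R) (tensor_map K M R f x))"
          by blast
        have f0: "f \<zero>\<^bsub>S\<^esub> = \<zero>\<^bsub>R\<^esub>"
          using ring_hom_zero[OF alg_homD(1)[OF f]] cring.axioms(1) CAlgD(1)[OF S] CAlgD(1)[OF R] by blast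
        have t0: "\<nu> (self R) (tensor_map K M R f \<zero>\<^bsub>s.T\<^esub>) = \<zero>\<^bsub>R\<^esub>"
        proof -
          have "tensor_map K M R f \<zero>\<^bsub>s.T\<^esub> = \<zero>\<^bsub>r.T\<^esub>"
            using tm(3)[of "\<zero>\<^bsub>M\<^esub>" "\<zero>\<^bsub>S\<^esub>"] alg_homD(4)[OF f, of "\<zero>\<^bsub>S\<^esub>"] by simp
          then show ?thesis
            using \<nu>self(2)[of "\<zero>\<^bsub>R\<^esub>" "\<zero>\<^bsub>r.T\<^esub>"] \<nu>self(3)[of "\<zero>\<^bsub>r.T\<^esub>"] by simp
        qed
        \<comment> \<open>Both composites agree on \<open>S\<close>, so \<open>\<Phi>\<close> is
          evaluated along the same arrow whether one passes through \<open>C\<close> or through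
          \<open>R\<close>.\<close>
        have hi: "cmp S h \<iota> = cmp S j f"
          using alg_homD(4)[OF f] by (auto simp: compose_def fun_eq_iff \<iota>_def h j_def t0)
        let ?\<nu>' = "\<epsilon> \<odot>\<^bsub>Obj (dual K (qcoh K M)) D\<^esub> Mor (dual K (qcoh K M)) R D j \<nu>"
        have j\<nu>: "Mor (dual K (qcoh K M)) R D j \<nu> \<in> carrier (Obj (dual K (qcoh K M)) D)"
          by (rule Mor_dual_closed[OF \<nu> R DA j])
        note dl = linear_functorD[OF linear_functor_dual[OF linear_functor_qcoh[OF M]]]
        interpret D': tensor_product K M D using M DA by (rule tensor_productI)
        \<comment> \<open>The map \<open>h\<close> specialises the universal functional to
          \<open>\<epsilon> \<nu>\<close>; on \<open>m \<otimes> 1\<close> both have second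
          coordinate \<open>\<nu> (m \<otimes> 1)\<close> and first coordinate zero.\<close>
        have "Mor (dual K (qcoh K M)) C D h (functional M C p) = ?\<nu>'"
        proof (rule qcoh_dual_ext[OF M DA Mor_dual_closed[OF \<mu> CA DA h(1)] dl(2)[OF DA \<epsilon> j\<nu>]])
          fix m assume m: "m \<in> carrier M"
          have "Mor (dual K (qcoh K M)) C D h (functional M C p) (self D) (tens K M D m \<one>\<^bsub>D\<^esub>) = h (p m)"
            using m alg_homD(4)[OF h(1), of "p m"] linear_mapD(1)[OF p m]
            by (simp add: Mor_dual_self[OF CA DA h(1)] functional_tens[OF M CA p DA h(1)])
          also have "\<dots> = d (\<zero>\<^bsub>R\<^esub>, \<nu> (self R) (tens K M R m \<one>\<^bsub>R\<^esub>))"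
            using m by (simp add: p_def h f0 tm alg_homD(8)[OF f])
          also have "\<dots> = \<epsilon> \<otimes>\<^bsub>D\<^esub> j (\<nu> (self R) (tens K M R m \<one>\<^bsub>R\<^esub>))"
            using m by (simp add: \<epsilon>j \<nu>self(3))
          also have "j (\<nu> (self R) (tens K M R m \<one>\<^bsub>R\<^esub>)) = \<nu> (along D j) (tens K M D m \<one>\<^bsub>D\<^esub>)"
            using dual_self_D(4)[OF \<nu> R DA j, of "tens K M R m \<one>\<^bsub>R\<^esub>"] m
            by (simp add: tensor_hm_tens[OF M R DA j] alg_homD(8)[OF j])
          also have "\<epsilon> \<otimes>\<^bsub>D\<^esub> \<dots> = ?\<nu>' (self D) (tens K M D m \<one>\<^bsub>D\<^esub>)"
            using m \<epsilon> DA j by (simp add: self_eq_along)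
          finally show "Mor (dual K (qcoh K M)) C D h (functional M C p) (self D) (tens K M D m \<one>\<^bsub>D\<^esub>) =
            ?\<nu>' (self D) (tens K M D m \<one>\<^bsub>D\<^esub>)" .
        qed
        \<comment> \<open>Naturality of \<open>\<Phi>\<close> along \<open>h\<close> and then its
          linearity over the dual numbers compute the same element as an infinitesimal multiple of
          \<open>\<Phi> \<nu>\<close>.\<close>
        then have "h (e (a, X)) = \<Phi> (along D (cmp S j f)) ?\<nu>'"
          using dual_D(2)[OF \<Phi> S CA \<iota> DA h(1) \<mu>] aX hi by simp
        also have "\<dots> = \<epsilon> \<otimes>\<^bsub>D\<^esub> j (\<Phi> (along R f) \<nu>)"
          using dual_D(4)[OF \<Phi> S DA cmp_hm[OF f j S] \<epsilon> j\<nu>] dual_D(2)[OF \<Phi> S R f DA j \<nu>] by simp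
        also have "\<dots> = d (\<zero>\<^bsub>R\<^esub>, \<Phi> (along R f) \<nu>)"
          using dual_D(1)[OF \<Phi> S R f \<nu>] by (simp add: \<epsilon>j)
        finally have "d (f a, \<nu> (self R) (tensor_map K M R f X)) = d (\<zero>\<^bsub>R\<^esub>, \<Phi> (along R f) \<nu>)"
          using aX by (simp add: h)
        then have "\<nu> (self R) (tensor_map K M R f X) = \<Phi> (along R f) \<nu>"
          using aX dual_D(1)[OF \<Phi> S R f \<nu>] alg_homD(4)[OF f, of a]
          by (simp add: DD(4) \<nu>self(3) tm)
        then show "bidual_map K (qcoh K M) S X (along R f) \<nu> = \<Phi> (along R f) \<nu>"
          using bidual_map_app[OF S _ R f \<nu>, of X] aX by simp
      qed
      then show "\<Phi> \<in> bidual_map K (qcoh K M) S ` carrier (Obj (qcoh K M) S)"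
        using aX by auto
    qed
  qed
qed

end

section \<open>Quasi-coherent submodules\<close>

context tensor_product
begin

lemma tens_eq_smult: "m \<in> carrier M \<Longrightarrow> s \<in> carrier S \<Longrightarrow> tens K M S m s = s \<odot>\<^bsub>T\<^esub> tens K M S m \<one>\<^bsub>S\<^esub>"
  by simp

end

section \<open>The identification of a module with its K-points\<close>

context base_ring
begin

lemma
  assumes M: "module K M"
  shows base_incl_closed: "\<And>m. m \<in> carrier M \<Longrightarrow> base_incl K M m \<in> carrier (tensor K M (self K))"
    and base_incl_bij: "bij_betw (base_incl K M) (carrier M) (carrier (tensor K M (self K)))"
    and base_incl_add: "\<And>m m'. m \<in> carrier M \<Longrightarrow> m' \<in> carrier M \<Longrightarrow>
      base_incl K M (m \<oplus>\<^bsub>M\<^esub> m') = base_incl K M m \<oplus>\<^bsub>tensor K M (self K)\<^esub> base_incl K M m'"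
    and base_incl_smult: "\<And>k m. k \<in> carrier K \<Longrightarrow> m \<in> carrier M \<Longrightarrow>
      base_incl K M (k \<odot>\<^bsub>M\<^esub> m) = k \<odot>\<^bsub>tensor K M (self K)\<^esub> base_incl K M m"
    and base_incl_push: "\<And>S m. S \<in> A \<Longrightarrow> m \<in> carrier M \<Longrightarrow>
      tensor_map K M S (smap S) (base_incl K M m) = tens K M S m \<one>\<^bsub>S\<^esub>"
proof -
  interpret t: tensor_product K M "self K" using M self_A by (rule tensor_productI)
  show cl: "base_incl K M m \<in> carrier t.T" if "m \<in> carrier M" for m
    using that by (simp add: base_incl_def)
  show add: "base_incl K M (m \<oplus>\<^bsub>M\<^esub> m') = base_incl K M m \<oplus>\<^bsub>t.T\<^esub> base_incl K M m'"
    if "m \<in> carrier M" "m' \<in> carrier M" for m m'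
    using that by (simp add: base_incl_def t.tens_add_left)
  have bal: "base_incl K M (k \<odot>\<^bsub>M\<^esub> m) = tens K M (self K) m k" if "k \<in> carrier K" "m \<in> carrier M" for k m
    using that t.tens_balanced[of k m "\<one>\<^bsub>K\<^esub>"] by (simp add: base_incl_def)
  then show "base_incl K M (k \<odot>\<^bsub>M\<^esub> m) = k \<odot>\<^bsub>t.T\<^esub> base_incl K M m" if "k \<in> carrier K" "m \<in> carrier M" for k m
    using that t.tens_eq_smult[of m k] by (simp add: base_incl_def)
  show "tensor_map K M S (smap S) (base_incl K M m) = tens K M S m \<one>\<^bsub>S\<^esub>" if "S \<in> A" "m \<in> carrier M" for S m
    using that tensor_hm_tens[OF M self_A that(1) smap_hm[OF that(1)], of m "\<one>\<^bsub>K\<^esub>"]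
      ring_hom_one[OF CAlgD(2)[OF that(1)]] by (simp add: base_incl_def)
  \<comment> \<open>The left inverse of \<open>base_incl\<close>, induced by
    \<open>m \<otimes> s \<mapsto> s m\<close>.\<close>
  have b: "t.balanced M (\<lambda>m s. s \<odot>\<^bsub>M\<^esub> m)"
    unfolding t.balanced_def
    by (simp add: t.M.smult_r_distr t.M.smult_l_distr t.M.smult_assoc1[symmetric] t.M.R.m_comm)
  have inv: "t.lift M (\<lambda>m s. s \<odot>\<^bsub>M\<^esub> m) (base_incl K M m) = m" if "m \<in> carrier M" for m
    using that t.lift_tens[OF t.M.abelian_group_axioms b that, of "\<one>\<^bsub>K\<^esub>"] by (simp add: base_incl_def)
  have "X \<in> base_incl K M ` carrier M" if "X \<in> carrier t.T" for X
    using that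
  proof (induction rule: t.tensor_induct)
    case (tens m s)
    then show ?case using bal[of s m] by (intro image_eqI[of _ _ "s \<odot>\<^bsub>M\<^esub> m"]) auto
  next
    case (add X Y)
    then obtain m m' where "m \<in> carrier M" "m' \<in> carrier M" "X = base_incl K M m" "Y = base_incl K M m'" by blast
    then show ?case
      using \<open>\<And>m m'. \<lbrakk>m \<in> carrier M; m' \<in> carrier M\<rbrakk> \<Longrightarrow> base_incl K M (m \<oplus>\<^bsub>M\<^esub> m') = _ m m'\<close>
      by (intro image_eqI[of _ _ "m \<oplus>\<^bsub>M\<^esub> m'"]) auto
  qed
  then show "bij_betw (base_incl K M) (carrier M) (carrier t.T)"
    using cl unfolding bij_betw_def by (auto intro: inj_on_inverseI inv)
qed

end

section \<open>Quasi-coherent submodules and submodules over distributions\<close>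

locale qcoh_G_module = base_field K + G_functor K G for K :: "'u ring" and G :: "('u, 'g) mon_functor" +
  fixes M :: "('u, 'u) module" and \<rho>
  assumes inf: "infinite (UNIV :: 'u set)" and module_M: "module K M" and refl: "reflexive K AG"
    and rho: "\<rho> \<in> monoid_trans K G (END K (qcoh K M))"
begin

sublocale M: module K M by (rule module_M)

sublocale q: reflexive_G_module K G "qcoh K M" \<rho>
  by unfold_locales (rule linear_functor_qcoh[OF module_M] rho reflexive_qcoh[OF inf module_M])+

lemma vector_tensor_M: "S \<in> A \<Longrightarrow> vector_tensor K M S"
  by (simp add: vector_tensor_def tensor_productI module_M base_field_axioms)

abbreviation "\<kappa> \<equiv> self K"

interpretation t: vector_tensor K M \<kappa> by (rule vector_tensor_M) simp

lemmas bi = base_incl_closed[OF module_M] base_incl_bij[OF module_M] base_incl_add[OF module_M]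
  base_incl_smult[OF module_M]
lemmas push = base_incl_push[OF module_M]

abbreviation bact where "bact \<equiv> base_act K M (act (extension K G (qcoh K M) \<rho>) \<kappa>)"

lemma bact:
  assumes "w \<in> carrier (Obj Dist \<kappa>)" "m \<in> carrier M"
  shows "bact w m \<in> carrier M" "base_incl K M (bact w m) = q.alpha \<kappa> w (base_incl K M m)"
proof -
  have "q.alpha \<kappa> w (base_incl K M m) \<in> carrier t.T"
    using q.alpha_closed[OF self_A assms(1)] bi(1)[OF assms(2)] by simp
  moreover have "bact w m = inv_into (carrier M) (base_incl K M) (q.alpha \<kappa> w (base_incl K M m))"
    using q.act_extension[OF refl self_A assms(1)] bi(1)[OF assms(2)] by (simp add: base_act_def)
  ultimately show "bact w m \<in> carrier M" "base_incl K M (bact w m) = q.alpha \<kappa> w (base_incl K M m)"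
    using bi(2) by (simp_all add: bij_betw_def inv_into_into f_inv_into_f)
qed

lemma base_incl_inj: "m \<in> carrier M \<Longrightarrow> m' \<in> carrier M \<Longrightarrow> base_incl K M m = base_incl K M m' \<Longrightarrow> m = m'"
  using bi(2) by (auto simp: bij_betw_def dest: inj_onD)

text \<open>The function \<open>g \<mapsto> \<omega> (g m)\<close> over \<open>K\<close>. Both
  notions of stability are expressed by its vanishing for functionals \<open>\<omega>\<close> that
  kill the submodule.\<close>

definition mcoef where
  "mcoef \<omega> m = q.coef \<kappa> (functional M \<kappa> \<omega>) (base_incl K M m)"

text \<open>Evaluation at \<open>g\<close> tests whether \<open>g (m \<otimes> 1)\<close> is in the
  image of \<open>N \<otimes> S\<close>, and pairing with \<open>w\<close> tests whether
  \<open>w m\<close> is in \<open>N\<close>, when \<open>\<omega>\<close> ranges over the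
  functionals that kill \<open>N\<close>.\<close>

lemma mcoef:
  assumes \<omega>: "linear_map M \<kappa> \<omega>" and m: "m \<in> carrier M"
  shows mcoef_closed: "mcoef \<omega> m \<in> carrier (Obj AG \<kappa>)"
    and mcoef_app: "\<And>S g. S \<in> A \<Longrightarrow> g \<in> carrier (Obj G S) \<Longrightarrow> mcoef \<omega> m (along S (smap S)) g =
      tensor_product.contract K M S (\<lambda>m. smap S (\<omega> m)) (act \<rho> S g (tens K M S m \<one>\<^bsub>S\<^esub>))"
    and mcoef_dist: "\<And>w. w \<in> carrier (Obj Dist \<kappa>) \<Longrightarrow> w \<kappa> (mcoef \<omega> m) = \<omega> (bact w m)"
proof -
  note f = functional[OF module_M self_A \<omega>]
  have m': "base_incl K M m \<in> carrier (Obj (qcoh K M) \<kappa>)" using bi(1)[OF m] by simp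
  show "mcoef \<omega> m \<in> carrier (Obj AG \<kappa>)"
    unfolding mcoef_def by (rule q.coef_closed[OF self_A f(1) m'])
  show "mcoef \<omega> m (along S (smap S)) g =
      tensor_product.contract K M S (\<lambda>m. smap S (\<omega> m)) (act \<rho> S g (tens K M S m \<one>\<^bsub>S\<^esub>))"
    if S: "S \<in> A" and g: "g \<in> carrier (Obj G S)" for S g
  proof -
    interpret s: vector_tensor K M S using S by (rule vector_tensor_M)
    have x: "act \<rho> S g (tens K M S m \<one>\<^bsub>S\<^esub>) \<in> carrier (Obj (qcoh K M) S)"
      using m by (intro q.act_closed S g) simp
    have "mcoef \<omega> m (along S (smap S)) g = functional M \<kappa> \<omega> (along S (smap S)) (act \<rho> S g (tens K M S m \<one>\<^bsub>S\<^esub>))"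
      unfolding mcoef_def using q.coef_app[OF S smap_hm[OF S] g, of "functional M \<kappa> \<omega>" "base_incl K M m"] S m
      by (simp add: push del: along_smap)
    also have "\<dots> = s.contract (\<lambda>m. smap S (\<omega> m)) (act \<rho> S g (tens K M S m \<one>\<^bsub>S\<^esub>))"
      unfolding functional_def by (rule fam_app[OF S smap_hm[OF S] x])
    finally show ?thesis .
  qed
  show "w \<kappa> (mcoef \<omega> m) = \<omega> (bact w m)" if w: "w \<in> carrier (Obj Dist \<kappa>)" for w
  proof -
    note b = bact[OF w m]
    have "w \<kappa> (mcoef \<omega> m) = functional M \<kappa> \<omega> (self \<kappa>) (q.alpha \<kappa> w (base_incl K M m))"
      using q.alpha_self[OF self_A w m' f(1)] by (simp add: mcoef_def self_def)
    also have "\<dots> = t.contract \<omega> (base_incl K M (bact w m))"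
      unfolding b(2)[symmetric] by (rule f(3)) (rule bi(1)[OF b(1)])
    also have "\<dots> = \<omega> (bact w m)"
      using b(1) linear_mapD(1)[OF \<omega> b(1)] by (simp add: base_incl_def t.contract_tens[OF \<omega>])
    finally show ?thesis .
  qed
qed

text \<open>\<open>linear_functor\<close> speaks of sums and scalar multiples only, so the zero
  function is represented as zero times a coefficient.\<close>

lemma zero_mcoef:
  assumes "linear_map M \<kappa> \<omega>" "m \<in> carrier M"
  defines "Z \<equiv> \<zero>\<^bsub>K\<^esub> \<odot>\<^bsub>Obj AG \<kappa>\<^esub> mcoef \<omega> m"
  shows "Z \<in> carrier (Obj AG \<kappa>)" "\<And>w. w \<in> carrier (Obj Dist \<kappa>) \<Longrightarrow> w \<kappa> Z = \<zero>\<^bsub>K\<^esub>"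
    "\<And>S g. S \<in> A \<Longrightarrow> g \<in> carrier (Obj G S) \<Longrightarrow> Z (along S (smap S)) g = \<zero>\<^bsub>S\<^esub>"
proof -
  note c = mcoef_closed[OF assms(1,2)]
  show "Z \<in> carrier (Obj AG \<kappa>)"
    unfolding Z_def by (rule AG_D(2)[OF self_A _ c]) simp
  have k: "self \<kappa> = \<kappa>" by (simp add: self_def)
  show "w \<kappa> Z = \<zero>\<^bsub>K\<^esub>" if "w \<in> carrier (Obj Dist \<kappa>)" for w
    unfolding Z_def using dual_self_D(1,3)[OF that self_A, unfolded k] c by simp
  show "Z (along S (smap S)) g = \<zero>\<^bsub>S\<^esub>" if S: "S \<in> A" "g \<in> carrier (Obj G S)" for S g
  proof -
    interpret s: vector_tensor K M S using S(1) by (rule vector_tensor_M)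
    have "mcoef \<omega> m (along S (smap S)) g \<in> carrier S"
      by (rule FUN_D(1)[OF c self_A S(1) smap_hm[OF S(1)] S(2)])
    then show ?thesis
      unfolding Z_def using FUN_ops(2)[OF S(1) smap_hm[OF S(1)] S(2)] by (simp add: s.smap_simps del: along_smap)
  qed
qed

text \<open>\<open>act_submodules\<close> asks for additive subgroups only, but the scalar
  \<open>k\<close> acts as the distribution \<open>k\<close> times the Dirac distribution at the
  unit.\<close>

lemma SUB_submodule:
  assumes "N \<in> act_submodules (Obj (dist_algebra K G) \<kappa>) M bact"
  shows "submodule N K M"
proof -
  have N: "subgroup N (add_monoid M)" "\<And>w n. w \<in> carrier (Obj Dist \<kappa>) \<Longrightarrow> n \<in> N \<Longrightarrow> bact w n \<in> N"
    using assms by (auto simp: act_submodules_def)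
  have sub: "n \<in> carrier M" if "n \<in> N" for n
    using subgroup.mem_carrier[OF N(1) that] by simp
  have "k \<odot>\<^bsub>M\<^esub> n \<in> N" if k: "k \<in> carrier K" and n: "n \<in> N" for k n
  proof -
    let ?d = "dirac K G \<kappa> \<one>\<^bsub>Obj G \<kappa>\<^esub>"
    have d: "?d \<in> carrier (Obj Dist \<kappa>)" by (rule dirac_closed[OF self_A G_one_closed[OF self_A]])
    have b: "base_incl K M n \<in> carrier (Obj (qcoh K M) \<kappa>)" using bi(1)[OF sub[OF n]] by simp
    have kd: "k \<odot>\<^bsub>Obj Dist \<kappa>\<^esub> ?d \<in> carrier (Obj Dist \<kappa>)" by (rule Dist_D(2)[OF self_A _ d]) (use k in simp)
    have "q.alpha \<kappa> (k \<odot>\<^bsub>Obj Dist \<kappa>\<^esub> ?d) (base_incl K M n) = k \<odot>\<^bsub>t.T\<^esub> base_incl K M n"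
      using q.alpha_linear(4)[OF self_A d b, of k] k
        q.alpha_dirac[OF self_A G_one_closed[OF self_A] b] q.act_one[OF self_A b] by simp
    then have "base_incl K M (bact (k \<odot>\<^bsub>Obj Dist \<kappa>\<^esub> ?d) n) = base_incl K M (k \<odot>\<^bsub>M\<^esub> n)"
      using bact(2)[OF kd sub[OF n]] bi(4)[OF k sub[OF n]] by simp
    then have "bact (k \<odot>\<^bsub>Obj Dist \<kappa>\<^esub> ?d) n = k \<odot>\<^bsub>M\<^esub> n"
      using bact(1)[OF kd sub[OF n]] k sub[OF n] by (intro base_incl_inj) auto
    then show ?thesis using N(2)[OF kd n] by simp
  qed
  then show ?thesis
    using N(1) by (simp add: submodule_def submodule_axioms_def)
qed

text \<open>Over \<open>K\<close> the tensor \<open>m \<otimes> s\<close> equals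
  \<open>s m \<otimes> 1\<close>, so the image of \<open>N \<otimes> K\<close> consists of the
  points \<open>n \<otimes> 1\<close>.\<close>

lemma base_points_qcoh_sub:
  assumes N: "submodule N K M"
  shows "base_points K M (qcoh_sub K M N) = N"
proof
  note D = M.submoduleD[OF N]
  show "N \<subseteq> base_points K M (qcoh_sub K M N)"
    using t.qcoh_sub_tens[OF N] D(1) by (auto simp: base_points_def base_incl_def)
  have "X \<in> base_incl K M ` N" if "X \<in> qcoh_sub K M N \<kappa>" for X
    using that
  proof (induction rule: t.qcoh_sub_induct[OF N, consumes 1])
    case (1 m s)
    then have sm: "s \<in> carrier K" "m \<in> carrier M" using D(1) by auto
    have "tens K M \<kappa> m s = base_incl K M (s \<odot>\<^bsub>M\<^esub> m)"
      unfolding bi(4)[OF sm] unfolding base_incl_def using sm by simp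
    then show ?case using 1 D(5)[of s m] by simp
  next
    case (2 X Y)
    then show ?case using D(1,4) bi(3)[symmetric] by (auto intro!: imageI)
  qed
  note in_image = this
  show "base_points K M (qcoh_sub K M N) \<subseteq> N"
  proof
    fix m assume "m \<in> base_points K M (qcoh_sub K M N)"
    then have m: "m \<in> carrier M" "base_incl K M m \<in> qcoh_sub K M N \<kappa>"
      by (auto simp: base_points_def)
    obtain n where n: "n \<in> N" "base_incl K M m = base_incl K M n"
      using in_image[OF m(2)] by (rule imageE)
    then show "m \<in> N" using base_incl_inj[OF m(1) D(1)[OF n(1)] n(2)] by simp
  qed
qed

text \<open>Provides the module required by quasi-coherence: \<open>N\<close> itself. Bijectivity
  onto the image is \<open>incl_inj\<close>, hence flatness.\<close>

lemma qcoh_sub_iso: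
  assumes N: "submodule N K M"
  shows "is_iso K (qcoh K (M\<lparr>carrier := N\<rparr>)) (subfunctor (qcoh K M) (qcoh_sub K M N))
    (\<lambda>S\<in>A. \<lambda>X\<in>carrier (tensor K (M\<lparr>carrier := N\<rparr>) S). tensor_product.incl K M S N X)"
proof -
  let ?P = "M\<lparr>carrier := N\<rparr>"
  let ?Q = "subfunctor (qcoh K M) (qcoh_sub K M N)"
  let ?\<eta> = "\<lambda>S\<in>A. \<lambda>X\<in>carrier (tensor K ?P S). tensor_product.incl K M S N X"
  have P: "module K ?P" using t.module_N[OF N] .
  show ?thesis
  proof (rule is_isoI[OF linear_functor_qcoh[OF P]])
    show "?\<eta>
      \<in> lin_trans K (qcoh K ?P) ?Q"
      unfolding lin_trans_def nat_trans_def
    proof (intro CollectI conjI ballI)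
      show "?\<eta>
        \<in> (\<Pi>\<^sub>E S\<in>A. carrier (Obj (qcoh K ?P) S) \<rightarrow>\<^sub>E carrier (Obj ?Q S))"
        by (intro PiE_I) (auto simp: subfunctor_def tensor_product.qcoh_sub_eq[OF tensor_productI[OF module_M] N])
    next
      fix S X assume S: "S \<in> A" and X: "X \<in> carrier (Obj (qcoh K ?P) S)"
      interpret s: vector_tensor K M S using S by (rule vector_tensor_M)
      interpret n: tensor_product K ?P S using P S by (rule tensor_productI)
      note i = s.incl[OF N]
      show "?\<eta> S (X \<oplus>\<^bsub>Obj (qcoh K ?P) S\<^esub> Y) =
         ?\<eta> S X
         \<oplus>\<^bsub>Obj ?Q S\<^esub>
         ?\<eta> S Y"
        if "Y \<in> carrier (Obj (qcoh K ?P) S)" for Y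
        using S X that by (simp add: subfunctor_def i)
      show "?\<eta> S (r \<odot>\<^bsub>Obj (qcoh K ?P) S\<^esub> X) =
         r \<odot>\<^bsub>Obj ?Q S\<^esub>
         ?\<eta> S X"
        if "r \<in> carrier S" for r
        using S X that by (simp add: subfunctor_def s.incl_smult[OF N])
      fix R f assume R: "R \<in> A" and f: "f \<in> hm S R"
      interpret r: vector_tensor K M R using R by (rule vector_tensor_M)
      interpret rn: tensor_product K ?P R using P R by (rule tensor_productI)
      note tP = tensor_map_hm[OF P S R f] and tM = tensor_map_hm[OF module_M S R f]
      from X[unfolded qcoh_sel] have "r.incl N (tensor_map K ?P R f X) = tensor_map K M R f (s.incl N X)"
      proof (induction rule: n.tensor_induct)
        case (tens m x)
        then show ?case
          using alg_homD(4)[OF f] M.submoduleD(1)[OF N]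
          by (simp add: tP(3) tM(3) i(2) r.incl(2)[OF N])
      qed (simp add: tP tM i r.incl[OF N])
      then show "?\<eta> R (Mor (qcoh K ?P) S R f X) =
         Mor ?Q S R f
         (?\<eta> S X)"
        using S R X by (simp add: subfunctor_def tP(1))
    qed
    fix S assume S: "S \<in> A"
    interpret s: vector_tensor K M S using S by (rule vector_tensor_M)
    have "bij_betw (s.incl N) (carrier (tensor K ?P S)) (qcoh_sub K M N S)"
      unfolding bij_betw_def using s.incl_inj[OF N] s.qcoh_sub_eq[OF N] by simp
    moreover have "bij_betw (restrict (s.incl N) (carrier (tensor K ?P S))) (carrier (tensor K ?P S)) B \<longleftrightarrow>
        bij_betw (s.incl N) (carrier (tensor K ?P S)) B" for B
      by (rule bij_betw_cong) simp
    moreover have "carrier (Obj ?Q S) = qcoh_sub K M N S"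
      by (simp add: subfunctor_def)
    ultimately show "bij_betw (?\<eta> S)
       (carrier (Obj (qcoh K ?P) S)) (carrier (Obj ?Q S))"
      unfolding qcoh_sel(1) restrict_apply'[OF S] by (simp only:)
  qed
qed

text \<open>If \<open>\<omega>\<close> kills \<open>N\<close>, then \<open>mcoef \<omega> n\<close>
  pairs to zero with every distribution over \<open>K\<close>, because \<open>w n\<close> stays in
  \<open>N\<close>. Separation makes it vanish at every \<open>g\<close>, and
  \<open>vanishing_imp_qcoh_sub\<close> puts \<open>g (n \<otimes> 1)\<close> into the image of
  \<open>N \<otimes> S\<close>.\<close>

lemma qcoh_sub_in_QC:
  assumes SUB: "N \<in> act_submodules (Obj (dist_algebra K G) \<kappa>) M bact"
  shows "qcoh_sub K M N \<in> qcoh_G_submodules K G (qcoh K M) \<rho>"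
proof -
  have N: "submodule N K M" by (rule SUB_submodule[OF SUB])
  note D = M.submoduleD[OF N]
  have stable: "bact w n \<in> N" if "w \<in> carrier (Obj Dist \<kappa>)" "n \<in> N" for w n
    using SUB that by (auto simp: act_submodules_def)
  have gen: "act \<rho> S g (tens K M S n \<one>\<^bsub>S\<^esub>) \<in> qcoh_sub K M N S"
    if S: "S \<in> A" and g: "g \<in> carrier (Obj G S)" and n: "n \<in> N" for S g n
  proof -
    interpret s: vector_tensor K M S using S by (rule vector_tensor_M)
    show ?thesis
    proof (rule s.vanishing_imp_qcoh_sub[OF N])
      show "act \<rho> S g (tens K M S n \<one>\<^bsub>S\<^esub>) \<in> carrier s.T"
        using q.act_closed[OF S g, of "tens K M S n \<one>\<^bsub>S\<^esub>"] D(1)[OF n] by simp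
      show "s.vanishing N (act \<rho> S g (tens K M S n \<one>\<^bsub>S\<^esub>))"
      proof (intro allI impI)
        fix \<omega> assume \<omega>: "linear_map M \<kappa> \<omega>" "\<forall>n\<in>N. \<omega> n = \<zero>\<^bsub>K\<^esub>"
        note F = mcoef[OF \<omega>(1) D(1)[OF n]] and Z = zero_mcoef[OF \<omega>(1) D(1)[OF n]]
        have "dirac K G S g (self S) (Mor AG \<kappa> S (smap S) (mcoef \<omega> n)) =
           dirac K G S g (self S) (Mor AG \<kappa> S (smap S) (\<zero>\<^bsub>K\<^esub> \<odot>\<^bsub>Obj AG \<kappa>\<^esub> mcoef \<omega> n))"
        proof (rule dual_base_points_separate[OF inf AG_linear self_A F(1) Z(1) _ S smap_hm[OF S] dirac_closed[OF S g]])
          fix w assume w: "w \<in> carrier (Obj Dist \<kappa>)"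
          show "w \<kappa> (mcoef \<omega> n) = w \<kappa> (\<zero>\<^bsub>K\<^esub> \<odot>\<^bsub>Obj AG \<kappa>\<^esub> mcoef \<omega> n)"
            unfolding F(3)[OF w] Z(2)[OF w] using \<omega>(2) stable[OF w n] by blast
        qed
        moreover have "dirac K G S g (self S) (Mor AG \<kappa> S (smap S) H) = H (along S (smap S)) g"
          if "H \<in> carrier (Obj AG \<kappa>)" for H
          using S g that Mor_FUN_closed[OF that self_A S smap_hm[OF S]]
            Mor_FUN[OF S ids_hm[OF S], of G \<kappa> "smap S" H] cmp_ids(1)[OF smap_hm[OF S]]
          by (simp add: self_eq_along[of S] G_D(2))
        ultimately show "s.contract (\<lambda>m. smap S (\<omega> m)) (act \<rho> S g (tens K M S n \<one>\<^bsub>S\<^esub>)) = \<zero>\<^bsub>S\<^esub>"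
          using F(1) Z(1) F(2)[OF S g] Z(3)[OF S g] by simp
      qed
    qed
  qed
  \<comment> \<open>The image of \<open>N \<otimes> S\<close> is spanned over \<open>S\<close> by
    the tensors \<open>n \<otimes> 1\<close>, and \<open>g\<close> acts linearly over
    \<open>S\<close>.\<close>
  have act: "act \<rho> S g X \<in> qcoh_sub K M N S"
    if S: "S \<in> A" and g: "g \<in> carrier (Obj G S)" and X: "X \<in> qcoh_sub K M N S" for S g X
  proof -
    interpret s: vector_tensor K M S using S by (rule vector_tensor_M)
    note sub = subsetD[OF s.qcoh_sub_carrier[OF N]]
    from X show ?thesis
    proof (induction rule: s.qcoh_sub_induct[OF N, consumes 1])
      case (1 n r)
      have "act \<rho> S g (tens K M S n r) = r \<odot>\<^bsub>s.T\<^esub> act \<rho> S g (tens K M S n \<one>\<^bsub>S\<^esub>)"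
        using q.act_smult[OF S g, of r "tens K M S n \<one>\<^bsub>S\<^esub>"] 1 D(1) by simp
      then show ?case
        using submodule.smult_closed[OF s.qcoh_sub_submodule[OF N] 1(2) gen[OF S g 1(1)]] by simp
    next
      case (2 X Y)
      then show ?case
        using q.act_add[OF S g, of X Y] sub s.qcoh_sub_add[OF N] by simp
    qed
  qed
  have mor: "tensor_map K M R f X \<in> qcoh_sub K M N R"
    if S: "S \<in> A" and R: "R \<in> A" and f: "f \<in> hm S R" and X: "X \<in> qcoh_sub K M N S" for S R f X
  proof -
    interpret s: vector_tensor K M S using S by (rule vector_tensor_M)
    interpret r: vector_tensor K M R using R by (rule vector_tensor_M)
    note tm = tensor_map_hm[OF module_M S R f]
    from X show ?thesis
      by (induction rule: s.qcoh_sub_induct[OF N, consumes 1])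
        (use subsetD[OF s.qcoh_sub_carrier[OF N]] D(1) alg_homD(4)[OF f] in
          \<open>simp_all add: tm r.qcoh_sub_tens[OF N] r.qcoh_sub_add[OF N]\<close>)
  qed
  have "submodule (qcoh_sub K M N S) S (tensor K M S)" if "S \<in> A" for S
    using tensor_product.qcoh_sub_submodule[OF tensor_productI[OF module_M that] N] .
  moreover have "qcoh_sub K M N \<in> extensional A" by (simp add: qcoh_sub_def)
  ultimately have "qcoh_sub K M N \<in> submodule_functors K (qcoh K M)"
    unfolding submodule_functors_def by (auto intro: mor)
  then show ?thesis
    unfolding qcoh_G_submodules_def using act qcoh_sub_iso[OF N] t.module_N[OF N] by blast
qed

lemma QC_D:
  assumes "N \<in> qcoh_G_submodules K G (qcoh K M) \<rho>"
  shows "N \<in> extensional A" "\<And>S. S \<in> A \<Longrightarrow> submodule (N S) S (tensor K M S)"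
    "\<And>S R f X. S \<in> A \<Longrightarrow> R \<in> A \<Longrightarrow> f \<in> hm S R \<Longrightarrow> X \<in> N S \<Longrightarrow> tensor_map K M R f X \<in> N R"
    "\<And>S g X. S \<in> A \<Longrightarrow> g \<in> carrier (Obj G S) \<Longrightarrow> X \<in> N S \<Longrightarrow> act \<rho> S g X \<in> N S"
    "\<exists>(P :: ('u, 'u) module) \<eta>. module K P \<and> is_iso K (qcoh K P) (subfunctor (qcoh K M) N) \<eta>"
  using assms unfolding qcoh_G_submodules_def submodule_functors_def by (auto simp: image_subset_iff)

lemma base_points_submodule:
  assumes QC: "N \<in> qcoh_G_submodules K G (qcoh K M) \<rho>"
  shows "submodule (base_points K M N) K M"
proof -
  have N: "submodule (N \<kappa>) \<kappa> t.T" by (rule QC_D(2)[OF QC self_A])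
  note D = t.T.submoduleD[OF N]
  have zero: "base_incl K M \<zero>\<^bsub>M\<^esub> = \<zero>\<^bsub>t.T\<^esub>" by (simp add: base_incl_def)
  have neg: "\<ominus>\<^bsub>M\<^esub> m = (\<ominus>\<^bsub>K\<^esub> \<one>\<^bsub>K\<^esub>) \<odot>\<^bsub>M\<^esub> m" if "m \<in> carrier M" for m
    using that by (simp add: M.smult_l_minus)
  show ?thesis
    by (rule M.submoduleI) (use D in \<open>auto simp: base_points_def zero bi neg\<close>)
qed

text \<open>A functor isomorphic to \<open>qcoh K P\<close> is generated over every \<open>S\<close>
  by its \<open>K\<close>-points, and the isomorphism carries \<open>K\<close>-points to
  \<open>K\<close>-points. Hence \<open>N(K)\<close> determines \<open>N\<close>.\<close>

lemma QC_eq_qcoh_sub: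
  assumes QC: "N \<in> qcoh_G_submodules K G (qcoh K M) \<rho>"
  shows "qcoh_sub K M (base_points K M N) = N"
proof (rule extensionalityI)
  let ?N = "base_points K M N"
  show "qcoh_sub K M ?N \<in> extensional A" by (simp add: qcoh_sub_def)
  show "N \<in> extensional A" by (rule QC_D(1)[OF QC])
  fix S assume S: "S \<in> A"
  interpret s: vector_tensor K M S using S by (rule vector_tensor_M)
  have N0: "submodule ?N K M" by (rule base_points_submodule[OF QC])
  note D = s.T.submoduleD[OF QC_D(2)[OF QC S]]
  have pts: "n \<in> carrier M" "base_incl K M n \<in> N \<kappa>" if "n \<in> ?N" for n
    using that by (auto simp: base_points_def)
  show "qcoh_sub K M ?N S = N S"
  proof (intro equalityI subsetI)
    fix X assume "X \<in> qcoh_sub K M ?N S"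
    then show "X \<in> N S"
    proof (induction rule: s.qcoh_sub_induct[OF N0, consumes 1])
      case (1 n r)
      have "tens K M S n \<one>\<^bsub>S\<^esub> \<in> N S"
        using QC_D(3)[OF QC self_A S smap_hm[OF S] pts(2)[OF 1(1)]] push[OF S pts(1)[OF 1(1)]] by simp
      then show ?case
        using D(5)[OF 1(2)] s.tens_eq_smult[OF pts(1)[OF 1(1)] 1(2)] by simp
    qed (rule D(4))
  next
    fix X assume X: "X \<in> N S"
    obtain P :: "('u, 'u) module" and \<eta> where P: "module K P"
      and iso: "is_iso K (qcoh K P) (subfunctor (qcoh K M) N) \<eta>"
      using QC_D(5)[OF QC] by blast
    have \<eta>: "\<eta> \<in> lin_trans K (qcoh K P) (subfunctor (qcoh K M) N)"
      using iso unfolding is_iso_def by blast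
    have \<eta>_cl: "\<eta> R Y \<in> N R" if "R \<in> A" "Y \<in> carrier (tensor K P R)" for R Y
      using lin_trans_closed[OF \<eta>, of R Y] that by (simp add: subfunctor_def)
    have \<eta>_add: "\<eta> S (Y \<oplus>\<^bsub>tensor K P S\<^esub> Z) = \<eta> S Y \<oplus>\<^bsub>s.T\<^esub> \<eta> S Z"
      if "Y \<in> carrier (tensor K P S)" "Z \<in> carrier (tensor K P S)" for Y Z
      using \<eta> S that unfolding lin_trans_def by (simp add: subfunctor_def)
    have \<eta>_smult: "\<eta> S (r \<odot>\<^bsub>tensor K P S\<^esub> Y) = r \<odot>\<^bsub>s.T\<^esub> \<eta> S Y"
      if "Y \<in> carrier (tensor K P S)" "r \<in> carrier S" for Y r
      using \<eta> S that unfolding lin_trans_def by (simp add: subfunctor_def)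
    have \<eta>_nat: "\<eta> S (tensor_map K P S (smap S) Y) = tensor_map K M S (smap S) (\<eta> \<kappa> Y)"
      if "Y \<in> carrier (tensor K P \<kappa>)" for Y
    proof -
      have "\<eta> S (Mor (qcoh K P) \<kappa> S (smap S) Y) = Mor (subfunctor (qcoh K M) N) \<kappa> S (smap S) (\<eta> \<kappa> Y)"
        using \<eta> S that smap_hm[OF S] self_A unfolding lin_trans_def nat_trans_def qcoh_sel(1)[symmetric] by blast
      then show ?thesis by (simp add: subfunctor_def)
    qed
    obtain Y where Y: "Y \<in> carrier (tensor K P S)" "X = \<eta> S Y"
    proof -
      obtain \<theta> where \<theta>: "\<theta> \<in> lin_trans K (subfunctor (qcoh K M) N) (qcoh K P)"
        "\<forall>S\<in>A. (\<forall>x\<in>carrier (Obj (qcoh K P) S). \<theta> S (\<eta> S x) = x) \<and>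
          (\<forall>y\<in>carrier (Obj (subfunctor (qcoh K M) N) S). \<eta> S (\<theta> S y) = y)"
        using iso unfolding is_iso_def by blast
      have X': "X \<in> carrier (Obj (subfunctor (qcoh K M) N) S)" using X by (simp add: subfunctor_def)
      show thesis
        using that[of "\<theta> S X"] \<theta>(2) S X' lin_trans_closed[OF \<theta>(1) S X'] by simp
    qed
    interpret p: tensor_product K P S using P S by (rule tensor_productI)
    from Y(1) have "\<eta> S Y \<in> qcoh_sub K M ?N S"
    proof (induction rule: p.tensor_induct)
      case (tens m r)
      have b: "base_incl K P m \<in> carrier (tensor K P \<kappa>)" by (rule base_incl_closed[OF P tens(1)])
      have "\<eta> \<kappa> (base_incl K P m) \<in> N \<kappa>" by (rule \<eta>_cl[OF self_A b])
      moreover have "N \<kappa> \<subseteq> carrier t.T"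
        using t.T.submoduleD(1)[OF QC_D(2)[OF QC self_A]] by blast
      \<comment> \<open>The generator \<open>m\<close> of \<open>P\<close> corresponds to a point of
        \<open>N\<close> over \<open>K\<close>, and thereby to a vector \<open>n\<close> of
        \<open>M\<close>.\<close>
      ultimately obtain n where n: "n \<in> carrier M" "\<eta> \<kappa> (base_incl K P m) = base_incl K M n"
        using bi(2) unfolding bij_betw_def by blast
      have n': "n \<in> ?N"
        using \<eta>_cl[OF self_A b] n by (simp add: base_points_def)
      have "tens K P S m r = r \<odot>\<^bsub>p.T\<^esub> tensor_map K P S (smap S) (base_incl K P m)"
        using tens by (simp add: base_incl_push[OF P S])
      then have "\<eta> S (tens K P S m r) = tens K M S n r"
        using tens S n b by (simp add: \<eta>_smult \<eta>_nat push base_incl_push[OF P S, symmetric] tensor_hm_closed[OF P self_A S smap_hm[OF S]])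
      then show ?case
        using s.qcoh_sub_tens[OF N0 n' tens(2)] by simp
    qed (simp add: \<eta>_add s.qcoh_sub_add[OF N0])
    then show "X \<in> qcoh_sub K M ?N S" using Y by simp
  qed
qed

text \<open>Otherwise some \<open>\<omega>\<close> kills \<open>N(K)\<close> but has value 1 at
  \<open>w n\<close>. Stability under \<open>G\<close> makes \<open>mcoef \<omega> n\<close> vanish
  at every \<open>g\<close>, so its pairing with \<open>w\<close>, which is
  \<open>\<omega> (w n)\<close>, is zero.\<close>

lemma base_points_in_SUB:
  assumes QC: "N \<in> qcoh_G_submodules K G (qcoh K M) \<rho>"
  shows "base_points K M N \<in> act_submodules (Obj (dist_algebra K G) \<kappa>) M bact"
proof -
  let ?N = "base_points K M N"
  have N0: "submodule ?N K M" by (rule base_points_submodule[OF QC])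
  note D = M.submoduleD[OF N0]
  have "bact w n \<in> ?N" if w: "w \<in> carrier (Obj Dist \<kappa>)" and n: "n \<in> ?N" for w n
  proof (rule ccontr)
    have nM: "n \<in> carrier M" by (rule D(1)[OF n])
    assume "bact w n \<notin> ?N"
    then obtain \<omega> where \<omega>: "linear_map M \<kappa> \<omega>" "\<forall>n\<in>?N. \<omega> n = \<zero>\<^bsub>K\<^esub>" "\<omega> (bact w n) = \<one>\<^bsub>K\<^esub>"
      using separating_functional[OF module_M N0 bact(1)[OF w nM]] by blast
    note F = mcoef[OF \<omega>(1) nM] and Z = zero_mcoef[OF \<omega>(1) nM]
    have "mcoef \<omega> n = \<zero>\<^bsub>K\<^esub> \<odot>\<^bsub>Obj AG \<kappa>\<^esub> mcoef \<omega> n"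
    proof (rule FUN_ext[OF F(1) Z(1) self_A])
      fix S f g assume S: "S \<in> A" and "f \<in> hm \<kappa> S" and g: "g \<in> carrier (Obj G S)"
      then have f: "f = smap S" by (simp add: hm_self)
      interpret s: vector_tensor K M S using S by (rule vector_tensor_M)
      have "tens K M S n \<one>\<^bsub>S\<^esub> \<in> N S"
        using s.qcoh_sub_tens[OF N0 n s.S.one_closed] unfolding QC_eq_qcoh_sub[OF QC] .
      then have "act \<rho> S g (tens K M S n \<one>\<^bsub>S\<^esub>) \<in> qcoh_sub K M ?N S"
        unfolding QC_eq_qcoh_sub[OF QC] by (rule QC_D(4)[OF QC S g])
      then have "mcoef \<omega> n (along S (smap S)) g = \<zero>\<^bsub>S\<^esub>"
        unfolding F(2)[OF S g] by (rule s.contract_vanish[OF N0 \<omega>(1,2)])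
      then show "mcoef \<omega> n (along S f) g = (\<zero>\<^bsub>K\<^esub> \<odot>\<^bsub>Obj AG \<kappa>\<^esub> mcoef \<omega> n) (along S f) g"
        unfolding f using Z(3)[OF S g] by simp
    qed
    then have "\<one>\<^bsub>K\<^esub> = \<zero>\<^bsub>K\<^esub>"
      using F(3)[OF w] Z(2)[OF w] \<omega>(3) by simp
    then show False using K.one_not_zero by simp
  qed
  then show ?thesis
    using submodule.axioms(1)[OF N0] by (simp add: act_submodules_def)
qed

lemma submodules_correspond:
  "bij_betw (base_points K M) (qcoh_G_submodules K G (qcoh K M) \<rho>)
     (act_submodules (Obj (dist_algebra K G) \<kappa>) M bact)"
  by (rule bij_betw_byWitness[where f' = "qcoh_sub K M"])
    (use QC_eq_qcoh_sub base_points_qcoh_sub SUB_submodule base_points_in_SUB qcoh_sub_in_QC in blast)+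

end

theorem corollary0p6:
  fixes K :: "'u ring" and G :: "('u, 'g) mon_functor"
  assumes "infinite (UNIV :: 'u set)"
    and "field K"
    and "monoid_functor K G"
    and "reflexive K (fun_functor K G)"
  shows
    "(\<forall>(M :: ('u, 'm) mod_functor) \<rho> (M' :: ('u, 'n) mod_functor) \<rho>' \<phi>.
        module_functor K M \<and> reflexive K M \<and> \<rho> \<in> monoid_trans K G (END K M) \<and>
        module_functor K M' \<and> reflexive K M' \<and> \<rho>' \<in> monoid_trans K G (END K M') \<and>
        \<phi> \<in> lin_trans K M M' \<longrightarrow>
        (G_morphism K G M \<rho> M' \<rho>' \<phi> \<longleftrightarrow>
         \<phi> (self K) \<in> act_hom (Obj (dist_algebra K G) (self K))
           (Obj M (self K)) (act (extension K G M \<rho>) (self K))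
           (Obj M' (self K)) (act (extension K G M' \<rho>') (self K)))) \<and>
     (\<forall>(M :: ('u, 'u) module) \<rho>.
        module K M \<and> \<rho> \<in> monoid_trans K G (END K (qcoh K M)) \<longrightarrow>
        (let QC = qcoh_G_submodules K G (qcoh K M) \<rho>;
             SUB = act_submodules (Obj (dist_algebra K G) (self K)) M
                     (base_act K M (act (extension K G (qcoh K M) \<rho>) (self K)))
         in bij_betw (base_points K M) QC SUB \<and>
            (\<forall>N\<in>SUB. qcoh_sub K M N \<in> QC \<and> base_points K M (qcoh_sub K M N) = N)))"
proof -
  interpret field K by fact
  interpret base_field K by unfold_locales
  interpret G_functor K G by unfold_locales fact
  show ?thesis
  proof (intro conjI allI impI)
    fix M :: "('u, 'm) mod_functor" and M' :: "('u, 'n) mod_functor" and \<rho> \<rho>' \<phi>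
    assume *: "module_functor K M \<and> reflexive K M \<and> \<rho> \<in> monoid_trans K G (END K M) \<and>
        module_functor K M' \<and> reflexive K M' \<and> \<rho>' \<in> monoid_trans K G (END K M') \<and>
        \<phi> \<in> lin_trans K M M'"
    interpret G_module_pair K G M \<rho> M' \<rho>' \<phi>
      by unfold_locales (use * module_functor_imp_linear in blast)+
    \<comment> \<open>The description in \<open>extension\<close> is resolved here: on
      \<open>K\<close>-points both extended actions are \<open>alpha\<close>.\<close>
    note ext = p.act_extension[OF assms(4) self_A] q.act_extension[OF assms(4) self_A]
    have "\<phi> (self K) \<in> hom (add_monoid (Obj M (self K))) (add_monoid (Obj M' (self K)))"
      by (rule homI) (simp_all add: phi_closed phi_add)
    then have "\<phi> (self K) \<in> act_hom (Obj (dist_algebra K G) (self K))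
           (Obj M (self K)) (act (extension K G M \<rho>) (self K))
           (Obj M' (self K)) (act (extension K G M' \<rho>') (self K)) \<longleftrightarrow>
       (\<forall>w\<in>carrier (Obj Dist (self K)). \<forall>m\<in>carrier (Obj M (self K)).
         \<phi> (self K) (p.alpha (self K) w m) = q.alpha (self K) w (\<phi> (self K) m))"
      by (auto simp: act_hom_def ext phi_closed)
    then show "G_morphism K G M \<rho> M' \<rho>' \<phi> \<longleftrightarrow>
         \<phi> (self K) \<in> act_hom (Obj (dist_algebra K G) (self K))
           (Obj M (self K)) (act (extension K G M \<rho>) (self K))
           (Obj M' (self K)) (act (extension K G M' \<rho>') (self K))"
      using G_morphism_imp[OF _ self_A] base_linear_imp[OF assms(1)] by metis
  next
    fix M :: "('u, 'u) module" and \<rho>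
    assume *: "module K M \<and> \<rho> \<in> monoid_trans K G (END K (qcoh K M))"
    interpret qcoh_G_module K G M \<rho>
      by (intro qcoh_G_module.intro qcoh_G_module_axioms.intro base_field_axioms G_functor_axioms)
        (use * assms in blast)+
    show "let QC = qcoh_G_submodules K G (qcoh K M) \<rho>;
             SUB = act_submodules (Obj (dist_algebra K G) (self K)) M
                     (base_act K M (act (extension K G (qcoh K M) \<rho>) (self K)))
         in bij_betw (base_points K M) QC SUB \<and>
            (\<forall>N\<in>SUB. qcoh_sub K M N \<in> QC \<and> base_points K M (qcoh_sub K M N) = N)"
      unfolding Let_def
      using submodules_correspond qcoh_sub_in_QC base_points_qcoh_sub[OF SUB_submodule] by blast
  qed
qed

end
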